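(* Let $\mathbb{K}$ be a field of characteristic $0$, let $\mathbb{K}[[t_1]]$ and $\mathbb{K}[[t_2]]$ be the rings of power series in the variables $t_1$ and $t_2$, and let $A$ be the ring $A := \mathbb{K}[[t_1]] \otimes_{\mathbb{K}} \mathbb{K}[[t_2]]$. Let $\mathfrak{a}$ be the ideal in $A$ generated by $t_1$ and $t_2$, and let $\widehat{A}$ be the $\mathfrak{a}$-adic completion of $A$. Then: (1) The ideal $\mathfrak{a}$ is weakly proregular. (2) The ring $A$ is not noetherian. (3) The ring $\widehat{A}$ is noetherian. (4) The ring $\widehat{A}$ is $\mathfrak{a}$-adically flat over $A$ (i.e. $\widehat{A}$ is $\mathfrak{a}$-adically flat as an $A$-module). (5) The ring $\widehat{A}$ is not flat over $A$.
   Context: The $\mathfrak{a}$-adic completion of $A$ is $\widehat{A} := \lim_{\leftarrow k} A/\mathfrak{a}^{k+1}$. An $A$-module $N$ is $\mathfrak{a}$-torsion if every element of $N$ is annihilated by some power of $\mathfrak{a}$. An $A$-module $M$ is $\mathfrak{a}$-adically flat if $\operatorname{Tor}^A_i(N, M) = 0$ for every $i > 0$ and every $\mathfrak{a}$-torsion $A$-module $N$. Weak proregularity: for a finite sequence $\boldsymbol{a} = (a_1,\ldots,a_n)$ of elements of $A$ and $k \geq 1$, let $\boldsymbol{a}^k := (a_1^k,\ldots,a_n^k)$ and let $\operatorname{K}(A;\boldsymbol{a}^k)$ be the associated Koszul complex, a complex of finite rank free $A$-modules concentrated in degrees $-n,\ldots,0$. These complexes form an inverse system in $k$ (for $n=1$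 the transition $\operatorname{K}(A; a^{k+1}) \to \operatorname{K}(A; a^k)$ is the identity of $A$ in degree $0$ and multiplication by $a$ in degree $-1$; for general $n$ take tensor products). The sequence $\boldsymbol{a}$ is weakly proregular if for every $i<0$ the inverse system $\{\operatorname{H}^i(\operatorname{K}(A;\boldsymbol{a}^k))\}_k$ is pro-zero, i.e. for every $k$ there is $k' \geq k$ such that the homomorphism $\operatorname{H}^i(\operatorname{K}(A;\boldsymbol{a}^{k'})) \to \operatorname{H}^i(\operatorname{K}(A;\boldsymbol{a}^{k}))$ is zero. The ideal $\mathfrak{a}$ is weakly proregular if it is generated by some weakly proregular finite sequence. *)

theory Defs
  imports "HOL-Algebra.Algebra" "HOL-Algebra.Algebraic_Closure_Type"
    "HOL-Computational_Algebra.Formal_Power_Series"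
begin

section \<open>Modules\<close>

text \<open>
  A ring is a HOL-Algebra ring record, a module or an algebra over it is a module record.  The
  fields \<open>mult\<close> and \<open>one\<close> of a record that is only used as a module carry no information.
\<close>

definition module_hom ::
  "('r, 'c) ring_scheme \<Rightarrow> ('r, 'm, 'd) module_scheme \<Rightarrow> ('r, 'n, 'e) module_scheme \<Rightarrow> ('m \<Rightarrow> 'n) set"
  where "module_hom R M N =
    {f \<in> carrier M \<rightarrow> carrier N.
       (\<forall>x\<in>carrier M. \<forall>y\<in>carrier M. f (x \<oplus>\<^bsub>M\<^esub> y) = f x \<oplus>\<^bsub>N\<^esub> f y) \<and>
       (\<forall>r\<in>carrier R. \<forall>x\<in>carrier M. f (r \<odot>\<^bsub>M\<^esub> x) = r \<odot>\<^bsub>N\<^esub> f x)}"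

definition submodule_generated ::
  "('r, 'c) ring_scheme \<Rightarrow> ('r, 'm, 'd) module_scheme \<Rightarrow> 'm set \<Rightarrow> 'm set"
  where "submodule_generated R M B = \<Inter>{H. submodule H R M \<and> B \<subseteq> H}"

text \<open>
  The quotient by a submodule \<open>S\<close>: the library's quotient (elements are cosets, also
  with the induced multiplication in case \<open>S\<close> is an ideal), with scalar multiplication added.
\<close>

definition quotient_module :: "('r, 'm, 'd) module_scheme \<Rightarrow> 'm set \<Rightarrow> ('r, 'm set) module"
  where "quotient_module M S =
    ring.extend (M Quot S) (module.fields (\<lambda>r C. \<Union>x\<in>C. S +>\<^bsub>M\<^esub> (r \<odot>\<^bsub>M\<^esub> x)))"

text \<open>The free module with basis \<open>B\<close>, as finitely supported functions.\<close>

definition support :: "('r, 'c) ring_scheme \<Rightarrow> ('x \<Rightarrow> 'r) \<Rightarrow> 'x set"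
  where "support R f = {x. f x \<noteq> \<zero>\<^bsub>R\<^esub>}"

definition free_module :: "('r, 'c) ring_scheme \<Rightarrow> 'x set \<Rightarrow> ('r, 'x \<Rightarrow> 'r) module"
  where "free_module R B =
    \<lparr>carrier = {f. range f \<subseteq> carrier R \<and> finite (support R f) \<and> support R f \<subseteq> B},
     monoid.mult = undefined, monoid.one = undefined,
     ring.zero = (\<lambda>_. \<zero>\<^bsub>R\<^esub>),
     ring.add = (\<lambda>f g x. f x \<oplus>\<^bsub>R\<^esub> g x),
     module.smult = (\<lambda>r f x. r \<otimes>\<^bsub>R\<^esub> f x)\<rparr>"

definition free_basis :: "('r, 'c) ring_scheme \<Rightarrow> 'x \<Rightarrow> 'x \<Rightarrow> 'r"
  where "free_basis R x = (\<lambda>y. if y = x then \<one>\<^bsub>R\<^esub> else \<zero>\<^bsub>R\<^esub>)"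


section \<open>Tensor products\<close>

text \<open>
  \<open>M \<otimes>\<^sub>R N\<close> is the free \<open>R\<close>-module on \<open>M \<times> N\<close> modulo the bilinearity relations.  The free module
  is also given the product that is bilinear and multiplies basis elements componentwise, so that
  for two \<open>R\<close>-algebras the quotient is their tensor product as an algebra, with
  \<open>(m \<otimes> n) (m' \<otimes> n') = m m' \<otimes> n n'\<close>.
\<close>

definition pre_tensor ::
  "('r, 'c) ring_scheme \<Rightarrow> ('r, 'm, 'd) module_scheme \<Rightarrow> ('r, 'n, 'e) module_scheme
    \<Rightarrow> ('r, 'm \<times> 'n \<Rightarrow> 'r) module"
  where "pre_tensor R M N = (free_module R (carrier M \<times> carrier N))
    \<lparr>monoid.mult := (\<lambda>f g q.
       \<Oplus>\<^bsub>R\<^esub>z\<in>{(x, y). x \<in> support R f \<and> y \<in> support R g \<and>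
                (fst x \<otimes>\<^bsub>M\<^esub> fst y, snd x \<otimes>\<^bsub>N\<^esub> snd y) = q}. f (fst z) \<otimes>\<^bsub>R\<^esub> g (snd z)),
     monoid.one := free_basis R (\<one>\<^bsub>M\<^esub>, \<one>\<^bsub>N\<^esub>)\<rparr>"

definition tensor_generators ::
  "('r, 'c) ring_scheme \<Rightarrow> ('r, 'm, 'd) module_scheme \<Rightarrow> ('r, 'n, 'e) module_scheme
    \<Rightarrow> ('m \<times> 'n \<Rightarrow> 'r) set"
  where "tensor_generators R M N =
    (let P = pre_tensor R M N; e = free_basis R in
       {e (m \<oplus>\<^bsub>M\<^esub> m', n) \<ominus>\<^bsub>P\<^esub> (e (m, n) \<oplus>\<^bsub>P\<^esub> e (m', n)) | m m' n.
          m \<in> carrier M \<and> m' \<in> carrier M \<and> n \<in> carrier N} \<union>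
       {e (m, n \<oplus>\<^bsub>N\<^esub> n') \<ominus>\<^bsub>P\<^esub> (e (m, n) \<oplus>\<^bsub>P\<^esub> e (m, n')) | m n n'.
          m \<in> carrier M \<and> n \<in> carrier N \<and> n' \<in> carrier N} \<union>
       {e (r \<odot>\<^bsub>M\<^esub> m, n) \<ominus>\<^bsub>P\<^esub> (r \<odot>\<^bsub>P\<^esub> e (m, n)) | r m n.
          r \<in> carrier R \<and> m \<in> carrier M \<and> n \<in> carrier N} \<union>
       {e (m, r \<odot>\<^bsub>N\<^esub> n) \<ominus>\<^bsub>P\<^esub> (r \<odot>\<^bsub>P\<^esub> e (m, n)) | r m n.
          r \<in> carrier R \<and> m \<in> carrier M \<and> n \<in> carrier N})"

definition tensor_relations ::
  "('r, 'c) ring_scheme \<Rightarrow> ('r, 'm, 'd) module_scheme \<Rightarrow> ('r, 'n, 'e) module_scheme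
    \<Rightarrow> ('m \<times> 'n \<Rightarrow> 'r) set"
  where "tensor_relations R M N =
    submodule_generated R (pre_tensor R M N) (tensor_generators R M N)"

definition tensor_product ::
  "('r, 'c) ring_scheme \<Rightarrow> ('r, 'm, 'd) module_scheme \<Rightarrow> ('r, 'n, 'e) module_scheme
    \<Rightarrow> ('r, ('m \<times> 'n \<Rightarrow> 'r) set) module"
  where "tensor_product R M N = quotient_module (pre_tensor R M N) (tensor_relations R M N)"

definition pure_tensor ::
  "('r, 'c) ring_scheme \<Rightarrow> ('r, 'm, 'd) module_scheme \<Rightarrow> ('r, 'n, 'e) module_scheme
    \<Rightarrow> 'm \<Rightarrow> 'n \<Rightarrow> ('m \<times> 'n \<Rightarrow> 'r) set"
  where "pure_tensor R M N m n =
    tensor_relations R M N +>\<^bsub>pre_tensor R M N\<^esub> free_basis R (m, n)"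

text \<open>The map \<open>f \<otimes> g : M \<otimes> N \<rightarrow> M' \<otimes> N'\<close>, computed on representatives.\<close>

definition tensor_map ::
  "('r, 'c) ring_scheme \<Rightarrow> ('r, 'm, 'd) module_scheme \<Rightarrow> ('r, 'n, 'e) module_scheme
    \<Rightarrow> ('m1 \<Rightarrow> 'm) \<Rightarrow> ('n1 \<Rightarrow> 'n) \<Rightarrow> ('m1 \<times> 'n1 \<Rightarrow> 'r) set \<Rightarrow> ('m \<times> 'n \<Rightarrow> 'r) set"
  where "tensor_map R M' N' f g C =
    (\<Union>h\<in>C. tensor_relations R M' N' +>\<^bsub>pre_tensor R M' N'\<^esub>
       (\<lambda>q. \<Oplus>\<^bsub>R\<^esub>x\<in>{x \<in> support R h. map_prod f g x = q}. h x))"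


section \<open>Homology\<close>

text \<open>
  A complex is given by modules \<open>C i\<close> and differentials \<open>d i : C i \<rightarrow> C (i - 1)\<close> for \<open>i :: nat\<close>,
  where \<open>d 0\<close> has to be zero (truncated subtraction makes it a map \<open>C 0 \<rightarrow> C 0\<close>).
  Cohomological degree \<open>-i\<close> is homological degree \<open>i\<close>.
\<close>

definition boundaries ::
  "(nat \<Rightarrow> ('r, 'm) module) \<Rightarrow> (nat \<Rightarrow> 'm \<Rightarrow> 'm) \<Rightarrow> nat \<Rightarrow> 'm set"
  where "boundaries C d i = d (Suc i) ` carrier (C (Suc i))"

definition homology ::
  "(nat \<Rightarrow> ('r, 'm) module) \<Rightarrow> (nat \<Rightarrow> 'm \<Rightarrow> 'm) \<Rightarrow> nat \<Rightarrow> ('r, 'm set) module"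
  where "homology C d i =
    quotient_module (C i\<lparr>carrier := a_kernel (C i) (C (i - 1)) (d i)\<rparr>) (boundaries C d i)"

text \<open>The map to \<open>H\<^sub>i(C, d)\<close> induced by a chain map that is \<open>\<phi>\<close> in degree \<open>i\<close>.\<close>

definition homology_map ::
  "(nat \<Rightarrow> ('r, 'm) module) \<Rightarrow> (nat \<Rightarrow> 'm \<Rightarrow> 'm) \<Rightarrow> nat \<Rightarrow> ('l \<Rightarrow> 'm) \<Rightarrow> 'l set \<Rightarrow> 'm set"
  where "homology_map C d i \<phi> c = (\<Union>z\<in>c. boundaries C d i +>\<^bsub>C i\<^esub> \<phi> z)"


section \<open>Koszul complexes and weak proregularity\<close>

text \<open>
  The tensor product of the complexes \<open>K(R; a\<^sub>j)\<close>, \<open>j < n\<close>, written out: in cohomological degree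
  \<open>-p\<close> it is free on the \<open>p\<close>-element subsets \<open>S\<close> of \<open>{..<n}\<close> (\<open>S\<close> stands for the tensor
  product of the degree \<open>-1\<close> generators of the factors \<open>j \<in> S\<close> and the degree \<open>0\<close> generators of
  the others), and the differential sends the basis element \<open>S\<close> to the sum over \<open>j \<in> S\<close> of
  \<open>(-1) ^ card {l \<in> S. l < j} * a\<^sub>j\<close> times the basis element \<open>S - {j}\<close>.
\<close>

definition koszul :: "('r, 'c) ring_scheme \<Rightarrow> 'r list \<Rightarrow> nat \<Rightarrow> ('r, nat set \<Rightarrow> 'r) module"
  where "koszul R as p = free_module R {S. S \<subseteq> {..<length as} \<and> card S = p}"

definition koszul_diff ::
  "('r, 'c) ring_scheme \<Rightarrow> 'r list \<Rightarrow> nat \<Rightarrow> (nat set \<Rightarrow> 'r) \<Rightarrow> nat set \<Rightarrow> 'r"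
  where "koszul_diff R as p f = (\<lambda>T.
    if T \<subseteq> {..<length as}
    then \<Oplus>\<^bsub>R\<^esub>j\<in>{..<length as} - T.
           ((\<ominus>\<^bsub>R\<^esub> \<one>\<^bsub>R\<^esub>) [^]\<^bsub>R\<^esub> card {l \<in> T. l < j}) \<otimes>\<^bsub>R\<^esub> ((as ! j) \<otimes>\<^bsub>R\<^esub> f (insert j T))
    else \<zero>\<^bsub>R\<^esub>)"

definition seq_power :: "('r, 'c) ring_scheme \<Rightarrow> 'r list \<Rightarrow> nat \<Rightarrow> 'r list"
  where "seq_power R as k = map (\<lambda>a. a [^]\<^bsub>R\<^esub> k) as"

text \<open>
  The transition \<open>K(R; a\<^sup>k\<^sup>+\<^sup>m) \<rightarrow> K(R; a\<^sup>k)\<close>, the \<open>m\<close>-fold composite of the basic ones: it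
  multiplies the basis element \<open>S\<close> by the product of the \<open>a\<^sub>j\<^sup>m\<close> with \<open>j \<in> S\<close>.
\<close>

definition koszul_transition ::
  "('r, 'c) ring_scheme \<Rightarrow> 'r list \<Rightarrow> nat \<Rightarrow> (nat set \<Rightarrow> 'r) \<Rightarrow> nat set \<Rightarrow> 'r"
  where "koszul_transition R as m f = (\<lambda>S.
    if S \<subseteq> {..<length as}
    then (\<Otimes>\<^bsub>R\<^esub>j\<in>S. (as ! j) [^]\<^bsub>R\<^esub> m) \<otimes>\<^bsub>R\<^esub> f S
    else \<zero>\<^bsub>R\<^esub>)"

definition koszul_homology ::
  "('r, 'c) ring_scheme \<Rightarrow> 'r list \<Rightarrow> nat \<Rightarrow> ('r, (nat set \<Rightarrow> 'r) set) module"
  where "koszul_homology R as = homology (koszul R as) (koszul_diff R as)"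

definition weakly_proregular_seq :: "('r, 'c) ring_scheme \<Rightarrow> 'r list \<Rightarrow> bool"
  where "weakly_proregular_seq R as \<longleftrightarrow>
    (\<forall>i>0. \<forall>k>0. \<exists>k'\<ge>k. \<forall>c\<in>carrier (koszul_homology R (seq_power R as k') i).
       homology_map (koszul R (seq_power R as k)) (koszul_diff R (seq_power R as k)) i
         (koszul_transition R as (k' - k)) c
       = \<zero>\<^bsub>koszul_homology R (seq_power R as k) i\<^esub>)"

definition weakly_proregular :: "('r, 'c) ring_scheme \<Rightarrow> 'r set \<Rightarrow> bool"
  where "weakly_proregular R I \<longleftrightarrow>
    (\<exists>as. set as \<subseteq> carrier R \<and> I = Idl\<^bsub>R\<^esub> (set as) \<and> weakly_proregular_seq R as)"


section \<open>Tor\<close>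

text \<open>
  The standard free resolution \<open>\<dots> \<rightarrow> F\<^sub>1 \<rightarrow> F\<^sub>0 \<rightarrow> N\<close>: the basis of \<open>F\<^sub>0\<close> is the set of all
  elements of \<open>N\<close> (as \<open>Gen x\<close>), and that of \<open>F\<^sub>k\<^sub>+\<^sub>1\<close> is the set of all formal linear combinations of
  basis elements of \<open>F\<^sub>k\<close> whose value lies in the kernel of \<open>F\<^sub>k \<rightarrow> F\<^sub>k\<^sub>-\<^sub>1\<close> (of \<open>F\<^sub>0 \<rightarrow> N\<close> if \<open>k = 0\<close>).
  The datatype provides one type for the bases in all degrees.
\<close>

datatype ('r, 'n) res_gen = Gen 'n | Syz "('r \<times> ('r, 'n) res_gen) list"

definition linear_combination ::
  "('r, 'c) ring_scheme \<Rightarrow> ('r \<times> 'x) list \<Rightarrow> 'x \<Rightarrow> 'r"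
  where "linear_combination R xs =
    (let F = free_module R UNIV
     in foldr (\<lambda>(c, x) f. (c \<odot>\<^bsub>F\<^esub> free_basis R x) \<oplus>\<^bsub>F\<^esub> f) xs \<zero>\<^bsub>F\<^esub>)"

fun gen_boundary :: "('r, 'c) ring_scheme \<Rightarrow> ('r, 'n) res_gen \<Rightarrow> ('r, 'n) res_gen \<Rightarrow> 'r"
  where
    "gen_boundary R (Gen x) = (\<lambda>_. \<zero>\<^bsub>R\<^esub>)"
  | "gen_boundary R (Syz xs) = linear_combination R xs"

text \<open>
  The linear extension of \<^const>\<open>gen_boundary\<close>; it does not depend on the degree and vanishes on
  \<open>F\<^sub>0\<close>, in accordance with the convention for complexes.
\<close>

definition res_diff ::
  "('r, 'c) ring_scheme \<Rightarrow> nat \<Rightarrow> (('r, 'n) res_gen \<Rightarrow> 'r) \<Rightarrow> ('r, 'n) res_gen \<Rightarrow> 'r"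
  where "res_diff R k f =
    (let F = free_module R UNIV in \<Oplus>\<^bsub>F\<^esub>x\<in>support R f. f x \<odot>\<^bsub>F\<^esub> gen_boundary R x)"

definition res_augmentation ::
  "('r, 'c) ring_scheme \<Rightarrow> ('r, 'n, 'd) module_scheme \<Rightarrow> (('r, 'n) res_gen \<Rightarrow> 'r) \<Rightarrow> 'n"
  where "res_augmentation R N f =
    (\<Oplus>\<^bsub>N\<^esub>x\<in>{x \<in> carrier N. Gen x \<in> support R f}. f (Gen x) \<odot>\<^bsub>N\<^esub> x)"

primrec res_basis ::
  "('r, 'c) ring_scheme \<Rightarrow> ('r, 'n, 'd) module_scheme \<Rightarrow> nat \<Rightarrow> ('r, 'n) res_gen set"
  where
    "res_basis R N 0 = Gen ` carrier N"
  | "res_basis R N (Suc k) =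
      Syz ` {xs. set xs \<subseteq> carrier R \<times> res_basis R N k \<and>
               (if k = 0 then res_augmentation R N (linear_combination R xs) = \<zero>\<^bsub>N\<^esub>
                else res_diff R k (linear_combination R xs) = (\<lambda>_. \<zero>\<^bsub>R\<^esub>))}"

definition resolution ::
  "('r, 'c) ring_scheme \<Rightarrow> ('r, 'n, 'd) module_scheme \<Rightarrow> nat \<Rightarrow> ('r, ('r, 'n) res_gen \<Rightarrow> 'r) module"
  where "resolution R N k = free_module R (res_basis R N k)"

definition Tor ::
  "('r, 'c) ring_scheme \<Rightarrow> nat \<Rightarrow> ('r, 'n, 'd) module_scheme \<Rightarrow> ('r, 'm, 'e) module_scheme
    \<Rightarrow> ('r, ((('r, 'n) res_gen \<Rightarrow> 'r) \<times> 'm \<Rightarrow> 'r) set set) module"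
  where "Tor R i N M =
    homology (\<lambda>k. tensor_product R (resolution R N k) M)
      (\<lambda>k. tensor_map R (resolution R N (k - 1)) M (res_diff R k) (\<lambda>x. x)) i"


section \<open>Adic completion, adic flatness and flatness\<close>

definition ideal_power :: "('r, 'c) ring_scheme \<Rightarrow> 'r set \<Rightarrow> nat \<Rightarrow> 'r set"
  where "ideal_power R I k = I [^]\<^bsub>ideals_set R\<^esub> k"

text \<open>
  The inverse limit of the rings \<open>R / I\<^sup>k\<^sup>+\<^sup>1\<close>, as an \<open>R\<close>-algebra.  The transition map sends a coset
  \<open>C\<close> of \<open>I\<^sup>k\<^sup>+\<^sup>2\<close> to the coset \<open>I\<^sup>k\<^sup>+\<^sup>1 + C\<close>.
\<close>

definition adic_completion :: "('r, 'c) ring_scheme \<Rightarrow> 'r set \<Rightarrow> ('r, nat \<Rightarrow> 'r set) module"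
  where "adic_completion R I =
    (let J = (\<lambda>k. ideal_power R I (Suc k)); Q = (\<lambda>k. R Quot J k) in
    \<lparr>carrier = {x. \<forall>k. x k \<in> carrier (Q k) \<and> J k <+>\<^bsub>R\<^esub> x (Suc k) = x k},
     monoid.mult = (\<lambda>x y k. x k \<otimes>\<^bsub>Q k\<^esub> y k),
     monoid.one = (\<lambda>k. \<one>\<^bsub>Q k\<^esub>),
     ring.zero = (\<lambda>k. \<zero>\<^bsub>Q k\<^esub>),
     ring.add = (\<lambda>x y k. x k \<oplus>\<^bsub>Q k\<^esub> y k),
     module.smult = (\<lambda>r x k. (J k +>\<^bsub>R\<^esub> r) \<otimes>\<^bsub>Q k\<^esub> x k)\<rparr>)"

definition adic_torsion :: "('r, 'c) ring_scheme \<Rightarrow> 'r set \<Rightarrow> ('r, 'n, 'd) module_scheme \<Rightarrow> bool"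
  where "adic_torsion R I N \<longleftrightarrow>
    (\<forall>x\<in>carrier N. \<exists>k. \<forall>r\<in>ideal_power R I k. r \<odot>\<^bsub>N\<^esub> x = \<zero>\<^bsub>N\<^esub>)"

text \<open>
  HOL cannot quantify over all modules, only over those whose carrier is a set of elements of a given
  type; this type is passed as the first argument of the next two predicates.  For an assertion of
  adic flatness the type should be arbitrary.  For flatness over \<open>R\<close> the type of the elements of \<open>R\<close>
  is already enough, because it accommodates the inclusions of ideals into \<open>R\<close>; a failure of
  flatness over any one type is a failure of flatness.
\<close>

definition adically_flat ::
  "'n itself \<Rightarrow> ('r, 'c) ring_scheme \<Rightarrow> 'r set \<Rightarrow> ('r, 'm, 'd) module_scheme \<Rightarrow> bool"
  where "adically_flat T R I M \<longleftrightarrow>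
    (\<forall>N :: ('r, 'n) module. module R N \<and> adic_torsion R I N \<longrightarrow>
       (\<forall>i>0. carrier (Tor R i N M) = {\<zero>\<^bsub>Tor R i N M\<^esub>}))"

definition flat ::
  "'n itself \<Rightarrow> ('r, 'c) ring_scheme \<Rightarrow> ('r, 'm, 'd) module_scheme \<Rightarrow> bool"
  where "flat T R M \<longleftrightarrow>
    (\<forall>(N' :: ('r, 'n) module) (N :: ('r, 'n) module) f.
       module R N' \<and> module R N \<and> f \<in> module_hom R N' N \<and> inj_on f (carrier N') \<longrightarrow>
       inj_on (tensor_map R N M f (\<lambda>x. x)) (carrier (tensor_product R N' M)))"


section \<open>Power series\<close>

definition fps_algebra :: "('k::field, 'k fps) module"
  where "fps_algebra =
    \<lparr>carrier = UNIV, monoid.mult = (*), monoid.one = 1, ring.zero = 0, ring.add = (+), module.smult = (\<lambda>c f. fps_const c * f)\<rparr>"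

end

theory Submission
  imports Defs "HOL-Library.Product_Plus"
begin

text \<open>
  Write \<open>x\<close>, \<open>y\<close> for the two variables.  A tensor \<open>\<Sum>u\<^sub>i \<otimes> v\<^sub>i\<close> is determined by the series
  \<open>\<Sum>u\<^sub>i(x) v\<^sub>i(y)\<close>, because a linear relation among such series is a consequence of bilinearity alone
  (\<open>fps_tensor_relation\<close>).  So \<open>A\<close> is the subring \<open>split_series\<close> of \<open>K[[x, y]]\<close>, realised as power
  series in \<open>x\<close> over \<open>K[[y]]\<close>.  This subring is stable under dividing by \<open>x\<close>, and it contains
  \<open>K[[y]]\<close> and \<open>x\<close>, so that it is dense for the order filtration; the powers of the ideal \<open>(x, y)\<close> of \<open>A\<close>
  are cut out by that filtration, and the completion is all of \<open>K[[x, y]]\<close>.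

  (1) If \<open>x\<^sup>k p + y\<^sup>k q = 0\<close> in \<open>A\<close> then \<open>q\<close> is divisible by \<open>x\<^sup>k\<close> in \<open>K[[x, y]]\<close>, hence in \<open>A\<close>.  So
  \<open>(x\<^sup>k, y\<^sup>k)\<close> is a regular sequence and its Koszul complex is acyclic in negative degrees.

  (2) and (5) rest on one statement (\<open>lacunary_diagonal\<close>).  Let \<open>f\<close> be a power series transcendental
  over \<open>K(x)\<close>.  If \<open>b (f(x) - f(y)) = (x - y) c\<close> with \<open>b, c\<close> in \<open>A\<close>, then \<open>b(0, 0) = 0\<close>.  The
  reason: there is a \<open>K\<close>-linear map \<open>D\<close> on power series that commutes with \<open>x\<close> and satisfies
  \<open>D(f u) = f D(u) + u\<close>.  Applying \<open>D\<close> to the functions of \<open>x\<close> and then putting \<open>y = x\<close> kills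
  \<open>(x - y) c\<close> and turns the left side into \<open>b(x, x)\<close>.
  For (5), \<open>f(x) - f(y) = (x - y) h\<close> holds in \<open>K[[x, y]]\<close>.  Over \<open>A\<close> this relation between \<open>f(x) - f(y)\<close>
  and \<open>x - y\<close> is not a combination of relations with coefficients in \<open>A\<close>: by the statement above, the
  coefficient of \<open>f(x) - f(y)\<close> in an element of the ideal \<open>J = (f(x) - f(y), x - y)\<close> is well defined
  at the origin, which separates \<open>(f(x) - f(y)) \<otimes> 1\<close> from \<open>(x - y) \<otimes> h\<close> in \<open>J \<otimes> K[[x, y]]\<close>, while
  the two agree in \<open>A \<otimes> K[[x, y]]\<close>.
  For (2), let \<open>g\<^sub>n\<close> be \<open>f\<^sub>n(x) - f\<^sub>n(y)\<close>, where \<open>f\<^sub>n\<close> is \<open>f\<close> with its first \<open>n\<close> coefficients shifted out.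
  Modulo \<open>x - y\<close> one has \<open>g\<^sub>n = x g\<^sub>n\<^sub>+\<^sub>1\<close>, so the ideals \<open>(g\<^sub>n, x - y)\<close> increase, and if they became
  stationary then \<open>(1 - r x) (f(x) - f(y))\<close> would be a multiple of \<open>x - y\<close> in \<open>A\<close> for some
  \<open>r\<close>, although \<open>1 - r x\<close> is \<open>1\<close> at the origin.

  (3) Ideals of \<open>K[[y]][[x]]\<close> are finitely generated by comparing lowest coefficients, which lie in
  the discrete valuation ring \<open>K[[y]]\<close>.

  (4) From \<open>K[[x, y]] = K[[y]] + x K[[x, y]]\<close> and the stability of \<open>A\<close> under division by \<open>x\<close> it follows
  that \<open>x\<close> acts bijectively on \<open>K[[x, y]] / A\<close>.  A torsion module \<open>N\<close> is \<open>x\<close>-torsion, and on a free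
  resolution of \<open>N\<close> powers of \<open>x\<close> are locally null-homotopic (\<open>torsion_homotopy\<close>).  A cycle with
  coefficients in \<open>K[[x, y]]\<close> is therefore homologous to one with coefficients in \<open>A\<close>, and this one is
  a boundary, because the resolution is exact (\<open>Tor_torsion_eq_zero\<close>).
\<close>

section \<open>Sums of products of one-variable series\<close>

text \<open>
  Series in \<open>x\<close> and \<open>y\<close> are series in \<open>x\<close> whose coefficients are series in \<open>y\<close>.
\<close>

definition left_series :: "'k::field fps \<Rightarrow> 'k fps fps"
  where "left_series u = Abs_fps (\<lambda>i. fps_const (u $ i))"

abbreviation right_series :: "'k::field fps \<Rightarrow> 'k fps fps"
  where "right_series \<equiv> fps_const"

definition split_sum :: "('k::field fps \<times> 'k fps) list \<Rightarrow> 'k fps fps"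
  where "split_sum xs = (\<Sum>(u, v)\<leftarrow>xs. left_series u * right_series v)"

lemma left_series_nth [simp]: "left_series u $ i = fps_const (u $ i)"
  by (simp add: left_series_def)

lemma left_series_0 [simp]: "left_series 0 = 0"
  by (simp add: fps_eq_iff)

lemma left_series_1 [simp]: "left_series 1 = 1"
  by (simp add: fps_eq_iff)

lemma left_series_X [simp]: "left_series fps_X = fps_X"
  by (simp add: fps_eq_iff fps_X_def)

lemma left_series_const [simp]: "left_series (fps_const c) = fps_const (fps_const c)"
  by (simp add: fps_eq_iff)

lemma left_series_add: "left_series (u + v) = left_series u + left_series v"
  by (simp add: fps_eq_iff)

lemma left_series_uminus: "left_series (- u) = - left_series u"
  by (simp add: fps_eq_iff fps_const_neg[symmetric] del: fps_const_neg)

lemma fps_const_sum: "fps_const (sum f A) = (\<Sum>x\<in>A. fps_const (f x))"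
  by (induct A rule: infinite_finite_induct) (auto simp del: fps_const_add simp: fps_const_add[symmetric])

lemma left_series_mult: "left_series (u * v) = left_series u * left_series v"
  by (rule fps_ext) (simp add: fps_mult_nth fps_const_sum)

lemma split_sum_Nil [simp]: "split_sum [] = 0"
  and split_sum_Cons [simp]: "split_sum ((u, v) # xs) = left_series u * right_series v + split_sum xs"
  and split_sum_append [simp]: "split_sum (xs @ ys) = split_sum xs + split_sum ys"
  by (auto simp: split_sum_def)

lemma split_sum_nth: "split_sum xs $ i = (\<Sum>(u, v)\<leftarrow>xs. fps_const (u $ i) * v)"
  by (induct xs) auto

text \<open>
  The vanishing of \<open>\<Sum>u\<^sub>i(x) v\<^sub>i(y)\<close> is rewritten as \<open>\<Sum>\<^sub>j w\<^sub>j(x) (\<Sum>\<^sub>i c\<^sub>i\<^sub>j v\<^sub>i(y))\<close> with every inner sum zero, and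
  in this form it holds for \<open>\<Sum>u\<^sub>i \<otimes> v\<^sub>i\<close> in any tensor product.  This is Gaussian elimination: a
  nonzero coefficient of some \<open>u\<^sub>p\<close> expresses \<open>v\<^sub>p\<close> through the other \<open>v\<^sub>i\<close>, and one summand disappears.
\<close>

lemma fps_tensor_relation:
  fixes u v :: "'i \<Rightarrow> 'k::field fps"
  assumes "finite I"
    and "\<And>m. (\<Sum>i\<in>I. fps_const (u i $ m) * v i) = 0"
  shows "\<exists>J c w. J \<subseteq> I \<and> (\<forall>i\<in>I. u i = (\<Sum>j\<in>J. fps_const (c i j) * w j)) \<and>
    (\<forall>j\<in>J. (\<Sum>i\<in>I. fps_const (c i j) * v i) = 0)"
  using assms
proof (induct "card I" arbitrary: I u)
  case 0
  then show ?case by auto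
next
  case (Suc n)
  show ?case
  proof (cases "\<forall>i\<in>I. u i = 0")
    case True
    then show ?thesis by (intro exI[of _ "{}"]) auto
  next
    case False
    then obtain p m0 where p: "p \<in> I" and a: "u p $ m0 \<noteq> 0"
      by (auto simp: fps_eq_iff)
    define a where "a = u p $ m0"
    define I' where "I' = I - {p}"
    define u' where "u' i = u i - fps_const (u i $ m0 / a) * u p" for i
    have I: "finite I'" "p \<notin> I'" "I = insert p I'" "card I' = n"
      using Suc p by (auto simp: I'_def)
    have a0: "a \<noteq> 0" using a by (simp add: a_def)
    have rel: "(\<Sum>i\<in>I'. fps_const (u i $ m) * v i) = - fps_const (u p $ m) * v p" for m
      using Suc(4)[of m] I by (simp add: eq_neg_iff_add_eq_0 add.commute del: fps_const_neg)
    have "(\<Sum>i\<in>I'. fps_const (u' i $ m) * v i) = 0" for m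
    proof -
      have "(\<Sum>i\<in>I'. fps_const (u' i $ m) * v i)
          = (\<Sum>i\<in>I'. fps_const (u i $ m) * v i - fps_const (u p $ m / a) * (fps_const (u i $ m0) * v i))"
        by (rule sum.cong) (auto simp: u'_def fps_eq_iff algebra_simps)
      also have "\<dots> = - fps_const (u p $ m) * v p
          - fps_const (u p $ m / a) * (- fps_const (u p $ m0) * v p)"
        by (simp only: sum_subtractf sum_distrib_left[symmetric] rel)
      also have "\<dots> = 0"
        using a0 by (simp add: fps_eq_iff a_def)
      finally show ?thesis .
    qed
    from Suc(1)[OF I(4)[symmetric] I(1) this] obtain J c w where J: "J \<subseteq> I'"
      and u': "\<And>i. i \<in> I' \<Longrightarrow> u' i = (\<Sum>j\<in>J. fps_const (c i j) * w j)"
      and c: "\<And>j. j \<in> J \<Longrightarrow> (\<Sum>i\<in>I'. fps_const (c i j) * v i) = 0"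
      by blast
    have fJ: "finite J" and pJ: "p \<notin> J" using J I by (auto intro: finite_subset)
    define c' where "c' i j = (if j = p then u i $ m0 / a else if i = p then 0 else c i j)" for i j
    define w' where "w' j = (if j = p then u p else w j)" for j
    have "u i = (\<Sum>j\<in>insert p J. fps_const (c' i j) * w' j)" if "i \<in> I" for i
    proof (cases "i = p")
      case True
      have "(\<Sum>j\<in>J. fps_const (c' p j) * w' j) = 0"
        using pJ by (intro sum.neutral) (auto simp: c'_def)
      then show ?thesis using True fJ pJ a0 by (simp add: c'_def w'_def a_def)
    next
      case False
      then have "(\<Sum>j\<in>J. fps_const (c' i j) * w' j) = u' i"
        using pJ that I by (subst u') (auto simp: c'_def w'_def intro!: sum.cong)
      then show ?thesis using fJ pJ by (simp add: u'_def) (simp add: c'_def w'_def)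
    qed
    moreover have "(\<Sum>i\<in>I. fps_const (c' i j) * v i) = 0" if "j \<in> insert p J" for j
    proof (cases "j = p")
      case True
      have "(\<Sum>i\<in>I. fps_const (c' i j) * v i) = fps_const (1 / a) * (\<Sum>i\<in>I. fps_const (u i $ m0) * v i)"
        unfolding sum_distrib_left using True by (intro sum.cong) (auto simp: c'_def fps_eq_iff)
      then show ?thesis using Suc(4) by simp
    next
      case False
      then have "(\<Sum>i\<in>I'. fps_const (c' i j) * v i) = 0"
        using that I by (subst c[of j, symmetric]) (auto simp: c'_def intro!: sum.cong)
      then show ?thesis using False I by (simp add: c'_def)
    qed
    moreover have "insert p J \<subseteq> I" using J I by auto
    ultimately show ?thesis by blast
  qed
qed

text \<open>
  A balanced biadditive map depends only on the two-variable series of a formal sum of tensors.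
\<close>

lemma split_sum_eq_0_additive:
  fixes b :: "'k::field fps \<Rightarrow> 'k fps \<Rightarrow> 'g::ab_group_add"
  assumes "split_sum xs = 0"
    and b1: "\<And>u u' v. b (u + u') v = b u v + b u' v"
    and b2: "\<And>u v v'. b u (v + v') = b u v + b u v'"
    and b3: "\<And>c u v. b (fps_const c * u) v = b u (fps_const c * v)"
  shows "(\<Sum>(u, v)\<leftarrow>xs. b u v) = 0"
proof -
  let ?u = "\<lambda>i. fst (xs ! i)" and ?v = "\<lambda>i. snd (xs ! i)"
  have "(\<Sum>i\<in>{..<length xs}. fps_const (?u i $ m) * ?v i) = 0" for m
    using arg_cong[OF assms(1), of "\<lambda>F. F $ m"]
    by (simp add: split_sum_nth sum_list_sum_nth atLeast0LessThan case_prod_beta)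
  from fps_tensor_relation[OF finite_lessThan this] obtain J c w where J: "J \<subseteq> {..<length xs}"
    and u: "\<And>i. i < length xs \<Longrightarrow> ?u i = (\<Sum>j\<in>J. fps_const (c i j) * w j)"
    and c: "\<And>j. j \<in> J \<Longrightarrow> (\<Sum>i<length xs. fps_const (c i j) * ?v i) = 0"
    by (elim exE conjE) (rule that, auto)
  have b10: "b 0 v = 0" and b20: "b u 0 = 0" for u v
    using b1[of 0 0] b2[of _ 0 0] by auto
  have s1: "b (sum f S) v = (\<Sum>x\<in>S. b (f x) v)" for f :: "nat \<Rightarrow> _" and S v
    by (induct S rule: infinite_finite_induct) (auto simp: b1 b10)
  have s2: "b u (sum f S) = (\<Sum>x\<in>S. b u (f x))" for f :: "nat \<Rightarrow> _" and S u
    by (induct S rule: infinite_finite_induct) (auto simp: b2 b20)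
  have "(\<Sum>(u, v)\<leftarrow>xs. b u v) = (\<Sum>i<length xs. b (?u i) (?v i))"
    by (simp add: sum_list_sum_nth atLeast0LessThan case_prod_beta)
  also have "\<dots> = (\<Sum>i<length xs. \<Sum>j\<in>J. b (w j) (fps_const (c i j) * ?v i))"
    by (rule sum.cong) (auto simp: u s1 b3)
  also have "\<dots> = (\<Sum>j\<in>J. b (w j) (\<Sum>i<length xs. fps_const (c i j) * ?v i))"
    by (subst sum.swap) (simp add: s2)
  also have "\<dots> = 0" by (simp add: c b20)
  finally show ?thesis .
qed

section \<open>A transcendental power series\<close>

text \<open>
  \<open>\<Sum>x\<^bsup>k!\<^esup>\<close>, where the equal exponents \<open>0!\<close> and \<open>1!\<close> contribute once.
\<close>

definition lacunary :: "'k::field fps"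
  where "lacunary = Abs_fps (\<lambda>n. if \<exists>k. n = fact k then 1 else 0)"

definition at_lacunary :: "'k::field poly poly \<Rightarrow> 'k fps"
  where "at_lacunary P = poly (map_poly fps_of_poly P) lacunary"

lemma at_lacunary_0 [simp]: "at_lacunary 0 = 0"
  by (simp add: at_lacunary_def)

lemma at_lacunary_pCons [simp]: "at_lacunary (pCons a P) = fps_of_poly a + lacunary * at_lacunary P"
  by (simp add: at_lacunary_def map_poly_pCons)

lemma at_lacunary_1 [simp]: "at_lacunary 1 = 1"
  by (simp add: one_pCons)

lemma at_lacunary_add: "at_lacunary (P + Q) = at_lacunary P + at_lacunary Q"
  by (induct P Q rule: poly_induct2) (auto simp: fps_of_poly_add algebra_simps)

lemma at_lacunary_smult: "at_lacunary (smult a P) = fps_of_poly a * at_lacunary P"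
  by (induct P) (auto simp: fps_of_poly_mult algebra_simps)

lemma at_lacunary_mult: "at_lacunary (P * Q) = at_lacunary P * at_lacunary Q"
  by (induct P) (auto simp: at_lacunary_add at_lacunary_smult algebra_simps)

text \<open>
  Replacing the series by a polynomial \<open>s\<close> changes the value of \<open>P\<close> by a multiple of the error made.
\<close>

lemma at_lacunary_cong_poly: "(lacunary - fps_of_poly s) dvd (at_lacunary P - fps_of_poly (poly P s))"
proof (induct P)
  case (pCons a P)
  have "at_lacunary (pCons a P) - fps_of_poly (poly (pCons a P) s)
      = (lacunary - fps_of_poly s) * at_lacunary P
        + fps_of_poly s * (at_lacunary P - fps_of_poly (poly P s))"
    by (simp add: fps_of_poly_add fps_of_poly_mult algebra_simps)
  then show ?case using pCons by simp
qed auto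

lemma degree_poly_le:
  fixes P :: "'a::comm_semiring_1 poly poly"
  assumes "\<And>i. Polynomial.degree (Polynomial.coeff P i) \<le> m"
  shows "Polynomial.degree (poly P s) \<le> m + Polynomial.degree P * Polynomial.degree s"
  unfolding poly_altdef
proof (rule degree_sum_le)
  fix i assume i: "i \<in> {..Polynomial.degree P}"
  have "Polynomial.degree (Polynomial.coeff P i * s ^ i) \<le> m + Polynomial.degree s * i"
    by (rule order.trans[OF degree_mult_le add_mono[OF assms degree_power_le]])
  also have "\<dots> \<le> m + Polynomial.degree P * Polynomial.degree s"
    using i by simp
  finally show "Polynomial.degree (Polynomial.coeff P i * s ^ i)
      \<le> m + Polynomial.degree P * Polynomial.degree s" .
qed simp

lemma X_power_dvd_iff: "fps_X ^ n dvd (F :: 'a::comm_ring_1 fps) \<longleftrightarrow> (\<forall>i<n. F $ i = 0)"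
proof
  assume "\<forall>i<n. F $ i = 0"
  then have "F = fps_X ^ n * fps_shift n F"
    by (auto simp: fps_eq_iff fps_X_power_mult_nth)
  then show "fps_X ^ n dvd F" by (metis dvd_triv_left)
qed (auto simp: fps_X_power_mult_nth elim!: dvdE)

text \<open>
  The argument of Liouville.  The partial sum \<open>s\<close> of degree \<open>k!\<close> differs from the series by terms of
  order \<open>(k + 1)!\<close>, so \<open>P(s)\<close> vanishes to that order, whereas its degree is at most a constant plus a
  constant times \<open>k!\<close>.  For large \<open>k\<close> this forces \<open>P(s) = 0\<close>, and \<open>P\<close> has infinitely many roots.
\<close>

lemma at_lacunary_eq_0D:
  fixes P :: "'k::field poly poly"
  assumes "at_lacunary P = 0"
  shows "P = 0"
proof (rule ccontr)
  assume "P \<noteq> 0"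
  define m where "m = Max ((\<lambda>i. Polynomial.degree (Polynomial.coeff P i)) ` {..Polynomial.degree P})"
  define d where "d = Polynomial.degree P"
  have m: "Polynomial.degree (Polynomial.coeff P i) \<le> m" for i
    by (cases "i \<le> Polynomial.degree P") (auto simp: m_def coeff_eq_0)
  define s :: "nat \<Rightarrow> 'k poly" where "s k = truncate_fps (Suc (fact k)) lacunary" for k
  have cs: "Polynomial.coeff (s k) n = (if n \<le> fact k then lacunary $ n else 0)" for k n
    by (auto simp: s_def coeff_truncate_fps)
  have deg: "Polynomial.degree (s k) = fact k" for k
    by (rule antisym[OF degree_le le_degree]) (auto simp: cs lacunary_def)
  have root: "poly P (s k) = 0" if k: "k > m + d" for k
  proof (rule poly_eqI)
    fix n
    have low: "n \<le> m + d * fact k \<Longrightarrow> n < fact (Suc k)"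
    proof -
      assume n: "n \<le> m + d * fact k"
      have "m + d * fact k \<le> (m + d) * fact k"
        by (simp add: algebra_simps)
      also have "\<dots> < Suc k * fact k" using k by (intro mult_strict_right_mono) auto
      finally show ?thesis using n by simp
    qed
    have gap: "lacunary $ n = (0::'k)" if "fact k < n" "n < fact (Suc k)" for n
    proof -
      have "n \<noteq> fact l" for l
        using that fact_mono_nat[of l k] fact_mono_nat[of "Suc k" l] by (cases "l \<le> k") force+
      then show ?thesis by (simp add: lacunary_def)
    qed
    have "fps_X ^ fact (Suc k) dvd lacunary - fps_of_poly (s k)"
      unfolding X_power_dvd_iff using gap by (auto simp: cs not_le)
    also have "\<dots> dvd at_lacunary P - fps_of_poly (poly P (s k))"
      by (rule at_lacunary_cong_poly)
    finally have "fps_X ^ fact (Suc k) dvd fps_of_poly (poly P (s k))"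
      using assms by (simp add: dvd_diff_right_iff)
    then have small: "Polynomial.coeff (poly P (s k)) n = 0" if "n < fact (Suc k)"
      using that unfolding X_power_dvd_iff by simp
    show "Polynomial.coeff (poly P (s k)) n = Polynomial.coeff 0 n"
    proof (cases "n \<le> m + d * fact k")
      case True
      then show ?thesis using low small by simp
    next
      case False
      then have "Polynomial.degree (poly P (s k)) < n"
        using degree_poly_le[of P m "s k", OF m] by (simp add: deg d_def)
      then show ?thesis by (simp add: coeff_eq_0)
    qed
  qed
  have "infinite (s ` {m + d<..})"
  proof
    assume "finite (s ` {m + d<..})"
    moreover have "inj_on s {m + d<..}"
    proof (rule inj_onI)
      fix k l assume kl: "k \<in> {m + d<..}" "l \<in> {m + d<..}" "s k = s l"
      then have "fact k = (fact l :: nat)" using deg by metis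
      then show "k = l"
        using kl fact_less_mono_nat[of k l] fact_less_mono_nat[of l k] by (cases k l rule: linorder_cases) auto
    qed
    ultimately show False using finite_imageD infinite_Ioi[of "m + d"] by blast
  qed
  moreover have "s ` {m + d<..} \<subseteq> {x. poly P x = 0}" using root by auto
  ultimately show False using poly_roots_finite[OF \<open>P \<noteq> 0\<close>] finite_subset by blast
qed

lemma at_lacunary_eq_0_iff [simp]: "at_lacunary P = 0 \<longleftrightarrow> P = 0"
  by (auto dest: at_lacunary_eq_0D)

lemma at_lacunary_uminus: "at_lacunary (- P) = - at_lacunary P"
  using at_lacunary_add[of P "- P"] by (simp add: eq_neg_iff_add_eq_0 add.commute)

lemma at_lacunary_diff: "at_lacunary (P - Q) = at_lacunary P - at_lacunary Q"
  using at_lacunary_add[of P "- Q"] by (simp add: at_lacunary_uminus)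

lemma at_lacunary_eq_iff: "at_lacunary P = at_lacunary Q \<longleftrightarrow> P = Q"
  using at_lacunary_eq_0_iff[of "P - Q"] by (simp add: at_lacunary_diff)

section \<open>A linear map that differentiates with respect to the transcendental series\<close>

definition laurent_at :: "'k::field poly poly \<Rightarrow> 'k fls"
  where "laurent_at P = fps_to_fls (at_lacunary P)"

lemma laurent_at_simps:
  "laurent_at 0 = 0" "laurent_at 1 = 1"
  "laurent_at (P + Q) = laurent_at P + laurent_at Q"
  "laurent_at (P * Q) = laurent_at P * laurent_at Q"
  by (simp_all add: laurent_at_def at_lacunary_add at_lacunary_mult fls_times_fps_to_fls)

lemma laurent_at_eq_0_iff [simp]: "laurent_at P = 0 \<longleftrightarrow> P = 0"
  by (simp add: laurent_at_def)

lemma laurent_at_eq_iff: "laurent_at P = laurent_at Q \<longleftrightarrow> P = Q"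
  by (simp add: laurent_at_def at_lacunary_eq_iff)

text \<open>
  The value of a rational function of \<open>x\<close> and a second variable at \<open>lacunary\<close>.  It is well defined
  because \<open>laurent_at\<close> is injective.
\<close>

definition fract_at :: "'k::field poly poly fract \<Rightarrow> 'k fls"
  where "fract_at r = (THE z. \<exists>p q. q \<noteq> 0 \<and> r = Fract p q \<and> z = laurent_at p / laurent_at q)"

lemma fract_at_Fract: "q \<noteq> 0 \<Longrightarrow> fract_at (Fract p q) = laurent_at p / laurent_at q"
  unfolding fract_at_def
  by (rule the_equality) (auto simp: eq_fract frac_eq_eq laurent_at_simps(4)[symmetric] laurent_at_eq_iff)

text \<open>
  The derivative of \<open>p / q\<close> with respect to the second variable, at \<open>lacunary\<close>.
\<close>

definition quotient_rule :: "'k::field poly poly \<Rightarrow> 'k poly poly \<Rightarrow> 'k fls"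
  where "quotient_rule p q =
    (laurent_at (pderiv p) * laurent_at q - laurent_at p * laurent_at (pderiv q)) / (laurent_at q)\<^sup>2"

definition fract_deriv :: "'k::field poly poly fract \<Rightarrow> 'k fls"
  where "fract_deriv r = (THE z. \<exists>p q. q \<noteq> 0 \<and> r = Fract p q \<and> z = quotient_rule p q)"

lemma quotient_rule_cong:
  assumes q: "q \<noteq> 0" "q' \<noteq> 0" and eq: "p * q' = p' * q"
  shows "quotient_rule p q = quotient_rule p' q'"
proof -
  let ?P = "laurent_at p" and ?Q = "laurent_at q" and ?P' = "laurent_at p'" and ?Q' = "laurent_at q'"
  let ?dP = "laurent_at (pderiv p)" and ?dQ = "laurent_at (pderiv q)"
    and ?dP' = "laurent_at (pderiv p')" and ?dQ' = "laurent_at (pderiv q')"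
  have nz: "?Q \<noteq> 0" "?Q' \<noteq> 0" using q by auto
  have e: "?P * ?Q' = ?P' * ?Q"
    using eq by (simp add: laurent_at_simps(4)[symmetric])
  have de: "?P * ?dQ' + ?Q' * ?dP = ?P' * ?dQ + ?Q * ?dP'"
    using arg_cong[OF eq, of "\<lambda>x. laurent_at (pderiv x)"]
    by (simp add: pderiv_mult laurent_at_simps)
  have P': "?P' = ?P * ?Q' / ?Q"
    using nz e by (simp add: field_simps)
  have dP': "?dP' = (?P * ?dQ' + ?Q' * ?dP - ?P' * ?dQ) / ?Q"
    using nz de by (simp add: field_simps)
  show "quotient_rule p q = quotient_rule p' q'"
    unfolding quotient_rule_def dP' P' using nz
    by (simp add: field_simps power2_eq_square)
qed

lemma fract_deriv_Fract: "q \<noteq> 0 \<Longrightarrow> fract_deriv (Fract p q) = quotient_rule p q"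
  unfolding fract_deriv_def
  by (rule the_equality) (auto simp: eq_fract intro!: quotient_rule_cong)

lemma fract_at_add: "fract_at (r + s) = fract_at r + fract_at s"
  by (cases r, cases s) (simp add: fract_at_Fract laurent_at_simps field_simps)

lemma fract_at_mult: "fract_at (r * s) = fract_at r * fract_at s"
  by (cases r, cases s) (simp add: fract_at_Fract laurent_at_simps)

lemma fract_at_1: "fract_at 1 = 1"
  by (simp add: One_fract_def fract_at_Fract laurent_at_simps)

lemma fract_deriv_1: "fract_deriv 1 = 0"
  by (simp add: One_fract_def fract_deriv_Fract quotient_rule_def laurent_at_simps)

lemma fract_deriv_add: "fract_deriv (r + s) = fract_deriv r + fract_deriv s"
proof (cases r, cases s)
  fix a b c d :: "'a poly poly" assume r: "r = Fract a b" "b \<noteq> 0" and s: "s = Fract c d" "d \<noteq> 0"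
  then have nz: "laurent_at b \<noteq> 0" "laurent_at d \<noteq> 0" by auto
  show ?thesis
    using r s nz
    by (simp add: fract_deriv_Fract quotient_rule_def pderiv_add pderiv_mult laurent_at_simps)
      (simp add: field_simps power2_eq_square)
qed

lemma fract_deriv_mult: "fract_deriv (r * s) = fract_at r * fract_deriv s + fract_deriv r * fract_at s"
proof (cases r, cases s)
  fix a b c d :: "'a poly poly" assume r: "r = Fract a b" "b \<noteq> 0" and s: "s = Fract c d" "d \<noteq> 0"
  then have nz: "laurent_at b \<noteq> 0" "laurent_at d \<noteq> 0" by auto
  show ?thesis
    using r s nz
    by (simp add: fract_deriv_Fract fract_at_Fract quotient_rule_def pderiv_mult laurent_at_simps)
      (simp add: field_simps power2_eq_square)
qed

lemma fract_at_poly: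
  "fract_at (Fract P 1) = laurent_at P" "fract_deriv (Fract P 1) = laurent_at (pderiv P)"
  by (simp_all add: fract_at_Fract fract_deriv_Fract quotient_rule_def laurent_at_simps)

text \<open>
  Laurent series form a vector space \<open>V\<close> over the field \<open>E\<close> of rational functions in \<open>x\<close> and \<open>lacunary\<close>.
  On \<open>V \<times> V\<close> let \<open>r \<in> E\<close> act by \<open>(a, b) \<mapsto> (r a, r b + r' a)\<close>, where \<open>r'\<close> is the derivative with
  respect to \<open>lacunary\<close>; in other words, \<open>E\<close> acts through a ring homomorphism into dual numbers.  The first
  projection is \<open>E\<close>-linear and surjective, and a linear section of it has the form \<open>a \<mapsto> (a, D a)\<close> with
  \<open>D(r a) = r D(a) + r' a\<close>.
\<close>

lemma exists_lacunary_derivation: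
  "\<exists>D :: 'k::field fps \<Rightarrow> 'k fls.
     (\<forall>u v. D (u + v) = D u + D v) \<and>
     (\<forall>c u. D (fps_const c * u) = fls_const c * D u) \<and>
     (\<forall>u. D (fps_X * u) = fls_X * D u) \<and>
     (\<forall>u. D (lacunary * u) = fps_to_fls lacunary * D u + fps_to_fls u)"
proof -
  define s1 :: "'k poly poly fract \<Rightarrow> 'k fls \<Rightarrow> 'k fls" where "s1 r x = fract_at r * x" for r x
  define s2 :: "'k poly poly fract \<Rightarrow> 'k fls \<times> 'k fls \<Rightarrow> 'k fls \<times> 'k fls"
    where "s2 r p = (fract_at r * fst p, fract_at r * snd p + fract_deriv r * fst p)" for r p
  interpret V1: vector_space s1
    by standard (auto simp: s1_def fract_at_add fract_at_mult fract_at_1 algebra_simps)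
  interpret V2: vector_space s2
    by standard (auto simp: s2_def fract_at_add fract_at_mult fract_at_1 fract_deriv_add
        fract_deriv_mult fract_deriv_1 algebra_simps)
  interpret V: vector_space_pair s2 s1 ..
  have "Vector_Spaces.linear s2 s1 fst"
    by unfold_locales (auto simp: s1_def s2_def)
  then obtain g where g: "Vector_Spaces.linear s1 s2 g" and inv: "fst \<circ> g = id"
    using V.linear_surjective_right_inverse[of fst] by (auto simp: surj_def)
  interpret g: Vector_Spaces.linear s1 s2 g by (rule g)
  define D where "D x = snd (g x)" for x
  \<comment> \<open>The section has the identity as its first component.\<close>
  have gD: "g x = (x, D x)" for x
    using inv by (simp add: D_def fun_eq_iff prod_eq_iff)
  have add: "D (x + y) = D x + D y" for x y
    using g.add[of x y] by (simp add: gD)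
  have scale: "D (fract_at r * x) = fract_at r * D x + fract_deriv r * x" for r x
    using g.scale[of r x] by (simp add: gD s1_def s2_def)
  have poly: "D (laurent_at P * x) = laurent_at P * D x + laurent_at (pderiv P) * x" for P x
    using scale[of "Fract P 1" x] by (simp add: fract_at_poly)
  have const: "laurent_at [:p:] = fps_to_fls (fps_of_poly p)" for p :: "'k poly"
    by (simp add: laurent_at_def)
  have F: "laurent_at [:0, 1:] = fps_to_fls (lacunary :: 'k fps)"
    by (simp add: laurent_at_def)
  have pd: "pderiv [:0, 1:] = (1 :: 'k poly poly)"
    by (simp add: pderiv_pCons)
  show ?thesis
  proof (intro exI[of _ "\<lambda>u. D (fps_to_fls u)"] conjI allI)
    fix u v :: "'k fps" and c :: 'k
    show "D (fps_to_fls (u + v)) = D (fps_to_fls u) + D (fps_to_fls v)"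
      by (simp add: add)
    show "D (fps_to_fls (fps_const c * u)) = fls_const c * D (fps_to_fls u)"
      using poly[of "[:[:c:]:]" "fps_to_fls u"]
      by (simp add: const laurent_at_simps fps_of_poly_const fls_times_fps_to_fls pderiv_pCons)
    show "D (fps_to_fls (fps_X * u)) = fls_X * D (fps_to_fls u)"
      using poly[of "[:[:0, 1:]:]" "fps_to_fls u"]
      by (simp add: const laurent_at_simps fls_times_fps_to_fls pderiv_pCons del: fps_of_poly_pCons)
    show "D (fps_to_fls (lacunary * u)) = fps_to_fls lacunary * D (fps_to_fls u) + fps_to_fls u"
      using poly[of "[:0, 1:]" "fps_to_fls u"]
      unfolding F pd laurent_at_simps fls_times_fps_to_fls by simp
  qed
qed

text \<open>
  The map \<open>\<Sum>u\<^sub>i \<otimes> v\<^sub>i \<mapsto> \<Sum>D(u\<^sub>i) v\<^sub>i\<close> vanishes on multiples of \<open>x - y\<close> and sends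
  \<open>(\<Sum>u\<^sub>i \<otimes> v\<^sub>i) (f(x) - f(y))\<close> to the diagonal value \<open>\<Sum>u\<^sub>i v\<^sub>i\<close>, with \<open>f\<close> the lacunary series.
\<close>

lemma split_sum_lacunary_diagonal:
  fixes xs ys :: "('k::field fps \<times> 'k fps) list"
  assumes "split_sum xs * (left_series lacunary - right_series lacunary)
    = (left_series fps_X - right_series fps_X) * split_sum ys"
  shows "split_sum xs $ 0 $ 0 = 0"
proof -
  obtain D :: "'k fps \<Rightarrow> 'k fls" where D: "\<And>u v. D (u + v) = D u + D v"
    "\<And>c u. D (fps_const c * u) = fls_const c * D u" "\<And>u. D (fps_X * u) = fls_X * D u"
    "\<And>u. D (lacunary * u) = fps_to_fls lacunary * D u + fps_to_fls u"
    using exists_lacunary_derivation by metis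
  have Dneg: "D (- u) = - D u" for u
    using D(2)[of "-1" u] by (simp add: fps_const_neg[symmetric] del: fps_const_neg)
  let ?b = "\<lambda>u v. D u * fps_to_fls v"
  \<comment> \<open>The two sides of the assumption, brought to one side and written out as lists of tensors.\<close>
  define zs1 where "zs1 = map (\<lambda>(u, v). (lacunary * u, v)) xs @ map (\<lambda>(u, v). (- u, lacunary * v)) xs"
  define zs2 where "zs2 = map (\<lambda>(u, v). (- (fps_X * u), v)) ys @ map (\<lambda>(u, v). (u, fps_X * v)) ys"
  have r: "right_series (a * b) = right_series a * right_series b" for a b :: "'k fps"
    by simp
  have "split_sum zs1
      = split_sum xs * (left_series lacunary - right_series lacunary)"
    unfolding zs1_def by (induct xs) (auto simp: left_series_mult left_series_uminus r algebra_simps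
        simp del: fps_const_mult)
  moreover have "split_sum zs2
      = - ((left_series fps_X - right_series fps_X) * split_sum ys)"
    unfolding zs2_def by (induct ys) (auto simp: left_series_mult left_series_uminus r algebra_simps
        simp del: fps_const_mult)
  ultimately have "split_sum (zs1 @ zs2) = 0"
    using assms by simp
  then have "(\<Sum>(u, v)\<leftarrow>zs1 @ zs2. ?b u v) = 0"
  proof (rule split_sum_eq_0_additive)
    fix u u' v :: "'k fps" and c :: 'k
    show "?b (u + u') v = ?b u v + ?b u' v" by (simp add: D distrib_right)
    show "?b u (v + u') = ?b u v + ?b u u'" by (simp add: distrib_left)
    show "?b (fps_const c * u) v = ?b u (fps_const c * v)"
      unfolding D(2) fls_times_fps_to_fls fps_const_to_fls by (simp only: mult_ac)
  qed
  moreover have "(\<Sum>(u, v)\<leftarrow>zs1. ?b u v)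
      = fps_to_fls (\<Sum>(u, v)\<leftarrow>xs. u * v)"
    unfolding zs1_def
    by (induct xs) (auto simp: D Dneg fls_times_fps_to_fls distrib_right distrib_left mult.assoc add_eq_0_iff)
  moreover have "(\<Sum>(u, v)\<leftarrow>zs2. ?b u v) = 0"
    unfolding zs2_def
    by (induct ys) (auto simp: D Dneg fls_times_fps_to_fls distrib_right distrib_left mult.assoc add_eq_0_iff)
  ultimately have "fps_to_fls (\<Sum>(u, v)\<leftarrow>xs. u * v) = 0"
    by simp
  then have "(\<Sum>(u, v)\<leftarrow>xs. u * v) $ 0 = 0"
    by simp
  moreover have "split_sum xs $ 0 $ 0 = (\<Sum>(u, v)\<leftarrow>xs. u * v) $ 0"
    by (induct xs) auto
  ultimately show ?thesis by simp
qed

section \<open>The ring of split series\<close>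

definition split_series :: "'k::field fps fps set"
  where "split_series = range split_sum"

lemma left_right_mult_split_sum:
  "left_series u * right_series v * split_sum xs = split_sum (map (\<lambda>(u', v'). (u * u', v * v')) xs)"
proof (induct xs)
  case (Cons p xs)
  have "right_series (v * v') = right_series v * right_series v'" for v'
    by simp
  with Cons show ?case
    by (cases p) (simp add: left_series_mult algebra_simps del: fps_const_mult)
qed simp

lemma split_seriesI: "split_sum xs \<in> split_series"
  by (auto simp: split_series_def)

lemma split_series_add: "F \<in> split_series \<Longrightarrow> G \<in> split_series \<Longrightarrow> F + G \<in> split_series"
  by (auto simp: split_series_def split_sum_append[symmetric] simp del: split_sum_append)

lemma split_series_mult: "F \<in> split_series \<Longrightarrow> G \<in> split_series \<Longrightarrow> F * G \<in> split_series"
proof -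
  assume "G \<in> split_series"
  then obtain ys where G: "G = split_sum ys" by (auto simp: split_series_def)
  have "split_sum xs * split_sum ys \<in> split_series" for xs
  proof (induct xs)
    case Nil
    show ?case using split_seriesI[of "[]"] by simp
  next
    case (Cons p xs)
    then show ?case
      by (cases p) (simp add: distrib_right split_series_add split_seriesI left_right_mult_split_sum)
  qed
  moreover assume "F \<in> split_series"
  ultimately show ?thesis by (auto simp: split_series_def G)
qed

lemma left_series_split: "left_series u \<in> split_series"
  using split_seriesI[of "[(u, 1)]"] by simp

lemma right_series_split: "right_series v \<in> split_series"
  using split_seriesI[of "[(1, v)]"] by simp

lemma split_series_0: "0 \<in> split_series"
  and split_series_1: "1 \<in> split_series"
  and split_series_X: "fps_X \<in> split_series"
  using left_series_split[of 0] left_series_split[of 1] left_series_split[of fps_X] by simp_all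

lemma split_series_uminus: "F \<in> split_series \<Longrightarrow> - F \<in> split_series"
  using split_series_mult[OF right_series_split[of "-1"], of F]
  by (simp add: fps_const_neg[symmetric] del: fps_const_neg)

lemma split_series_diff: "F \<in> split_series \<Longrightarrow> G \<in> split_series \<Longrightarrow> F - G \<in> split_series"
  using split_series_add[OF _ split_series_uminus, of F G] by simp

lemma split_series_power: "F \<in> split_series \<Longrightarrow> F ^ n \<in> split_series"
  by (induct n) (auto intro: split_series_mult split_series_1)

lemma fps_shift_split_sum: "fps_shift n (split_sum xs) = split_sum (map (\<lambda>(u, v). (fps_shift n u, v)) xs)"
  by (induct xs) (auto simp: fps_eq_iff)

lemma split_series_shift: "F \<in> split_series \<Longrightarrow> fps_shift n F \<in> split_series"
  by (auto simp: split_series_def fps_shift_split_sum)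

text \<open>
  Shifting the coefficients in \<open>x\<close> acts on the left factors alone, so it preserves split series.
\<close>

lemma split_series_X_power_cancel: "fps_X ^ n * F \<in> split_series \<Longrightarrow> F \<in> split_series"
  using split_series_shift[of "fps_X ^ n * F" n] by (simp add: fps_shift_times_fps_X_power' mult.commute)

lemma split_series_regular:
  assumes "Q \<in> split_series"
    and "fps_X ^ n * P + right_series fps_X ^ n * Q = (0 :: 'k::field fps fps)"
  shows "\<exists>Z\<in>split_series. P = - (right_series fps_X ^ n * Z) \<and> Q = fps_X ^ n * Z"
proof -
  have "fps_X ^ n dvd right_series fps_X ^ n * Q"
    using assms(2) by (metis add_eq_0_iff dvd_minus_iff dvd_triv_left)
  then have "fps_X ^ n dvd Q"
    by (auto simp: X_power_dvd_iff fps_const_power)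
  then obtain Z where Z: "Q = fps_X ^ n * Z" by auto
  have "fps_X ^ n * (P + right_series fps_X ^ n * Z) = 0"
    using assms(2) by (simp add: Z algebra_simps)
  then have "P = - (right_series fps_X ^ n * Z)"
    by (simp add: eq_neg_iff_add_eq_0)
  then show ?thesis using Z assms(1) split_series_X_power_cancel by blast
qed

lemma lacunary_diagonal:
  assumes "b \<in> split_series" "c \<in> split_series"
    and "b * (left_series lacunary - right_series lacunary) = (fps_X - right_series fps_X) * c"
  shows "b $ 0 $ 0 = 0"
  using assms split_sum_lacunary_diagonal by (auto simp: split_series_def)

section \<open>The order filtration\<close>

definition order_ge :: "nat \<Rightarrow> 'k::field fps fps set"
  where "order_ge n = {F. \<forall>i j. i + j < n \<longrightarrow> F $ i $ j = 0}"

lemma order_ge_add: "F \<in> order_ge n \<Longrightarrow> G \<in> order_ge n \<Longrightarrow> F + G \<in> order_ge n"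
  and order_ge_uminus: "F \<in> order_ge n \<Longrightarrow> - F \<in> order_ge n"
  and order_ge_diff: "F \<in> order_ge n \<Longrightarrow> G \<in> order_ge n \<Longrightarrow> F - G \<in> order_ge n"
  and order_ge_0: "0 \<in> order_ge n"
  and order_ge_zero: "order_ge 0 = UNIV"
  and order_ge_mono: "m \<le> n \<Longrightarrow> order_ge n \<subseteq> order_ge m"
  by (auto simp: order_ge_def)

lemma order_ge_mult: "F \<in> order_ge n \<Longrightarrow> G * F \<in> order_ge n"
  by (auto simp: order_ge_def fps_mult_nth fps_sum_nth intro!: sum.neutral)

lemma order_ge_left_X: "F \<in> order_ge n \<Longrightarrow> fps_X * F \<in> order_ge (Suc n)"
  by (auto simp: order_ge_def)

lemma order_ge_right_X: "F \<in> order_ge n \<Longrightarrow> right_series fps_X * F \<in> order_ge (Suc n)"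
  by (auto simp: order_ge_def)

lemma fps_shift_split: "F = fps_const (F $ 0) + fps_X * fps_shift 1 F"
  for F :: "'a::comm_ring_1 fps"
  by (auto simp: fps_eq_iff)

text \<open>
  The terms without \<open>x\<close> form a series in \<open>y\<close>, which is split, so both quotients are split again.
\<close>

lemma order_ge_Suc_decompose:
  assumes "F \<in> order_ge (Suc n)" "F \<in> split_series"
  shows "\<exists>G\<in>order_ge n \<inter> split_series. \<exists>H\<in>order_ge n \<inter> split_series.
    F = fps_X * G + right_series fps_X * H"
proof (intro bexI)
  have "F $ 0 = fps_X * fps_shift 1 (F $ 0)"
    using fps_shift_split[of "F $ 0"] assms(1) by (simp add: order_ge_def)
  then have "right_series (F $ 0) = right_series fps_X * right_series (fps_shift 1 (F $ 0))"
    by simp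
  then show "F = fps_X * fps_shift 1 F + right_series fps_X * right_series (fps_shift 1 (F $ 0))"
    using fps_shift_split[of F] by (simp add: add.commute)
  show "fps_shift 1 F \<in> order_ge n \<inter> split_series"
    using assms by (auto simp: order_ge_def split_series_shift)
  show "right_series (fps_shift 1 (F $ 0)) \<in> order_ge n \<inter> split_series"
    using assms by (auto simp: order_ge_def right_series_split)
qed

lemma split_series_dense: "\<exists>G\<in>split_series. F - G \<in> order_ge n"
proof
  let ?G = "\<Sum>i<n. fps_X ^ i * right_series (F $ i)"
  have "(\<Sum>i<m. fps_X ^ i * right_series (F $ i)) \<in> split_series" for m
    by (induct m) (auto intro!: split_series_0 split_series_add split_series_mult split_series_power
        split_series_X right_series_split)
  then show "?G \<in> split_series" .
  have "?G $ m = F $ m" if "m < n" for m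
  proof -
    have "?G $ m = (\<Sum>i<n. if i = m then F $ i else 0)"
      unfolding fps_sum_nth by (rule sum.cong) (auto simp: fps_X_power_mult_nth)
    then show ?thesis using that by simp
  qed
  then show "F - ?G \<in> order_ge n" by (auto simp: order_ge_def)
qed

lemma order_ge_separated: "(\<And>n. F \<in> order_ge n) \<Longrightarrow> F = 0"
  by (simp add: order_ge_def fps_eq_iff) blast

section \<open>Ideals of power series over a discrete valuation ring\<close>

text \<open>
  Division with a remainder that can be removed at every order: if the lowest coefficient of \<open>G\<close> divides
  those of all elements of the ideal of order at least \<open>N\<close>, then the coefficients of the quotient are
  found one after the other.  The sequence \<open>r\<close> consists of the successive remainders, divided by powers of
  the variable.
\<close>

lemma fps_dvd_of_leading_dvd:
  fixes G H :: "'a::field fps fps"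
  assumes add: "\<And>F F'. F \<in> I \<Longrightarrow> F' \<in> I \<Longrightarrow> F + F' \<in> I"
    and mult: "\<And>c F. F \<in> I \<Longrightarrow> c * F \<in> I"
    and G: "fps_X ^ N * G \<in> I" and H: "fps_X ^ N * H \<in> I"
    and lead: "\<And>n H. N \<le> n \<Longrightarrow> fps_X ^ n * H \<in> I \<Longrightarrow> G $ 0 dvd H $ 0"
  shows "G dvd H"
proof -
  define r where "r = rec_nat H (\<lambda>_ R. fps_shift 1 (R - fps_const (R $ 0 div G $ 0) * G))"
  define q where "q n = r n $ 0 div G $ 0" for n
  have r0: "r 0 = H" by (simp add: r_def)
  have rS: "r (Suc n) = fps_shift 1 (r n - fps_const (q n) * G)" for n
    by (simp add: r_def q_def)
  have diff: "F \<in> I \<Longrightarrow> F' \<in> I \<Longrightarrow> F - F' \<in> I" for F F'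
    using add[of F "-1 * F'"] mult[of F' "-1"] by simp
  have step: "fps_X ^ (N + n) * r n \<in> I \<and> fps_X * r (Suc n) = r n - fps_const (q n) * G" for n
  proof (induct n)
    have *: "fps_X * r (Suc n) = r n - fps_const (q n) * G" if "fps_X ^ (N + n) * r n \<in> I" for n
    proof -
      have "q n * G $ 0 = r n $ 0"
        using lead[OF _ that] by (simp add: q_def)
      then show ?thesis
        using fps_shift_split[of "r n - fps_const (q n) * G"] by (simp add: rS)
    qed
    {
      case 0
      show ?case using H * by (simp add: r0)
    next
      case (Suc n)
      have "fps_X ^ (N + Suc n) * r (Suc n) = fps_X ^ (N + n) * (fps_X * r (Suc n))"
        by (simp add: algebra_simps)
      also have "\<dots> = fps_X ^ (N + n) * r n - (fps_X ^ n * fps_const (q n)) * (fps_X ^ N * G)"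
        using conjunct2[OF Suc] by (simp only:) (simp add: algebra_simps power_add)
      also have "\<dots> \<in> I"
        by (rule diff[OF conjunct1[OF Suc] mult[OF G]])
      finally show ?case using *[of "Suc n"] by simp
    }
  qed
  have expand: "H = (\<Sum>i<n. fps_const (q i) * fps_X ^ i) * G + fps_X ^ n * r n" for n
  proof (induct n)
    case (Suc n)
    have "r n = fps_const (q n) * G + fps_X * r (Suc n)"
      using step[of n] by simp
    then have "fps_X ^ n * r n = fps_X ^ n * (fps_const (q n) * G + fps_X * r (Suc n))"
      by (rule arg_cong)
    then show ?case using Suc by (simp add: algebra_simps)
  qed (simp add: r0)
  have "H = Abs_fps q * G"
  proof (rule fps_ext)
    fix m
    let ?S = "\<Sum>i<Suc m. fps_const (q i) * fps_X ^ i"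
    have S: "?S $ i = q i" if "i \<le> m" for i
    proof -
      have "?S $ i = (\<Sum>l<Suc m. if l = i then q l else 0)"
        unfolding fps_sum_nth by (rule sum.cong) (auto simp: fps_X_power_mult_right_nth fps_X_power_nth)
      then show ?thesis using that by simp
    qed
    have "H $ m = (?S * G) $ m"
      by (subst expand[of "Suc m"]) (simp only: fps_add_nth fps_X_power_mult_nth, simp)
    also have "\<dots> = (Abs_fps q * G) $ m"
      unfolding fps_mult_nth using S by (intro sum.cong) auto
    finally show "H $ m = (Abs_fps q * G) $ m" .
  qed
  then show ?thesis by simp
qed

text \<open>
  Among all elements \<open>x\<^sup>n H\<close> of the ideal with \<open>H(0) \<noteq> 0\<close> choose \<open>x\<^sup>N G\<close> with the order of \<open>G(0)\<close> minimal.
  It generates the part of the ideal of order at least \<open>N\<close> in \<open>x\<close>; for every \<open>n < N\<close> one more generator,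
  minimal among the elements of the form \<open>x\<^sup>n H\<close>, is enough.  That the set \<open>S\<close> generates is
  expressed without sums, as minimality among the sets closed under the ideal operations.
\<close>

lemma fps_fps_ideal_finitely_generated:
  fixes I :: "'a::field fps fps set"
  assumes zero: "0 \<in> I" and add: "\<And>F F'. F \<in> I \<Longrightarrow> F' \<in> I \<Longrightarrow> F + F' \<in> I"
    and mult: "\<And>c F. F \<in> I \<Longrightarrow> c * F \<in> I"
  shows "\<exists>S\<subseteq>I. finite S \<and> (\<forall>J. 0 \<in> J \<longrightarrow> S \<subseteq> J \<longrightarrow> (\<forall>F\<in>J. \<forall>F'\<in>J. F + F' \<in> J) \<longrightarrow>
    (\<forall>c. \<forall>F\<in>J. c * F \<in> J) \<longrightarrow> I \<subseteq> J)"
proof (cases "\<exists>n H. fps_X ^ n * H \<in> I \<and> H $ 0 \<noteq> 0")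
  case False
  have "I \<subseteq> {0}"
  proof
    fix F assume F: "F \<in> I"
    have "F = 0"
    proof (rule ccontr)
      assume "F \<noteq> 0"
      then have "fps_X ^ subdegree F * fps_shift (subdegree F) F \<in> I"
        "fps_shift (subdegree F) F $ 0 \<noteq> 0"
        using F \<open>F \<noteq> 0\<close> by (simp_all add: mult.commute subdegree_decompose[symmetric])
      then show False using False by blast
    qed
    then show "F \<in> {0}" by simp
  qed
  then show ?thesis by (intro exI[of _ "{}"]) auto
next
  case True
  define L where "L = (\<lambda>(n, H). fps_X ^ n * H \<in> I \<and> H $ 0 \<noteq> 0)"
  obtain N G where NG: "L (N, G)"
    and min: "\<And>n H. L (n, H) \<Longrightarrow> subdegree (G $ 0) \<le> subdegree (H $ 0)"
    using True ex_has_least_nat[of L _ "\<lambda>p. subdegree (snd p $ 0)"] by (fastforce simp: L_def)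
  have "\<forall>n. \<exists>G. (\<exists>H. L (n, H)) \<longrightarrow> L (n, G) \<and> (\<forall>H. L (n, H) \<longrightarrow> subdegree (G $ 0) \<le> subdegree (H $ 0))"
    using ex_has_least_nat[of "\<lambda>H. L (_, H)" _ "\<lambda>H. subdegree (H $ 0)"] by blast
  then obtain g where g: "\<And>n H. L (n, H) \<Longrightarrow> L (n, g n) \<and> subdegree (g n $ 0) \<le> subdegree (H $ 0)"
    by metis
  define S where "S = insert (fps_X ^ N * G) ((\<lambda>n. fps_X ^ n * g n) ` {n. n < N \<and> (\<exists>H. L (n, H))})"
  show ?thesis
  proof (intro exI[of _ S] conjI allI impI)
    show "S \<subseteq> I" using NG g by (auto simp: S_def L_def)
    show "finite S" by (simp add: S_def)
    fix J assume J: "0 \<in> J" "S \<subseteq> J" "\<forall>F\<in>J. \<forall>F'\<in>J. F + F' \<in> J" "\<forall>c. \<forall>F\<in>J. c * F \<in> J"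
    have "fps_X ^ n * H \<in> J" if "n \<le> N" "fps_X ^ n * H \<in> I" for n H
      using that
    proof (induct n arbitrary: H rule: inc_induct)
      case base
      have "G dvd H"
      proof (rule fps_dvd_of_leading_dvd[OF add mult _ base])
        show "fps_X ^ N * G \<in> I" using NG by (simp add: L_def)
        fix n H assume "fps_X ^ n * H \<in> I"
        then show "G $ 0 dvd H $ 0"
          using min[of n H] NG by (cases "H $ 0 = 0") (auto simp: L_def fps_dvd_iff)
      qed
      then obtain c where "H = G * c" by auto
      then have "fps_X ^ N * H = c * (fps_X ^ N * G)" by (simp add: algebra_simps)
      moreover have "fps_X ^ N * G \<in> J" using J(2) by (simp add: S_def)
      ultimately show ?case using J(4) by metis
    next
      case (step n)
      have "\<exists>c. fps_const c * (fps_X ^ n * g n) \<in> I \<inter> J \<and> (H - fps_const c * g n) $ 0 = 0"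
      proof (cases "H $ 0 = 0")
        case True
        then show ?thesis using zero J by (intro exI[of _ 0]) auto
      next
        case False
        then have H: "L (n, H)" using step by (auto simp: L_def)
        from g[OF H] have gn: "fps_X ^ n * g n \<in> I" "fps_X ^ n * g n \<in> J"
          using J(2) step H by (auto simp: S_def L_def)
        have "g n $ 0 dvd H $ 0"
          using g[OF H] False by (auto simp: L_def fps_dvd_iff)
        then have "(H - fps_const (H $ 0 div g n $ 0) * g n) $ 0 = 0" by simp
        then show ?thesis using gn mult J(4) by blast
      qed
      then obtain c where c: "fps_const c * (fps_X ^ n * g n) \<in> I" "fps_const c * (fps_X ^ n * g n) \<in> J"
        "(H - fps_const c * g n) $ 0 = 0" by auto
      let ?H = "fps_shift 1 (H - fps_const c * g n)"
      have H': "fps_X * ?H = H - fps_const c * g n"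
        using fps_shift_split[of "H - fps_const c * g n"] c(3) by simp
      have eq: "fps_X ^ n * H = fps_X ^ Suc n * ?H + fps_const c * (fps_X ^ n * g n)"
      proof -
        have "fps_X ^ Suc n * ?H = fps_X ^ n * (fps_X * ?H)" by (simp add: mult_ac)
        then show ?thesis unfolding H' by (simp add: algebra_simps)
      qed
      have "fps_X ^ Suc n * ?H = fps_X ^ n * H + (-1) * (fps_const c * (fps_X ^ n * g n))"
        using eq by simp
      also have "\<dots> \<in> I" by (rule add[OF step(4) mult[OF c(1)]])
      finally have "fps_X ^ Suc n * ?H \<in> J" by (rule step)
      then show ?case using J c unfolding eq by blast
    qed
    from this[of 0] show "I \<subseteq> J" by auto
  qed
qed

section \<open>Modules, quotients and free modules\<close>

lemma module_homI:
  assumes "\<And>x. x \<in> carrier M \<Longrightarrow> f x \<in> carrier N"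
    and "\<And>x y. x \<in> carrier M \<Longrightarrow> y \<in> carrier M \<Longrightarrow> f (x \<oplus>\<^bsub>M\<^esub> y) = f x \<oplus>\<^bsub>N\<^esub> f y"
    and "\<And>r x. r \<in> carrier R \<Longrightarrow> x \<in> carrier M \<Longrightarrow> f (r \<odot>\<^bsub>M\<^esub> x) = r \<odot>\<^bsub>N\<^esub> f x"
  shows "f \<in> module_hom R M N"
  using assms by (auto simp: module_hom_def)

lemma module_homD:
  assumes "f \<in> module_hom R M N"
  shows "x \<in> carrier M \<Longrightarrow> f x \<in> carrier N"
    and "x \<in> carrier M \<Longrightarrow> y \<in> carrier M \<Longrightarrow> f (x \<oplus>\<^bsub>M\<^esub> y) = f x \<oplus>\<^bsub>N\<^esub> f y"
    and "r \<in> carrier R \<Longrightarrow> x \<in> carrier M \<Longrightarrow> f (r \<odot>\<^bsub>M\<^esub> x) = r \<odot>\<^bsub>N\<^esub> f x"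
  using assms by (auto simp: module_hom_def)

lemma module_hom_zero:
  assumes "module R M" "module R N" "f \<in> module_hom R M N"
  shows "f \<zero>\<^bsub>M\<^esub> = \<zero>\<^bsub>N\<^esub>"
proof -
  interpret M: module R M by fact
  interpret N: module R N by fact
  have "f \<zero>\<^bsub>M\<^esub> \<oplus>\<^bsub>N\<^esub> f \<zero>\<^bsub>M\<^esub> = f \<zero>\<^bsub>M\<^esub>"
    using module_homD(2)[OF assms(3), of "\<zero>\<^bsub>M\<^esub>" "\<zero>\<^bsub>M\<^esub>"] by simp
  then show ?thesis using module_homD(1)[OF assms(3), of "\<zero>\<^bsub>M\<^esub>"] by simp
qed

lemma module_hom_uminus:
  assumes "module R M" "module R N" "f \<in> module_hom R M N" "x \<in> carrier M"
  shows "f (\<ominus>\<^bsub>M\<^esub> x) = \<ominus>\<^bsub>N\<^esub> f x"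
proof -
  interpret M: module R M by fact
  interpret N: module R N by fact
  have "f (\<ominus>\<^bsub>M\<^esub> x) \<oplus>\<^bsub>N\<^esub> f x = \<zero>\<^bsub>N\<^esub>"
    using module_homD(2)[OF assms(3), of "\<ominus>\<^bsub>M\<^esub> x" x] assms
    by (simp add: M.l_neg module_hom_zero[OF assms(1-3)])
  then show ?thesis using module_homD(1)[OF assms(3)] assms(4)
    by (simp add: N.minus_equality)
qed

lemma module_hom_minus:
  assumes "module R M" "module R N" "f \<in> module_hom R M N" "x \<in> carrier M" "y \<in> carrier M"
  shows "f (x \<ominus>\<^bsub>M\<^esub> y) = f x \<ominus>\<^bsub>N\<^esub> f y"
proof -
  interpret M: module R M by fact
  show ?thesis using assms
    by (simp add: a_minus_def module_homD(2)[OF assms(3)] module_hom_uminus[OF assms(1-3)])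
qed

lemma module_hom_comp:
  assumes "f \<in> module_hom R M N" "g \<in> module_hom R N P"
  shows "(\<lambda>x. g (f x)) \<in> module_hom R M P"
  using assms by (auto simp: module_hom_def Pi_iff)

lemma submodule_kernel:
  assumes "module R M" "module R N" "f \<in> module_hom R M N"
  shows "submodule {x \<in> carrier M. f x = \<zero>\<^bsub>N\<^esub>} R M"
proof -
  interpret M: module R M by fact
  interpret N: module R N by fact
  show ?thesis
    by (rule M.submoduleI)
      (auto simp: module_hom_zero[OF assms] module_homD[OF assms(3)] module_hom_uminus[OF assms])
qed

lemma submodule_image:
  assumes "module R M" "module R N" "f \<in> module_hom R M N"
  shows "submodule (f ` carrier M) R N"
proof -
  interpret M: module R M by fact
  interpret N: module R N by fact
  note f = module_homD[OF assms(3)]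
  show ?thesis
  proof (rule N.submoduleI)
    show "f ` carrier M \<subseteq> carrier N" using f by auto
    show "\<zero>\<^bsub>N\<^esub> \<in> f ` carrier M"
      using module_hom_zero[OF assms] by (metis M.zero_closed image_eqI)
    show "\<ominus>\<^bsub>N\<^esub> a \<in> f ` carrier M" if "a \<in> f ` carrier M" for a
      using that by (auto simp: module_hom_uminus[OF assms, symmetric])
    show "a \<oplus>\<^bsub>N\<^esub> b \<in> f ` carrier M" if "a \<in> f ` carrier M" "b \<in> f ` carrier M" for a b
      using that by (auto simp: f(2)[symmetric])
    show "r \<odot>\<^bsub>N\<^esub> a \<in> f ` carrier M" if "r \<in> carrier R" "a \<in> f ` carrier M" for r a
      using that by (auto simp: f(3)[symmetric])
  qed
qed

lemma submodule_generated_submodule: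
  assumes "module R M" "B \<subseteq> carrier M"
  shows "submodule (submodule_generated R M B) R M"
proof -
  interpret M: module R M by fact
  note E = M.submoduleE
  have c: "submodule (carrier M) R M" by (rule M.carrier_is_submodule)
  show ?thesis unfolding submodule_generated_def
  proof (rule M.submoduleI)
    show "\<Inter> {H. submodule H R M \<and> B \<subseteq> H} \<subseteq> carrier M" using c assms(2) by auto
    have "\<zero>\<^bsub>M\<^esub> \<in> H" if "submodule H R M" for H
      using submodule.axioms(1)[OF that] subgroup.one_closed by fastforce
    then show "\<zero>\<^bsub>M\<^esub> \<in> \<Inter> {H. submodule H R M \<and> B \<subseteq> H}" by auto
  qed (auto intro: E)
qed

lemma submodule_generated_superset: "B \<subseteq> submodule_generated R M B"
  by (auto simp: submodule_generated_def)

lemma submodule_generated_least: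
  "submodule H R M \<Longrightarrow> B \<subseteq> H \<Longrightarrow> submodule_generated R M B \<subseteq> H"
  by (auto simp: submodule_generated_def)

lemma quotient_module_sel:
  "carrier (quotient_module M S) = a_rcosets\<^bsub>M\<^esub> S"
  "\<zero>\<^bsub>quotient_module M S\<^esub> = S"
  "\<one>\<^bsub>quotient_module M S\<^esub> = S +>\<^bsub>M\<^esub> \<one>\<^bsub>M\<^esub>"
  "ring.add (quotient_module M S) = set_add M"
  "C \<otimes>\<^bsub>quotient_module M S\<^esub> D = [mod S:] C \<Otimes>\<^bsub>M\<^esub> D"
  "r \<odot>\<^bsub>quotient_module M S\<^esub> C = (\<Union>x\<in>C. S +>\<^bsub>M\<^esub> (r \<odot>\<^bsub>M\<^esub> x))"
  by (simp_all add: quotient_module_def ring.extend_def module.fields_def FactRing_def)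

locale quotient_of_module = module +
  fixes S
  assumes submodule: "submodule S R M"
begin

sublocale sub: abelian_subgroup S M
  using submodule submodule.axioms(1) by (intro abelian_subgroupI3) (auto simp: additive_subgroup_def abelian_group_axioms)

lemma carrier_quotient: "carrier (quotient_module M S) = (\<lambda>x. S +>\<^bsub>M\<^esub> x) ` carrier M"
  by (auto simp: quotient_module_sel A_RCOSETS_def')

lemma coset_closed [simp, intro]: "x \<in> carrier M \<Longrightarrow> S +>\<^bsub>M\<^esub> x \<in> carrier (quotient_module M S)"
  by (auto simp: carrier_quotient)

lemma coset_add: "x \<in> carrier M \<Longrightarrow> y \<in> carrier M \<Longrightarrow>
    (S +>\<^bsub>M\<^esub> x) \<oplus>\<^bsub>quotient_module M S\<^esub> (S +>\<^bsub>M\<^esub> y) = S +>\<^bsub>M\<^esub> (x \<oplus>\<^bsub>M\<^esub> y)"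
  by (simp add: quotient_module_sel sub.a_rcos_sum)

lemma mem_coset_iff: "y \<in> S +>\<^bsub>M\<^esub> x \<longleftrightarrow> (\<exists>s\<in>S. y = s \<oplus>\<^bsub>M\<^esub> x)"
  by (auto simp: a_r_coset_def')

lemma coset_eq_iff:
  assumes "x \<in> carrier M" "y \<in> carrier M"
  shows "S +>\<^bsub>M\<^esub> x = S +>\<^bsub>M\<^esub> y \<longleftrightarrow> x \<ominus>\<^bsub>M\<^esub> y \<in> S"
proof -
  have sub: "S \<subseteq> carrier M" using submoduleE(1)[OF submodule] .
  have "S +>\<^bsub>M\<^esub> x = S +>\<^bsub>M\<^esub> y \<longleftrightarrow> x \<in> S +>\<^bsub>M\<^esub> y"
  proof
    assume "S +>\<^bsub>M\<^esub> x = S +>\<^bsub>M\<^esub> y"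
    then show "x \<in> S +>\<^bsub>M\<^esub> y" using sub.a_rcos_self[OF assms(1)] by simp
  next
    assume "x \<in> S +>\<^bsub>M\<^esub> y"
    from M.a_repr_independence[OF this assms(2) sub.a_subgroup]
    show "S +>\<^bsub>M\<^esub> x = S +>\<^bsub>M\<^esub> y" by simp
  qed
  also have "\<dots> \<longleftrightarrow> x \<ominus>\<^bsub>M\<^esub> y \<in> S"
  proof
    assume "x \<in> S +>\<^bsub>M\<^esub> y"
    then obtain s where "s \<in> S" "x = s \<oplus>\<^bsub>M\<^esub> y" using assms by (auto simp: mem_coset_iff)
    then show "x \<ominus>\<^bsub>M\<^esub> y \<in> S" using sub assms by (auto simp: a_minus_def M.a_assoc M.r_neg subset_iff)
  next
    assume "x \<ominus>\<^bsub>M\<^esub> y \<in> S"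
    moreover have "x = (x \<ominus>\<^bsub>M\<^esub> y) \<oplus>\<^bsub>M\<^esub> y" using assms by (simp add: a_minus_def M.a_assoc M.l_neg)
    ultimately show "x \<in> S +>\<^bsub>M\<^esub> y" using assms by (auto simp: mem_coset_iff)
  qed
  finally show ?thesis .
qed

lemma coset_smult:
  assumes "r \<in> carrier R" "x \<in> carrier M"
  shows "r \<odot>\<^bsub>quotient_module M S\<^esub> (S +>\<^bsub>M\<^esub> x) = S +>\<^bsub>M\<^esub> (r \<odot>\<^bsub>M\<^esub> x)"
proof -
  have sub: "S \<subseteq> carrier M" using submoduleE(1)[OF submodule] .
  have "S +>\<^bsub>M\<^esub> (r \<odot>\<^bsub>M\<^esub> y) = S +>\<^bsub>M\<^esub> (r \<odot>\<^bsub>M\<^esub> x)" if y: "y \<in> S +>\<^bsub>M\<^esub> x" for y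
  proof -
    obtain s where s: "s \<in> S" "y = s \<oplus>\<^bsub>M\<^esub> x" using y assms by (auto simp: mem_coset_iff)
    then have s': "s \<in> carrier M" "r \<odot>\<^bsub>M\<^esub> s \<in> S"
      using sub submoduleE(4)[OF submodule] assms by auto
    have "r \<odot>\<^bsub>M\<^esub> y \<ominus>\<^bsub>M\<^esub> (r \<odot>\<^bsub>M\<^esub> x) = r \<odot>\<^bsub>M\<^esub> s"
      using s s' assms by (simp add: smult_r_distr a_minus_def M.a_assoc M.r_neg)
    then show ?thesis using s s' assms by (subst coset_eq_iff) auto
  qed
  moreover have "x \<in> S +>\<^bsub>M\<^esub> x" using assms sub.a_rcos_self by auto
  ultimately show ?thesis unfolding quotient_module_sel by blast
qed

lemma coset_zero: "S +>\<^bsub>M\<^esub> \<zero>\<^bsub>M\<^esub> = S"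
  using sub.a_subset by simp

lemma coset_eq_S_iff: "x \<in> carrier M \<Longrightarrow> S +>\<^bsub>M\<^esub> x = S \<longleftrightarrow> x \<in> S"
  using coset_eq_iff[of x "\<zero>\<^bsub>M\<^esub>"] M.minus_equality[of "\<zero>\<^bsub>M\<^esub>" "\<zero>\<^bsub>M\<^esub>"]
  by (simp add: coset_zero a_minus_def)

lemma module_quotient: "module R (quotient_module M S)"
proof (rule moduleI)
  show "cring R" by (rule R.is_cring)
  show "abelian_group (quotient_module M S)"
  proof (rule abelian_groupI)
    have z: "\<zero>\<^bsub>quotient_module M S\<^esub> = S +>\<^bsub>M\<^esub> \<zero>\<^bsub>M\<^esub>"
      by (simp add: coset_zero quotient_module_sel)
    show "\<zero>\<^bsub>quotient_module M S\<^esub> \<in> carrier (quotient_module M S)"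
      unfolding z by blast
    fix C assume "C \<in> carrier (quotient_module M S)"
    then obtain x where x: "x \<in> carrier M" "C = S +>\<^bsub>M\<^esub> x" by (auto simp: carrier_quotient)
    then show "\<zero>\<^bsub>quotient_module M S\<^esub> \<oplus>\<^bsub>quotient_module M S\<^esub> C = C"
      unfolding z by (simp add: coset_add)
    show "\<exists>D\<in>carrier (quotient_module M S). D \<oplus>\<^bsub>quotient_module M S\<^esub> C = \<zero>\<^bsub>quotient_module M S\<^esub>"
      using x unfolding z
      by (intro bexI[of _ "S +>\<^bsub>M\<^esub> (\<ominus>\<^bsub>M\<^esub> x)"]) (auto simp: coset_add M.l_neg)
  qed (auto simp: carrier_quotient coset_add M.a_ac)
qed (auto simp: carrier_quotient coset_add coset_smult smult_l_distr smult_r_distr smult_assoc1)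

end

lemma quotient_of_moduleI: "module R M \<Longrightarrow> submodule S R M \<Longrightarrow> quotient_of_module R M S"
  by (simp add: quotient_of_module.intro quotient_of_module_axioms.intro)

lemma free_module_sel [simp]:
  "\<zero>\<^bsub>free_module R B\<^esub> = (\<lambda>_. \<zero>\<^bsub>R\<^esub>)"
  "f \<oplus>\<^bsub>free_module R B\<^esub> g = (\<lambda>x. f x \<oplus>\<^bsub>R\<^esub> g x)"
  "r \<odot>\<^bsub>free_module R B\<^esub> f = (\<lambda>x. r \<otimes>\<^bsub>R\<^esub> f x)"
  by (simp_all add: free_module_def)

lemma free_module_carrier_iff:
  "f \<in> carrier (free_module R B) \<longleftrightarrow>
    (\<forall>x. f x \<in> carrier R) \<and> finite (support R f) \<and> support R f \<subseteq> B"
  by (auto simp: free_module_def)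

lemma free_moduleD:
  assumes "f \<in> carrier (free_module R B)"
  shows "f x \<in> carrier R" "finite (support R f)" "support R f \<subseteq> B" "x \<notin> B \<Longrightarrow> f x = \<zero>\<^bsub>R\<^esub>"
  using assms by (auto simp: free_module_carrier_iff support_def)

lemma free_moduleI:
  assumes "\<And>x. f x \<in> carrier R" "finite T" "T \<subseteq> B" "\<And>x. x \<notin> T \<Longrightarrow> f x = \<zero>\<^bsub>R\<^esub>"
  shows "f \<in> carrier (free_module R B)"
proof -
  have "support R f \<subseteq> T" using assms(4) by (auto simp: support_def)
  then show ?thesis using assms finite_subset by (auto simp: free_module_carrier_iff)
qed

context cring
begin

lemma free_module_add_closed:
  assumes "f \<in> carrier (free_module R B)" "g \<in> carrier (free_module R B)"
  shows "(\<lambda>x. f x \<oplus> g x) \<in> carrier (free_module R B)"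
  using assms
  by (intro free_moduleI[where T = "support R f \<union> support R g"])
    (auto simp: free_module_carrier_iff support_def)

lemma free_module_smult_closed:
  assumes "r \<in> carrier R" "f \<in> carrier (free_module R B)"
  shows "(\<lambda>x. r \<otimes> f x) \<in> carrier (free_module R B)"
  using assms
  by (intro free_moduleI[where T = "support R f"]) (auto simp: free_module_carrier_iff support_def)

lemma module_free_module: "module R (free_module R B)"
proof (rule moduleI)
  show "cring R" by (rule is_cring)
  show "abelian_group (free_module R B)"
  proof (rule abelian_groupI)
    fix f assume f: "f \<in> carrier (free_module R B)"
    show "\<exists>g\<in>carrier (free_module R B). g \<oplus>\<^bsub>free_module R B\<^esub> f = \<zero>\<^bsub>free_module R B\<^esub>"
    proof (intro bexI)
      show "(\<lambda>x. \<ominus> \<one> \<otimes> f x) \<in> carrier (free_module R B)"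
        using f by (intro free_module_smult_closed) auto
      show "(\<lambda>x. \<ominus> \<one> \<otimes> f x) \<oplus>\<^bsub>free_module R B\<^esub> f = \<zero>\<^bsub>free_module R B\<^esub>"
        using free_moduleD(1)[OF f] by (simp add: fun_eq_iff l_minus l_neg)
    qed
  next
    show "\<zero>\<^bsub>free_module R B\<^esub> \<in> carrier (free_module R B)"
      by (auto intro: free_moduleI[where T = "{}"])
  qed (auto simp: free_module_add_closed free_moduleD(1) a_ac fun_eq_iff)
qed (auto simp: free_module_add_closed free_module_smult_closed free_moduleD(1) l_distr r_distr m_assoc fun_eq_iff)

lemma free_basis_closed: "x \<in> B \<Longrightarrow> free_basis R x \<in> carrier (free_module R B)"
  by (rule free_moduleI[where T = "{x}"]) (auto simp: free_basis_def)

lemma free_module_induct [consumes 1, case_names zero add basis]: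
  assumes f: "f \<in> carrier (free_module R B)"
    and zero: "P (\<lambda>_. \<zero>)"
    and add: "\<And>f g. f \<in> carrier (free_module R B) \<Longrightarrow> g \<in> carrier (free_module R B) \<Longrightarrow> P f \<Longrightarrow> P g \<Longrightarrow>
      P (\<lambda>x. f x \<oplus> g x)"
    and basis: "\<And>r x. r \<in> carrier R \<Longrightarrow> x \<in> B \<Longrightarrow> P (\<lambda>y. r \<otimes> free_basis R x y)"
  shows "P f"
proof -
  have "P f" if "support R f \<subseteq> T" "finite T" "T \<subseteq> B" "\<And>x. f x \<in> carrier R" for T f
    using that(2,1,3,4)
  proof (induct T arbitrary: f)
    case empty
    then have "f = (\<lambda>_. \<zero>)" by (auto simp: support_def)
    then show ?case using zero by simp
  next
    case (insert a T)
    let ?g = "\<lambda>x. if x = a then \<zero> else f x"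
    let ?h = "\<lambda>y. f a \<otimes> free_basis R a y"
    have g: "P ?g" using insert by (intro insert(3)) (auto simp: support_def)
    have gc: "?g \<in> carrier (free_module R B)"
      using insert by (intro free_moduleI[where T = T]) (auto simp: support_def)
    have hc: "?h \<in> carrier (free_module R B)"
      using insert by (intro free_module_smult_closed free_basis_closed) auto
    have "f = (\<lambda>x. ?g x \<oplus> ?h x)"
      using insert by (auto simp: fun_eq_iff free_basis_def)
    then show ?case using add[OF gc hc g] basis insert by simp
  qed
  then show ?thesis using f by (auto simp: free_module_carrier_iff)
qed

end

definition linear_extension where
  "linear_extension R P w f = (\<Oplus>\<^bsub>P\<^esub>x\<in>support R f. f x \<odot>\<^bsub>P\<^esub> w x)"

lemma (in module) linear_extension_superset:
  assumes "finite T" "support R f \<subseteq> T" "\<And>x. x \<in> T \<Longrightarrow> w x \<in> carrier M" "\<And>x. f x \<in> carrier R"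
  shows "linear_extension R M w f = (\<Oplus>\<^bsub>M\<^esub>x\<in>T. f x \<odot>\<^bsub>M\<^esub> w x)"
  unfolding linear_extension_def
  by (rule M.add.finprod_mono_neutral_cong_left) (use assms in \<open>auto simp: support_def\<close>)

lemma (in module) linear_extension_hom:
  assumes w: "\<And>x. x \<in> B \<Longrightarrow> w x \<in> carrier M"
  shows "linear_extension R M w \<in> module_hom R (free_module R B) M"
proof (rule module_homI)
  fix f assume f: "f \<in> carrier (free_module R B)"
  note F = free_moduleD[OF f]
  have sw: "x \<in> support R f \<Longrightarrow> w x \<in> carrier M" for x using F w by auto
  show "linear_extension R M w f \<in> carrier M"
    unfolding linear_extension_def using F sw by (intro M.finsum_closed) auto
  {
    fix g assume g: "g \<in> carrier (free_module R B)"
    note G = free_moduleD[OF g]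
    let ?T = "support R f \<union> support R g"
    have T: "finite ?T" "\<And>x. x \<in> ?T \<Longrightarrow> w x \<in> carrier M" using F G w by auto
    have "support R (\<lambda>x. f x \<oplus>\<^bsub>R\<^esub> g x) \<subseteq> ?T" by (auto simp: support_def)
    then have "linear_extension R M w (f \<oplus>\<^bsub>free_module R B\<^esub> g)
        = (\<Oplus>\<^bsub>M\<^esub>x\<in>?T. (f x \<oplus>\<^bsub>R\<^esub> g x) \<odot>\<^bsub>M\<^esub> w x)"
      using T F G by (subst linear_extension_superset[of ?T]) auto
    also have "\<dots> = (\<Oplus>\<^bsub>M\<^esub>x\<in>?T. f x \<odot>\<^bsub>M\<^esub> w x \<oplus>\<^bsub>M\<^esub> g x \<odot>\<^bsub>M\<^esub> w x)"
      using T F G by (intro M.finsum_cong') (auto simp: smult_l_distr)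
    also have "\<dots> = (\<Oplus>\<^bsub>M\<^esub>x\<in>?T. f x \<odot>\<^bsub>M\<^esub> w x) \<oplus>\<^bsub>M\<^esub> (\<Oplus>\<^bsub>M\<^esub>x\<in>?T. g x \<odot>\<^bsub>M\<^esub> w x)"
      using T F G by (intro M.finsum_addf) auto
    also have "\<dots> = linear_extension R M w f \<oplus>\<^bsub>M\<^esub> linear_extension R M w g"
      using T F G by (subst (1 2) linear_extension_superset[of ?T]) auto
    finally show "linear_extension R M w (f \<oplus>\<^bsub>free_module R B\<^esub> g)
      = linear_extension R M w f \<oplus>\<^bsub>M\<^esub> linear_extension R M w g" .
  }
  fix r assume r: "r \<in> carrier R"
  have "linear_extension R M w (r \<odot>\<^bsub>free_module R B\<^esub> f)
      = (\<Oplus>\<^bsub>M\<^esub>x\<in>support R f. (r \<otimes>\<^bsub>R\<^esub> f x) \<odot>\<^bsub>M\<^esub> w x)"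
    using F sw r by (subst linear_extension_superset[of "support R f"]) (auto simp: support_def)
  also have "\<dots> = (\<Oplus>\<^bsub>M\<^esub>x\<in>support R f. r \<odot>\<^bsub>M\<^esub> (f x \<odot>\<^bsub>M\<^esub> w x))"
    using F sw r by (intro M.finsum_cong') (auto simp: smult_assoc1)
  also have "\<dots> = r \<odot>\<^bsub>M\<^esub> linear_extension R M w f"
    unfolding linear_extension_def using F sw r by (intro finsum_smult_ldistr[symmetric]) auto
  finally show "linear_extension R M w (r \<odot>\<^bsub>free_module R B\<^esub> f) = r \<odot>\<^bsub>M\<^esub> linear_extension R M w f" .
qed

lemma (in module) linear_extension_basis:
  assumes "w x \<in> carrier M"
  shows "linear_extension R M w (free_basis R x) = w x"
proof -
  have "linear_extension R M w (free_basis R x) = (\<Oplus>\<^bsub>M\<^esub>y\<in>{x}. free_basis R x y \<odot>\<^bsub>M\<^esub> w y)"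
    using assms by (intro linear_extension_superset) (auto simp: support_def free_basis_def)
  then show ?thesis using assms by (simp add: free_basis_def)
qed

lemma (in module) linear_on_free_eqI:
  assumes f: "f \<in> carrier (free_module R B)"
    and "\<phi> \<in> module_hom R (free_module R B) M" "\<psi> \<in> module_hom R (free_module R B) M"
    and "\<And>x. x \<in> B \<Longrightarrow> \<phi> (free_basis R x) = \<psi> (free_basis R x)"
  shows "\<phi> f = \<psi> f"
proof -
  have FM: "module R (free_module R B)" by (rule R.module_free_module)
  note * = module_homD[OF assms(2)] module_homD[OF assms(3)]
  show ?thesis using f
  proof (induct rule: R.free_module_induct)
    case zero
    show ?case
      using module_hom_zero[OF FM module_axioms assms(2)] module_hom_zero[OF FM module_axioms assms(3)] by simp
  next
    case (add f g)
    then show ?case using *(2)[of f g] *(5)[of f g] by simp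
  next
    case (basis r x)
    then show ?case using *(3)[of r "free_basis R x"] *(6)[of r "free_basis R x"] assms(4)
      by (simp add: R.free_basis_closed)
  qed
qed

section \<open>Tensor products of modules\<close>

definition bilinear ::
  "('r, 'c) ring_scheme \<Rightarrow> ('r, 'm, 'd) module_scheme \<Rightarrow> ('r, 'n, 'e) module_scheme \<Rightarrow>
    ('r, 'p, 'f) module_scheme \<Rightarrow> ('m \<Rightarrow> 'n \<Rightarrow> 'p) \<Rightarrow> bool"
  where "bilinear R M N P b \<longleftrightarrow>
    (\<forall>x\<in>carrier M. b x \<in> module_hom R N P) \<and> (\<forall>y\<in>carrier N. (\<lambda>x. b x y) \<in> module_hom R M P)"

lemma bilinearI:
  assumes "\<And>x y. x \<in> carrier M \<Longrightarrow> y \<in> carrier N \<Longrightarrow> b x y \<in> carrier P"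
    and "\<And>x x' y. x \<in> carrier M \<Longrightarrow> x' \<in> carrier M \<Longrightarrow> y \<in> carrier N \<Longrightarrow>
      b (x \<oplus>\<^bsub>M\<^esub> x') y = b x y \<oplus>\<^bsub>P\<^esub> b x' y"
    and "\<And>x y y'. x \<in> carrier M \<Longrightarrow> y \<in> carrier N \<Longrightarrow> y' \<in> carrier N \<Longrightarrow>
      b x (y \<oplus>\<^bsub>N\<^esub> y') = b x y \<oplus>\<^bsub>P\<^esub> b x y'"
    and "\<And>r x y. r \<in> carrier R \<Longrightarrow> x \<in> carrier M \<Longrightarrow> y \<in> carrier N \<Longrightarrow>
      b (r \<odot>\<^bsub>M\<^esub> x) y = r \<odot>\<^bsub>P\<^esub> b x y"
    and "\<And>r x y. r \<in> carrier R \<Longrightarrow> x \<in> carrier M \<Longrightarrow> y \<in> carrier N \<Longrightarrow>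
      b x (r \<odot>\<^bsub>N\<^esub> y) = r \<odot>\<^bsub>P\<^esub> b x y"
  shows "bilinear R M N P b"
  using assms by (auto simp: bilinear_def intro!: module_homI)

lemma bilinearD:
  assumes "bilinear R M N P b"
  shows "x \<in> carrier M \<Longrightarrow> y \<in> carrier N \<Longrightarrow> b x y \<in> carrier P"
    and "x \<in> carrier M \<Longrightarrow> x' \<in> carrier M \<Longrightarrow> y \<in> carrier N \<Longrightarrow>
      b (x \<oplus>\<^bsub>M\<^esub> x') y = b x y \<oplus>\<^bsub>P\<^esub> b x' y"
    and "x \<in> carrier M \<Longrightarrow> y \<in> carrier N \<Longrightarrow> y' \<in> carrier N \<Longrightarrow>
      b x (y \<oplus>\<^bsub>N\<^esub> y') = b x y \<oplus>\<^bsub>P\<^esub> b x y'"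
    and "r \<in> carrier R \<Longrightarrow> x \<in> carrier M \<Longrightarrow> y \<in> carrier N \<Longrightarrow>
      b (r \<odot>\<^bsub>M\<^esub> x) y = r \<odot>\<^bsub>P\<^esub> b x y"
    and "r \<in> carrier R \<Longrightarrow> x \<in> carrier M \<Longrightarrow> y \<in> carrier N \<Longrightarrow>
      b x (r \<odot>\<^bsub>N\<^esub> y) = r \<odot>\<^bsub>P\<^esub> b x y"
  using assms module_homD unfolding bilinear_def by fastforce+

lemma pre_tensor_sel:
  "carrier (pre_tensor R M N) = carrier (free_module R (carrier M \<times> carrier N))"
  "\<zero>\<^bsub>pre_tensor R M N\<^esub> = (\<lambda>_. \<zero>\<^bsub>R\<^esub>)"
  "ring.add (pre_tensor R M N) = (\<lambda>f g x. f x \<oplus>\<^bsub>R\<^esub> g x)"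
  "module.smult (pre_tensor R M N) = (\<lambda>r f x. r \<otimes>\<^bsub>R\<^esub> f x)"
  by (simp_all add: pre_tensor_def free_module_def)

lemma module_hom_pre_tensor:
  "module_hom R (pre_tensor R M N) P = module_hom R (free_module R (carrier M \<times> carrier N)) P"
  by (simp add: module_hom_def pre_tensor_sel)

text \<open>
  For bilinear \<open>b\<close> the linear extension of \<open>b\<close> is constant on every class \<open>C\<close>, so the image is a singleton.
\<close>

definition tensor_lift where
  "tensor_lift R P b C = the_elem (linear_extension R P (\<lambda>z. b (fst z) (snd z)) ` C)"

locale tensor_modules = M: module R M + N: module R N
  for R (structure) and M and N
begin

abbreviation "\<tau> \<equiv> pure_tensor R M N"
abbreviation "T \<equiv> tensor_product R M N"

lemma module_pre_tensor: "module R (pre_tensor R M N)"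
proof -
  interpret F: module R "free_module R (carrier M \<times> carrier N)"
    by (rule M.R.module_free_module)
  show ?thesis
  proof (rule moduleI)
    show "cring R" by (rule M.R.is_cring)
    show "abelian_group (pre_tensor R M N)"
    proof (rule abelian_groupI)
      fix x assume "x \<in> carrier (pre_tensor R M N)"
      then show "\<exists>y\<in>carrier (pre_tensor R M N). y \<oplus>\<^bsub>pre_tensor R M N\<^esub> x = \<zero>\<^bsub>pre_tensor R M N\<^esub>"
        using F.M.l_neg[of x] F.M.a_inv_closed[of x] unfolding pre_tensor_sel by auto
    qed (use F.M.a_closed F.M.zero_closed F.M.a_assoc F.M.a_comm F.M.l_zero in \<open>auto simp: pre_tensor_sel\<close>)
  qed (use F.smult_closed F.smult_l_distr F.smult_r_distr F.smult_assoc1 F.smult_one in \<open>auto simp: pre_tensor_sel\<close>)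
qed

sublocale P: module R "pre_tensor R M N" by (rule module_pre_tensor)

lemma basis_closed [simp]: "x \<in> carrier M \<Longrightarrow> y \<in> carrier N \<Longrightarrow> free_basis R (x, y) \<in> carrier (pre_tensor R M N)"
  by (simp add: pre_tensor_sel M.R.free_basis_closed)

lemma tensor_generators_closed: "tensor_generators R M N \<subseteq> carrier (pre_tensor R M N)"
  by (auto simp: tensor_generators_def Let_def)

lemma tensor_relations_submodule: "submodule (tensor_relations R M N) R (pre_tensor R M N)"
  unfolding tensor_relations_def
  by (rule submodule_generated_submodule[OF module_pre_tensor tensor_generators_closed])

sublocale Q: quotient_of_module R "pre_tensor R M N" "tensor_relations R M N"
  by (rule quotient_of_moduleI[OF module_pre_tensor tensor_relations_submodule])

lemma module_tensor_product: "module R T"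
  unfolding tensor_product_def by (rule Q.module_quotient)

sublocale T: module R T by (rule module_tensor_product)

lemma tensor_generators_sub: "tensor_generators R M N \<subseteq> tensor_relations R M N"
  unfolding tensor_relations_def by (rule submodule_generated_superset)

lemma pure_tensor_closed: "x \<in> carrier M \<Longrightarrow> y \<in> carrier N \<Longrightarrow> \<tau> x y \<in> carrier T"
  by (simp add: pure_tensor_def tensor_product_def Q.coset_closed)

lemma tensor_relationI:
  assumes "x \<ominus>\<^bsub>pre_tensor R M N\<^esub> y \<in> tensor_generators R M N"
    and "x \<in> carrier (pre_tensor R M N)" "y \<in> carrier (pre_tensor R M N)"
  shows "tensor_relations R M N +>\<^bsub>pre_tensor R M N\<^esub> x = tensor_relations R M N +>\<^bsub>pre_tensor R M N\<^esub> y"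
  using assms tensor_generators_sub by (simp only: Q.coset_eq_iff) blast

lemma tensor_generator_intros:
  "x \<in> carrier M \<Longrightarrow> x' \<in> carrier M \<Longrightarrow> y \<in> carrier N \<Longrightarrow>
    free_basis R (x \<oplus>\<^bsub>M\<^esub> x', y) \<ominus>\<^bsub>pre_tensor R M N\<^esub>
      (free_basis R (x, y) \<oplus>\<^bsub>pre_tensor R M N\<^esub> free_basis R (x', y)) \<in> tensor_generators R M N"
  "x \<in> carrier M \<Longrightarrow> y \<in> carrier N \<Longrightarrow> y' \<in> carrier N \<Longrightarrow>
    free_basis R (x, y \<oplus>\<^bsub>N\<^esub> y') \<ominus>\<^bsub>pre_tensor R M N\<^esub>
      (free_basis R (x, y) \<oplus>\<^bsub>pre_tensor R M N\<^esub> free_basis R (x, y')) \<in> tensor_generators R M N"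
  "r \<in> carrier R \<Longrightarrow> x \<in> carrier M \<Longrightarrow> y \<in> carrier N \<Longrightarrow>
    free_basis R (r \<odot>\<^bsub>M\<^esub> x, y) \<ominus>\<^bsub>pre_tensor R M N\<^esub>
      (r \<odot>\<^bsub>pre_tensor R M N\<^esub> free_basis R (x, y)) \<in> tensor_generators R M N"
  "r \<in> carrier R \<Longrightarrow> x \<in> carrier M \<Longrightarrow> y \<in> carrier N \<Longrightarrow>
    free_basis R (x, r \<odot>\<^bsub>N\<^esub> y) \<ominus>\<^bsub>pre_tensor R M N\<^esub>
      (r \<odot>\<^bsub>pre_tensor R M N\<^esub> free_basis R (x, y)) \<in> tensor_generators R M N"
  unfolding tensor_generators_def Let_def by blast+

lemma bilinear_pure_tensor: "bilinear R M N T \<tau>"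
proof (rule bilinearI)
  fix x x' y assume "x \<in> carrier M" "x' \<in> carrier M" "y \<in> carrier N"
  then show "\<tau> (x \<oplus>\<^bsub>M\<^esub> x') y = \<tau> x y \<oplus>\<^bsub>T\<^esub> \<tau> x' y"
    unfolding pure_tensor_def tensor_product_def
    by (simp only: Q.coset_add basis_closed) (intro tensor_relationI tensor_generator_intros, auto)
next
  fix x y y' assume "x \<in> carrier M" "y \<in> carrier N" "y' \<in> carrier N"
  then show "\<tau> x (y \<oplus>\<^bsub>N\<^esub> y') = \<tau> x y \<oplus>\<^bsub>T\<^esub> \<tau> x y'"
    unfolding pure_tensor_def tensor_product_def
    by (simp only: Q.coset_add basis_closed) (intro tensor_relationI tensor_generator_intros, auto)
next
  fix s x y assume "s \<in> carrier R" "x \<in> carrier M" "y \<in> carrier N"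
  then show "\<tau> (s \<odot>\<^bsub>M\<^esub> x) y = s \<odot>\<^bsub>T\<^esub> \<tau> x y" "\<tau> x (s \<odot>\<^bsub>N\<^esub> y) = s \<odot>\<^bsub>T\<^esub> \<tau> x y"
    unfolding pure_tensor_def tensor_product_def
    by (simp_all only: Q.coset_smult basis_closed)
      ((intro tensor_relationI tensor_generator_intros; simp)+)
qed (rule pure_tensor_closed)

lemmas pure_tensor_simps = bilinearD(2-5)[OF bilinear_pure_tensor]

lemma pure_tensor_zero:
  "y \<in> carrier N \<Longrightarrow> \<tau> \<zero>\<^bsub>M\<^esub> y = \<zero>\<^bsub>T\<^esub>"
  "x \<in> carrier M \<Longrightarrow> \<tau> x \<zero>\<^bsub>N\<^esub> = \<zero>\<^bsub>T\<^esub>"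
  using bilinear_pure_tensor module_hom_zero[OF M.module_axioms module_tensor_product]
    module_hom_zero[OF N.module_axioms module_tensor_product]
  unfolding bilinear_def by auto

lemma carrier_tensor:
  "carrier T = (\<lambda>h. tensor_relations R M N +>\<^bsub>pre_tensor R M N\<^esub> h) ` carrier (pre_tensor R M N)"
  by (simp add: tensor_product_def Q.carrier_quotient)

lemma coset_hom:
  "(\<lambda>h. tensor_relations R M N +>\<^bsub>pre_tensor R M N\<^esub> h) \<in> module_hom R (pre_tensor R M N) T"
  by (rule module_homI) (auto simp: tensor_product_def Q.coset_add Q.coset_smult)

text \<open>
  Scalar multiples of pure tensors are pure, so sums of pure tensors are everything.
\<close>

lemma tensor_induct [consumes 1, case_names pure add]:
  assumes z: "z \<in> carrier T"
    and pure: "\<And>x y. x \<in> carrier M \<Longrightarrow> y \<in> carrier N \<Longrightarrow> \<Phi> (\<tau> x y)"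
    and add: "\<And>z z'. z \<in> carrier T \<Longrightarrow> z' \<in> carrier T \<Longrightarrow> \<Phi> z \<Longrightarrow> \<Phi> z' \<Longrightarrow> \<Phi> (z \<oplus>\<^bsub>T\<^esub> z')"
  shows "\<Phi> z"
proof -
  note hom = module_homD[OF coset_hom, unfolded pre_tensor_sel]
  obtain h where h: "h \<in> carrier (free_module R (carrier M \<times> carrier N))"
    and z: "z = tensor_relations R M N +>\<^bsub>pre_tensor R M N\<^esub> h"
    using z by (auto simp: carrier_tensor pre_tensor_sel)
  show ?thesis using h unfolding z
  proof (induct rule: M.R.free_module_induct)
    case zero
    have "\<Phi> (\<tau> \<zero>\<^bsub>M\<^esub> \<zero>\<^bsub>N\<^esub>)" by (rule pure) auto
    then show ?case
      using module_hom_zero[OF module_pre_tensor module_tensor_product coset_hom]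
      by (simp add: pure_tensor_zero pre_tensor_sel)
  next
    case (add f g)
    then show ?case using hom(1,2) assms(3) by simp
  next
    case (basis r p)
    then obtain x y where p: "p = (x, y)" "x \<in> carrier M" "y \<in> carrier N" by auto
    have "\<Phi> (\<tau> (r \<odot>\<^bsub>M\<^esub> x) y)" using p basis by (intro pure) auto
    also have "\<tau> (r \<odot>\<^bsub>M\<^esub> x) y = r \<odot>\<^bsub>T\<^esub> \<tau> x y"
      using p basis by (simp add: pure_tensor_simps)
    finally show ?case
      using hom(3)[of r "free_basis R (x, y)"] p basis
      by (simp add: pure_tensor_def M.R.free_basis_closed)
  qed
qed

context
  fixes L :: "('a, 'l, 'z) module_scheme" and b
  assumes L: "module R L" and b: "bilinear R M N L b"
begin

interpretation L: module R L by (rule L)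

lemma evaluation_hom:
  "linear_extension R L (\<lambda>z. b (fst z) (snd z)) \<in> module_hom R (pre_tensor R M N) L"
  unfolding module_hom_pre_tensor
  by (rule L.linear_extension_hom) (use bilinearD(1)[OF b] in auto)

lemma evaluation_basis:
  "x \<in> carrier M \<Longrightarrow> y \<in> carrier N \<Longrightarrow>
    linear_extension R L (\<lambda>z. b (fst z) (snd z)) (free_basis R (x, y)) = b x y"
  by (subst L.linear_extension_basis) (use bilinearD(1)[OF b] in auto)

lemma evaluation_relations:
  assumes "h \<in> tensor_relations R M N"
  shows "linear_extension R L (\<lambda>z. b (fst z) (snd z)) h = \<zero>\<^bsub>L\<^esub>"
proof -
  let ?ev = "linear_extension R L (\<lambda>z. b (fst z) (snd z))"
  note D = bilinearD[OF b]
  note hom = evaluation_hom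
  note ev = module_hom_minus[OF module_pre_tensor L hom] module_homD(2,3)[OF hom] evaluation_basis
  have neg: "u \<in> carrier L \<Longrightarrow> u \<ominus>\<^bsub>L\<^esub> u = \<zero>\<^bsub>L\<^esub>" for u by (simp add: a_minus_def L.M.r_neg)
  have "tensor_generators R M N \<subseteq> {h \<in> carrier (pre_tensor R M N). ?ev h = \<zero>\<^bsub>L\<^esub>}"
    using tensor_generators_closed
    by (auto simp: tensor_generators_def Let_def ev D neg)
  then have "tensor_relations R M N \<subseteq> {h \<in> carrier (pre_tensor R M N). ?ev h = \<zero>\<^bsub>L\<^esub>}"
    unfolding tensor_relations_def
    by (intro submodule_generated_least submodule_kernel[OF module_pre_tensor L hom])
  then show ?thesis using assms by auto
qed

lemma evaluation_coset:
  assumes h: "h \<in> carrier (pre_tensor R M N)"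
    and g: "g \<in> tensor_relations R M N +>\<^bsub>pre_tensor R M N\<^esub> h"
  shows "linear_extension R L (\<lambda>z. b (fst z) (snd z)) g = linear_extension R L (\<lambda>z. b (fst z) (snd z)) h"
proof -
  obtain s where s: "s \<in> tensor_relations R M N" "g = s \<oplus>\<^bsub>pre_tensor R M N\<^esub> h"
    using g Q.mem_coset_iff by blast
  then have "s \<in> carrier (pre_tensor R M N)"
    using P.submoduleE(1)[OF tensor_relations_submodule] by auto
  then show ?thesis
    using s h module_homD(1,2)[OF evaluation_hom] by (simp add: evaluation_relations)
qed

lemma tensor_lift_coset:
  assumes h: "h \<in> carrier (pre_tensor R M N)"
  shows "tensor_lift R L b (tensor_relations R M N +>\<^bsub>pre_tensor R M N\<^esub> h)
    = linear_extension R L (\<lambda>z. b (fst z) (snd z)) h"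
proof -
  have "h \<in> tensor_relations R M N +>\<^bsub>pre_tensor R M N\<^esub> h" by (rule Q.sub.a_rcos_self[OF h])
  then have "(\<lambda>_. linear_extension R L (\<lambda>z. b (fst z) (snd z)) h) ` (tensor_relations R M N +>\<^bsub>pre_tensor R M N\<^esub> h)
      = {linear_extension R L (\<lambda>z. b (fst z) (snd z)) h}"
    by (rule image_constant)
  moreover have "linear_extension R L (\<lambda>z. b (fst z) (snd z)) ` (tensor_relations R M N +>\<^bsub>pre_tensor R M N\<^esub> h)
      = (\<lambda>_. linear_extension R L (\<lambda>z. b (fst z) (snd z)) h) ` (tensor_relations R M N +>\<^bsub>pre_tensor R M N\<^esub> h)"
    by (rule image_cong[OF refl evaluation_coset[OF h]])
  ultimately show ?thesis unfolding tensor_lift_def by simp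
qed

lemma tensor_lift_hom: "tensor_lift R L b \<in> module_hom R T L"
proof (rule module_homI)
  note hom = module_homD[OF evaluation_hom]
  note c = module_homD(2,3)[OF coset_hom, symmetric]
  fix z assume z: "z \<in> carrier T"
  then show "tensor_lift R L b z \<in> carrier L"
    by (auto simp: carrier_tensor tensor_lift_coset hom(1))
  {
    fix z' assume "z' \<in> carrier T"
    then show "tensor_lift R L b (z \<oplus>\<^bsub>T\<^esub> z') = tensor_lift R L b z \<oplus>\<^bsub>L\<^esub> tensor_lift R L b z'"
      using z by (auto simp: carrier_tensor c tensor_lift_coset hom(2))
  }
  fix r assume "r \<in> carrier R"
  then show "tensor_lift R L b (r \<odot>\<^bsub>T\<^esub> z) = r \<odot>\<^bsub>L\<^esub> tensor_lift R L b z"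
    using z by (auto simp: carrier_tensor c tensor_lift_coset hom(3))
qed

lemma tensor_lift_pure:
  "x \<in> carrier M \<Longrightarrow> y \<in> carrier N \<Longrightarrow> tensor_lift R L b (\<tau> x y) = b x y"
  by (simp add: pure_tensor_def tensor_lift_coset evaluation_basis)

end

end

lemma (in cring) finsum_free_module_apply:
  assumes "finite A" "\<And>x. x \<in> A \<Longrightarrow> w x \<in> carrier (free_module R B)"
  shows "(\<Oplus>\<^bsub>free_module R B\<^esub>x\<in>A. w x) q = (\<Oplus>x\<in>A. w x q)"
proof -
  interpret F: module R "free_module R B" by (rule module_free_module)
  show ?thesis using assms
  proof (induct A)
    case (insert a A)
    then have w: "w \<in> A \<rightarrow> carrier (free_module R B)" "w a \<in> carrier (free_module R B)"
      by blast+
    then have "(\<lambda>x. w x q) \<in> A \<rightarrow> carrier R" "w a q \<in> carrier R"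
      using free_moduleD(1)[where B = B] by blast+
    with w have "(\<Oplus>\<^bsub>free_module R B\<^esub>x\<in>insert a A. w x) = w a \<oplus>\<^bsub>free_module R B\<^esub> (\<Oplus>\<^bsub>free_module R B\<^esub>x\<in>A. w x)"
      and "(\<Oplus>x\<in>insert a A. w x q) = w a q \<oplus> (\<Oplus>x\<in>A. w x q)"
      using F.M.finsum_insert[OF insert(1,2)] finsum_insert[OF insert(1,2)] by blast+
    then show ?case using insert by simp
  qed simp
qed

locale tensor_functor = S: tensor_modules R M N + T: tensor_modules R M' N'
  for R (structure) and M N M' N' +
  fixes f g
  assumes f: "f \<in> module_hom R M M'" and g: "g \<in> module_hom R N N'"
begin

lemma bilinear_functor: "bilinear R M N T.T (\<lambda>x y. T.\<tau> (f x) (g y))"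
  by (rule bilinearI)
    (simp_all add: module_homD[OF f] module_homD[OF g] T.pure_tensor_simps T.pure_tensor_closed)

lemma push_eq_linear_extension:
  assumes "h \<in> carrier (free_module R (carrier M \<times> carrier N))"
  shows "(\<lambda>q. \<Oplus>x\<in>{x \<in> support R h. map_prod f g x = q}. h x)
    = linear_extension R (free_module R (carrier M' \<times> carrier N')) (\<lambda>z. free_basis R (map_prod f g z)) h"
proof
  fix q
  note F = free_moduleD[OF assms]
  let ?B = "carrier M' \<times> carrier N'"
  have mp: "map_prod f g z \<in> ?B" if "z \<in> support R h" for z
    using that F(3) module_homD(1)[OF f] module_homD(1)[OF g] by (cases z) auto
  have "linear_extension R (free_module R ?B) (\<lambda>z. free_basis R (map_prod f g z)) h q
      = (\<Oplus>x\<in>support R h. h x \<otimes> free_basis R (map_prod f g x) q)"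
    unfolding linear_extension_def
    by (subst S.M.R.finsum_free_module_apply)
      (use F mp in \<open>auto intro!: S.M.R.free_module_smult_closed S.M.R.free_basis_closed\<close>)
  also have "\<dots> = (\<Oplus>x\<in>{x \<in> support R h. map_prod f g x = q}. h x)"
    by (rule S.M.R.add.finprod_mono_neutral_cong_right)
      (use F in \<open>auto simp: free_basis_def split: if_splits\<close>)
  finally show "(\<Oplus>x\<in>{x \<in> support R h. map_prod f g x = q}. h x)
    = linear_extension R (free_module R ?B) (\<lambda>z. free_basis R (map_prod f g z)) h q" by simp
qed

text \<open>
  The representative used in the definition of \<open>tensor_map\<close> is the image of \<open>h\<close> under the map of free
  modules induced by \<open>f\<close> and \<open>g\<close>.  Its class is therefore linear in \<open>h\<close>, and so is determined on the basis.
\<close>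

lemma push_coset:
  assumes h: "h \<in> carrier (pre_tensor R M N)"
  shows "tensor_relations R M' N' +>\<^bsub>pre_tensor R M' N'\<^esub>
      (\<lambda>q. \<Oplus>x\<in>{x \<in> support R h. map_prod f g x = q}. h x)
    = linear_extension R T.T (\<lambda>z. T.\<tau> (f (fst z)) (g (snd z))) h"
proof -
  let ?F = "free_module R (carrier M' \<times> carrier N')"
  let ?push = "linear_extension R ?F (\<lambda>z. free_basis R (map_prod f g z))"
  let ?c = "\<lambda>h. tensor_relations R M' N' +>\<^bsub>pre_tensor R M' N'\<^esub> h"
  interpret F: module R ?F by (rule S.M.R.module_free_module)
  have mp: "map_prod f g z \<in> carrier M' \<times> carrier N'" if "z \<in> carrier M \<times> carrier N" for z
    using that module_homD(1)[OF f] module_homD(1)[OF g] by (cases z) auto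
  have push: "?push \<in> module_hom R (free_module R (carrier M \<times> carrier N)) ?F"
    by (rule F.linear_extension_hom) (use mp in \<open>auto intro!: S.M.R.free_basis_closed\<close>)
  have "?c \<in> module_hom R ?F T.T"
    using T.coset_hom by (simp add: module_hom_pre_tensor)
  from module_hom_comp[OF push this]
  have a: "(\<lambda>h. ?c (?push h)) \<in> module_hom R (free_module R (carrier M \<times> carrier N)) T.T" .
  have b: "linear_extension R T.T (\<lambda>z. T.\<tau> (f (fst z)) (g (snd z)))
      \<in> module_hom R (free_module R (carrier M \<times> carrier N)) T.T"
    using S.evaluation_hom[OF T.module_tensor_product bilinear_functor]
    by (simp add: module_hom_pre_tensor)
  have c: "?c (?push (free_basis R z))
      = linear_extension R T.T (\<lambda>z. T.\<tau> (f (fst z)) (g (snd z))) (free_basis R z)"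
    if z: "z \<in> carrier M \<times> carrier N" for z
  proof -
    have "?push (free_basis R z) = free_basis R (map_prod f g z)"
      using mp[OF z] by (intro F.linear_extension_basis S.M.R.free_basis_closed)
    moreover have "linear_extension R T.T (\<lambda>z. T.\<tau> (f (fst z)) (g (snd z))) (free_basis R z)
        = T.\<tau> (f (fst z)) (g (snd z))"
      using S.evaluation_basis[OF T.module_tensor_product bilinear_functor, of "fst z" "snd z"] z by auto
    ultimately show ?thesis
      by (cases z) (simp add: pure_tensor_def)
  qed
  have "?c (?push h) = linear_extension R T.T (\<lambda>z. T.\<tau> (f (fst z)) (g (snd z))) h"
    by (rule T.T.linear_on_free_eqI[OF _ a b c]) (use h in \<open>simp_all only: pre_tensor_sel\<close>)
  then show ?thesis
    using h by (simp add: push_eq_linear_extension pre_tensor_sel)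
qed

lemma tensor_map_eq_lift:
  assumes "C \<in> carrier S.T"
  shows "tensor_map R M' N' f g C = tensor_lift R T.T (\<lambda>x y. T.\<tau> (f x) (g y)) C"
proof -
  obtain h where h: "h \<in> carrier (pre_tensor R M N)"
    and C: "C = tensor_relations R M N +>\<^bsub>pre_tensor R M N\<^esub> h"
    using assms by (auto simp: S.carrier_tensor)
  have hC: "h \<in> C" unfolding C by (rule S.Q.sub.a_rcos_self[OF h])
  have "g' \<in> carrier (pre_tensor R M N)" if "g' \<in> C" for g'
    using that h S.Q.sub.a_subset S.P.M.a_r_coset_subset_G C by blast
  then have "tensor_relations R M' N' +>\<^bsub>pre_tensor R M' N'\<^esub>
      (\<lambda>q. \<Oplus>x\<in>{x \<in> support R g'. map_prod f g x = q}. g' x)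
    = linear_extension R T.T (\<lambda>z. T.\<tau> (f (fst z)) (g (snd z))) h" if "g' \<in> C" for g'
    using that S.evaluation_coset[OF T.module_tensor_product bilinear_functor h, of g']
    by (simp add: push_coset C)
  then have "tensor_map R M' N' f g C = linear_extension R T.T (\<lambda>z. T.\<tau> (f (fst z)) (g (snd z))) h"
    unfolding tensor_map_def using hC by (simp cong: SUP_cong) blast
  then show ?thesis
    using S.tensor_lift_coset[OF T.module_tensor_product bilinear_functor h] C by simp
qed

lemma tensor_map_hom: "tensor_map R M' N' f g \<in> module_hom R S.T T.T"
  using S.tensor_lift_hom[OF T.module_tensor_product bilinear_functor]
  by (auto simp: module_hom_def tensor_map_eq_lift)

lemma tensor_map_pure:
  assumes "x \<in> carrier M" "y \<in> carrier N"
  shows "tensor_map R M' N' f g (S.\<tau> x y) = T.\<tau> (f x) (g y)"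
  using assms S.tensor_lift_pure[OF T.module_tensor_product bilinear_functor]
  by (simp add: tensor_map_eq_lift S.pure_tensor_closed)

end

lemma (in module) minus_eq_zeroD:
  assumes "x \<in> carrier M" "y \<in> carrier M" "x \<ominus>\<^bsub>M\<^esub> y = \<zero>\<^bsub>M\<^esub>"
  shows "x = y"
proof -
  have "x = (x \<ominus>\<^bsub>M\<^esub> y) \<oplus>\<^bsub>M\<^esub> y" using assms(1,2) by (simp add: a_minus_def M.a_assoc M.l_neg)
  then show ?thesis using assms by simp
qed

section \<open>Tensor products with free modules\<close>

locale free_tensor = C: cring R + Mod: module R M for R (structure) and M and B :: "'x set"
begin

abbreviation "F \<equiv> free_module R B"

sublocale tensor_modules R F M
  by (intro tensor_modules.intro C.module_free_module Mod.module_axioms)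

lemma free_tensor_induct [consumes 1, case_names basis zero add]:
  assumes z: "z \<in> carrier T"
    and basis: "\<And>x m. x \<in> B \<Longrightarrow> m \<in> carrier M \<Longrightarrow> \<Phi> (\<tau> (free_basis R x) m)"
    and zero: "\<Phi> \<zero>\<^bsub>T\<^esub>"
    and add: "\<And>z z'. z \<in> carrier T \<Longrightarrow> z' \<in> carrier T \<Longrightarrow> \<Phi> z \<Longrightarrow> \<Phi> z' \<Longrightarrow> \<Phi> (z \<oplus>\<^bsub>T\<^esub> z')"
  shows "\<Phi> z"
  using z
proof (induct rule: tensor_induct)
  case (pure f m)
  from pure(1) show ?case
  proof (induct rule: C.free_module_induct)
    case zero
    then show ?case using assms(3) pure_tensor_zero(1)[OF pure(2)] by simp
  next
    case (add f g)
    then show ?case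
      using pure(2) assms(4) pure_tensor_simps(1)[of f g m] by (simp add: pure_tensor_closed)
  next
    case (basis r x)
    have "\<Phi> (\<tau> (free_basis R x) (r \<odot>\<^bsub>M\<^esub> m))" using basis pure(2) by (intro assms(2)) auto
    then show ?case
      using basis pure(2) pure_tensor_simps(3,4)[of r "free_basis R x" m] C.free_basis_closed[of x B] by simp
  qed
qed (rule add)

text \<open>
  An element of \<open>F \<otimes> M\<close> involves finitely many basis elements of \<open>F\<close>.  Expressed through
  homomorphisms this allows arguing on basis elements, with no choice of an expansion as a sum.
\<close>

lemma hom_finitely_determined:
  fixes Q :: "('a, 'q) module"
  assumes Q: "module R Q" and z: "z \<in> carrier T"
  shows "\<exists>G. finite G \<and> G \<subseteq> B \<and> (\<forall>\<phi> \<psi>. \<phi> \<in> module_hom R T Q \<longrightarrow> \<psi> \<in> module_hom R T Q \<longrightarrow>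
    (\<forall>x\<in>G. \<forall>m\<in>carrier M. \<phi> (\<tau> (free_basis R x) m) = \<psi> (\<tau> (free_basis R x) m)) \<longrightarrow> \<phi> z = \<psi> z)"
  using z
proof (induct rule: free_tensor_induct)
  case (basis x m)
  then show ?case by (intro exI[of _ "{x}"]) auto
next
  case zero
  show ?case
  proof (intro exI[of _ "{}"] conjI allI impI)
    fix \<phi> \<psi> assume "\<phi> \<in> module_hom R T Q" "\<psi> \<in> module_hom R T Q"
    then show "\<phi> \<zero>\<^bsub>T\<^esub> = \<psi> \<zero>\<^bsub>T\<^esub>"
      by (simp only: module_hom_zero[OF module_tensor_product Q])
  qed auto
next
  case (add z z')
  from add(3) obtain G where G: "finite G" "G \<subseteq> B" "\<And>\<phi> \<psi>. \<phi> \<in> module_hom R T Q \<Longrightarrow> \<psi> \<in> module_hom R T Q \<Longrightarrow>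
    (\<forall>x\<in>G. \<forall>m\<in>carrier M. \<phi> (\<tau> (free_basis R x) m) = \<psi> (\<tau> (free_basis R x) m)) \<Longrightarrow> \<phi> z = \<psi> z"
    by blast
  from add(4) obtain H where H: "finite H" "H \<subseteq> B" "\<And>\<phi> \<psi>. \<phi> \<in> module_hom R T Q \<Longrightarrow> \<psi> \<in> module_hom R T Q \<Longrightarrow>
    (\<forall>x\<in>H. \<forall>m\<in>carrier M. \<phi> (\<tau> (free_basis R x) m) = \<psi> (\<tau> (free_basis R x) m)) \<Longrightarrow> \<phi> z' = \<psi> z'"
    by blast
  show ?case
  proof (intro exI[of _ "G \<union> H"] conjI allI impI)
    fix \<phi> \<psi> assume h: "\<phi> \<in> module_hom R T Q" "\<psi> \<in> module_hom R T Q"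
      and eq: "\<forall>x\<in>G \<union> H. \<forall>m\<in>carrier M. \<phi> (\<tau> (free_basis R x) m) = \<psi> (\<tau> (free_basis R x) m)"
    have "\<phi> z = \<psi> z" "\<phi> z' = \<psi> z'" using G(3)[OF h] H(3)[OF h] eq by blast+
    then show "\<phi> (z \<oplus>\<^bsub>T\<^esub> z') = \<psi> (z \<oplus>\<^bsub>T\<^esub> z')"
      using module_homD(2)[OF h(1)] module_homD(2)[OF h(2)] add(1,2) by simp
  qed (use G H in auto)
qed

definition coord :: "'x \<Rightarrow> (('x \<Rightarrow> 'a) \<times> 'c \<Rightarrow> 'a) set \<Rightarrow> 'c"
  where "coord x = tensor_lift R M (\<lambda>f m. f x \<odot>\<^bsub>M\<^esub> m)"

lemma bilinear_coord: "bilinear R F M M (\<lambda>f m. f x \<odot>\<^bsub>M\<^esub> m)"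
  by (rule bilinearI)
    (simp_all add: free_moduleD(1)[where B = B] Mod.smult_l_distr Mod.smult_r_distr Mod.smult_assoc1[symmetric] C.m_comm)

lemma coord_hom: "coord x \<in> module_hom R T M"
  unfolding coord_def by (rule tensor_lift_hom[OF Mod.module_axioms bilinear_coord])

lemma coord_pure: "f \<in> carrier F \<Longrightarrow> m \<in> carrier M \<Longrightarrow> coord x (\<tau> f m) = f x \<odot>\<^bsub>M\<^esub> m"
  unfolding coord_def by (rule tensor_lift_pure[OF Mod.module_axioms bilinear_coord])

lemma coord_basis:
  "y \<in> B \<Longrightarrow> m \<in> carrier M \<Longrightarrow> coord x (\<tau> (free_basis R y) m) = (if x = y then m else \<zero>\<^bsub>M\<^esub>)"
  by (simp add: coord_pure C.free_basis_closed) (simp add: free_basis_def)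

lemma coord_finite: "z \<in> carrier T \<Longrightarrow> \<exists>G. finite G \<and> G \<subseteq> B \<and> (\<forall>x. x \<notin> G \<longrightarrow> coord x z = \<zero>\<^bsub>M\<^esub>)"
proof (induct rule: free_tensor_induct)
  case (basis x m)
  then show ?case by (intro exI[of _ "{x}"]) (auto simp: coord_basis)
next
  case zero
  show ?case
    using module_hom_zero[OF module_tensor_product Mod.module_axioms coord_hom]
    by (intro exI[of _ "{}"]) simp
next
  case (add z z')
  then obtain G H where "finite G" "G \<subseteq> B" "\<forall>x. x \<notin> G \<longrightarrow> coord x z = \<zero>\<^bsub>M\<^esub>"
    "finite H" "H \<subseteq> B" "\<forall>x. x \<notin> H \<longrightarrow> coord x z' = \<zero>\<^bsub>M\<^esub>" by blast
  then show ?case using module_homD(2)[OF coord_hom add(1,2)]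
    by (intro exI[of _ "G \<union> H"]) auto
qed

text \<open>
  The finite sum \<open>\<rho> w\<close> of the tensors of basis elements with the coordinates of \<open>w\<close> is a homomorphism in \<open>w\<close>
  that fixes the tensors of the basis elements in \<open>G\<close>, hence also fixes \<open>z\<close>.
\<close>

lemma coords_zero:
  assumes z: "z \<in> carrier T" and c: "\<And>x. x \<in> B \<Longrightarrow> coord x z = \<zero>\<^bsub>M\<^esub>"
  shows "z = \<zero>\<^bsub>T\<^esub>"
proof -
  obtain G where G: "finite G" "G \<subseteq> B" and det: "\<And>\<phi> \<psi>. \<phi> \<in> module_hom R T T \<Longrightarrow> \<psi> \<in> module_hom R T T \<Longrightarrow>
    (\<forall>x\<in>G. \<forall>m\<in>carrier M. \<phi> (\<tau> (free_basis R x) m) = \<psi> (\<tau> (free_basis R x) m)) \<Longrightarrow> \<phi> z = \<psi> z"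
    using hom_finitely_determined[OF module_tensor_product z] by blast
  define \<rho> where "\<rho> w = (\<Oplus>\<^bsub>T\<^esub>x\<in>G. \<tau> (free_basis R x) (coord x w))" for w
  have e: "free_basis R x \<in> carrier F" if "x \<in> G" for x using that G C.free_basis_closed[of x B] by auto
  note ch = module_homD[OF coord_hom]
  have cl: "(\<lambda>x. \<tau> (free_basis R x) (coord x w)) \<in> G \<rightarrow> carrier T" if "w \<in> carrier T" for w
    using that e ch(1) by (auto intro: pure_tensor_closed)
  have "\<rho> \<in> module_hom R T T"
  proof (rule module_homI)
    fix w assume w: "w \<in> carrier T"
    show "\<rho> w \<in> carrier T" unfolding \<rho>_def by (rule T.M.finsum_closed[OF cl[OF w]])
    {
      fix v assume v: "v \<in> carrier T"
      have "\<rho> (w \<oplus>\<^bsub>T\<^esub> v) = (\<Oplus>\<^bsub>T\<^esub>x\<in>G. \<tau> (free_basis R x) (coord x w) \<oplus>\<^bsub>T\<^esub> \<tau> (free_basis R x) (coord x v))"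
        unfolding \<rho>_def using cl[OF w] cl[OF v] w v e ch
        by (intro T.M.finsum_cong') (auto simp: pure_tensor_simps)
      also have "\<dots> = \<rho> w \<oplus>\<^bsub>T\<^esub> \<rho> v"
        unfolding \<rho>_def by (rule T.M.finsum_addf[OF cl[OF w] cl[OF v]])
      finally show "\<rho> (w \<oplus>\<^bsub>T\<^esub> v) = \<rho> w \<oplus>\<^bsub>T\<^esub> \<rho> v" .
    }
    fix r assume r: "r \<in> carrier R"
    have "\<rho> (r \<odot>\<^bsub>T\<^esub> w) = (\<Oplus>\<^bsub>T\<^esub>x\<in>G. r \<odot>\<^bsub>T\<^esub> \<tau> (free_basis R x) (coord x w))"
      unfolding \<rho>_def using cl[OF w] w e ch r
      by (intro T.M.finsum_cong') (auto simp: pure_tensor_simps)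
    also have "\<dots> = r \<odot>\<^bsub>T\<^esub> \<rho> w"
      unfolding \<rho>_def by (rule T.finsum_smult_ldistr[OF G(1) r cl[OF w], symmetric])
    finally show "\<rho> (r \<odot>\<^bsub>T\<^esub> w) = r \<odot>\<^bsub>T\<^esub> \<rho> w" .
  qed
  moreover have "(\<lambda>w. w) \<in> module_hom R T T" by (simp add: module_hom_def)
  moreover have "\<rho> (\<tau> (free_basis R y) m) = \<tau> (free_basis R y) m" if y: "y \<in> G" and m: "m \<in> carrier M" for y m
  proof -
    have "\<rho> (\<tau> (free_basis R y) m) = (\<Oplus>\<^bsub>T\<^esub>x\<in>G. if y = x then \<tau> (free_basis R x) m else \<zero>\<^bsub>T\<^esub>)"
      unfolding \<rho>_def using y m G e
      by (intro T.M.finsum_cong') (auto simp: coord_basis pure_tensor_zero pure_tensor_closed)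
    also have "\<dots> = \<tau> (free_basis R y) m"
      using y m G e by (intro T.M.finsum_singleton) (auto intro: pure_tensor_closed)
    finally show ?thesis .
  qed
  ultimately have "\<rho> z = z" using det[of \<rho> "\<lambda>w. w"] by blast
  moreover have "\<rho> z = \<zero>\<^bsub>T\<^esub>"
  proof -
    have "\<rho> z = (\<Oplus>\<^bsub>T\<^esub>x\<in>G. \<zero>\<^bsub>T\<^esub>)"
      unfolding \<rho>_def using c G e by (intro T.M.finsum_cong') (auto simp: pure_tensor_zero)
    then show ?thesis by simp
  qed
  ultimately show ?thesis by simp
qed

lemma free_tensor_eqI:
  assumes "z \<in> carrier T" "w \<in> carrier T" "\<And>x. x \<in> B \<Longrightarrow> coord x z = coord x w"
  shows "z = w"
proof -
  note minus = module_hom_minus[OF module_tensor_product Mod.module_axioms coord_hom]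
  have "coord x (z \<ominus>\<^bsub>T\<^esub> w) = \<zero>\<^bsub>M\<^esub>" if "x \<in> B" for x
    using assms(1,2) assms(3)[OF that] module_homD(1)[OF coord_hom assms(2), of x]
    by (simp add: minus Mod.M.r_neg a_minus_def[of M])
  then have "z \<ominus>\<^bsub>T\<^esub> w = \<zero>\<^bsub>T\<^esub>"
    using assms(1,2) by (intro coords_zero) auto
  then show ?thesis using T.minus_eq_zeroD[OF assms(1,2)] by blast
qed

end

section \<open>Modules on whose quotient by the ring an element acts bijectively\<close>

text \<open>
  The relation of \<open>R\<close> to a completion \<open>M\<close>, with \<open>u\<close> in the role of \<open>1\<close>: the map \<open>a \<mapsto> a u\<close> is
  injective, and multiplication by \<open>t\<close> is bijective on its cokernel (surjective by \<open>divide\<close>, injective by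
  \<open>saturated\<close>).
\<close>

locale dense_extension = Mod: module R M for R (structure) and M +
  fixes t u
  assumes t: "t \<in> carrier R" and u: "u \<in> carrier M"
    and divide: "\<And>m. m \<in> carrier M \<Longrightarrow> \<exists>a\<in>carrier R. \<exists>m'\<in>carrier M. m = a \<odot>\<^bsub>M\<^esub> u \<oplus>\<^bsub>M\<^esub> t \<odot>\<^bsub>M\<^esub> m'"
    and saturated: "\<And>m a. m \<in> carrier M \<Longrightarrow> a \<in> carrier R \<Longrightarrow> t \<odot>\<^bsub>M\<^esub> m = a \<odot>\<^bsub>M\<^esub> u \<Longrightarrow>
      \<exists>b\<in>carrier R. m = b \<odot>\<^bsub>M\<^esub> u"
    and faithful: "\<And>a. a \<in> carrier R \<Longrightarrow> a \<odot>\<^bsub>M\<^esub> u = \<zero>\<^bsub>M\<^esub> \<Longrightarrow> a = \<zero>"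
begin

lemma pow_closed [simp]: "t [^] (n::nat) \<in> carrier R"
  using t by simp

lemma pow_Suc_smult: "m \<in> carrier M \<Longrightarrow> t [^] Suc n \<odot>\<^bsub>M\<^esub> m = t \<odot>\<^bsub>M\<^esub> (t [^] n \<odot>\<^bsub>M\<^esub> m)"
  using t by (simp add: Mod.smult_assoc1[symmetric] Mod.R.m_comm)

lemma divide_pow:
  "m \<in> carrier M \<Longrightarrow> \<exists>a\<in>carrier R. \<exists>m'\<in>carrier M. m = a \<odot>\<^bsub>M\<^esub> u \<oplus>\<^bsub>M\<^esub> t [^] (n::nat) \<odot>\<^bsub>M\<^esub> m'"
proof (induct n arbitrary: m)
  case 0
  then show ?case using u by (intro bexI[of _ \<zero>] bexI[of _ m]) auto
next
  case (Suc n)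
  obtain a m' where a: "a \<in> carrier R" "m' \<in> carrier M" "m = a \<odot>\<^bsub>M\<^esub> u \<oplus>\<^bsub>M\<^esub> t \<odot>\<^bsub>M\<^esub> m'"
    using divide Suc(2) by blast
  obtain b m'' where b: "b \<in> carrier R" "m'' \<in> carrier M" "m' = b \<odot>\<^bsub>M\<^esub> u \<oplus>\<^bsub>M\<^esub> t [^] n \<odot>\<^bsub>M\<^esub> m''"
    using Suc(1)[OF a(2)] by blast
  have "m = (a \<oplus> t \<otimes> b) \<odot>\<^bsub>M\<^esub> u \<oplus>\<^bsub>M\<^esub> t [^] Suc n \<odot>\<^bsub>M\<^esub> m''"
    using a(1) b(1,2) t u unfolding a(3) b(3) pow_Suc_smult[OF b(2)]
    by (simp add: Mod.smult_l_distr Mod.smult_r_distr Mod.smult_assoc1 Mod.M.a_assoc)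
  moreover have "a \<oplus> t \<otimes> b \<in> carrier R" using a(1) b(1) t by simp
  ultimately show ?case using b(2) by (intro bexI)
qed

lemma saturated_pow:
  assumes m: "m \<in> carrier M"
  shows "a \<in> carrier R \<Longrightarrow> t [^] (n::nat) \<odot>\<^bsub>M\<^esub> m = a \<odot>\<^bsub>M\<^esub> u \<Longrightarrow> \<exists>b\<in>carrier R. m = b \<odot>\<^bsub>M\<^esub> u"
proof (induct n arbitrary: a)
  case 0
  from 0(2) have "m = a \<odot>\<^bsub>M\<^esub> u" using m by simp
  with 0(1) show ?case by (intro bexI)
next
  case (Suc n)
  have "t [^] n \<odot>\<^bsub>M\<^esub> m \<in> carrier M" using m by simp
  from saturated[OF this Suc(2) Suc(3)[unfolded pow_Suc_smult[OF m]]]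
  obtain b where b: "b \<in> carrier R" "t [^] n \<odot>\<^bsub>M\<^esub> m = b \<odot>\<^bsub>M\<^esub> u" by (elim bexE)
  show ?case by (rule Suc(1)[OF b])
qed

end

locale dense_free_tensor = free_tensor R M B + dense_extension R M t u
  for R (structure) and M and B and t and u
begin

lemma tensor_divide:
  "z \<in> carrier T \<Longrightarrow> \<exists>f\<in>carrier F. \<exists>w\<in>carrier T. z = \<tau> f u \<oplus>\<^bsub>T\<^esub> t [^] (n::nat) \<odot>\<^bsub>T\<^esub> w"
proof (induct rule: tensor_induct)
  case (pure f m)
  obtain a m' where a: "a \<in> carrier R" "m' \<in> carrier M" "m = a \<odot>\<^bsub>M\<^esub> u \<oplus>\<^bsub>M\<^esub> t [^] n \<odot>\<^bsub>M\<^esub> m'"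
    using divide_pow[OF pure(2)] by blast
  have "\<tau> f m = \<tau> (a \<odot>\<^bsub>F\<^esub> f) u \<oplus>\<^bsub>T\<^esub> t [^] n \<odot>\<^bsub>T\<^esub> \<tau> f m'"
    using a(1,2) u pure(1) unfolding a(3)
    by (simp del: free_module_sel add: pure_tensor_simps)
  moreover have "a \<odot>\<^bsub>F\<^esub> f \<in> carrier F" using a pure by (intro M.smult_closed)
  ultimately show ?case using a pure pure_tensor_closed by blast
next
  case (add z z')
  then obtain f w f' w' where *: "f \<in> carrier F" "w \<in> carrier T" "z = \<tau> f u \<oplus>\<^bsub>T\<^esub> t [^] n \<odot>\<^bsub>T\<^esub> w"
    "f' \<in> carrier F" "w' \<in> carrier T" "z' = \<tau> f' u \<oplus>\<^bsub>T\<^esub> t [^] n \<odot>\<^bsub>T\<^esub> w'" by blast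
  have "z \<oplus>\<^bsub>T\<^esub> z' = \<tau> (f \<oplus>\<^bsub>F\<^esub> f') u \<oplus>\<^bsub>T\<^esub> t [^] n \<odot>\<^bsub>T\<^esub> (w \<oplus>\<^bsub>T\<^esub> w')"
    using *(1,2,4,5) u unfolding *(3,6)
    by (simp del: free_module_sel add: pure_tensor_simps pure_tensor_closed T.smult_r_distr T.M.a_ac)
  moreover have "f \<oplus>\<^bsub>F\<^esub> f' \<in> carrier F" using * by (intro M.M.a_closed)
  ultimately show ?case using * by blast
qed

lemma tensor_saturated:
  assumes z: "z \<in> carrier T" and f: "f \<in> carrier F" and eq: "t [^] (n::nat) \<odot>\<^bsub>T\<^esub> z = \<tau> f u"
  shows "\<exists>g\<in>carrier F. z = \<tau> g u"
proof -
  note ch = module_homD[OF coord_hom]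
  have "\<exists>b\<in>carrier R. coord x z = b \<odot>\<^bsub>M\<^esub> u \<and> (coord x z = \<zero>\<^bsub>M\<^esub> \<longrightarrow> b = \<zero>)" for x
  proof (cases "coord x z = \<zero>\<^bsub>M\<^esub>")
    case True
    then show ?thesis using u by (intro bexI[of _ \<zero>]) auto
  next
    case False
    have "t [^] n \<odot>\<^bsub>M\<^esub> coord x z = f x \<odot>\<^bsub>M\<^esub> u"
      using arg_cong[OF eq, of "coord x"] ch(3)[OF pow_closed z] coord_pure[OF f u] by simp
    then show ?thesis
      using saturated_pow[OF ch(1)[OF z] free_moduleD(1)[OF f]] False by blast
  qed
  then obtain g where g: "\<And>x. g x \<in> carrier R" "\<And>x. coord x z = g x \<odot>\<^bsub>M\<^esub> u"
    "\<And>x. coord x z = \<zero>\<^bsub>M\<^esub> \<Longrightarrow> g x = \<zero>"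
    by metis
  obtain G where "finite G" "G \<subseteq> B" "\<And>x. x \<notin> G \<Longrightarrow> coord x z = \<zero>\<^bsub>M\<^esub>"
    using coord_finite[OF z] by blast
  then have gF: "g \<in> carrier F" using g by (intro free_moduleI[where T = G]) auto
  have "z = \<tau> g u"
    using z gF u by (intro free_tensor_eqI) (auto simp: coord_pure pure_tensor_closed g)
  then show ?thesis using gF by blast
qed

lemma tensor_faithful:
  assumes f: "f \<in> carrier F" and eq: "\<tau> f u = \<zero>\<^bsub>T\<^esub>"
  shows "f = \<zero>\<^bsub>F\<^esub>"
proof -
  have "f x \<odot>\<^bsub>M\<^esub> u = \<zero>\<^bsub>M\<^esub>" for x
    using arg_cong[OF eq, of "coord x"] coord_pure[OF f u]
      module_hom_zero[OF module_tensor_product Mod.module_axioms coord_hom] by simp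
  then show ?thesis using faithful free_moduleD(1)[OF f] by auto
qed

end

section \<open>The standard free resolution\<close>

lemma module_hom_cong:
  assumes "module R M" "f \<in> module_hom R M N" "\<And>x. x \<in> carrier M \<Longrightarrow> g x = f x"
  shows "g \<in> module_hom R M N"
proof -
  interpret M: module R M by fact
  show ?thesis using assms(3) module_homD[OF assms(2)] by (intro module_homI) simp_all
qed

lemma free_module_mono: "B \<subseteq> B' \<Longrightarrow> carrier (free_module R B) \<subseteq> carrier (free_module R B')"
  by (auto simp: free_module_def)

lemma module_hom_free_mono:
  "B \<subseteq> B' \<Longrightarrow> f \<in> module_hom R (free_module R B') P \<Longrightarrow> f \<in> module_hom R (free_module R B) P"
  using free_module_mono[of B B' R] unfolding module_hom_def free_module_sel by blast

context cring
begin

lemma linear_combination_Nil: "linear_combination R [] = (\<lambda>_. \<zero>)"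
  by (simp add: linear_combination_def)

lemma linear_combination_Cons:
  "linear_combination R ((c, x) # xs) = (\<lambda>y. c \<otimes> free_basis R x y \<oplus> linear_combination R xs y)"
  by (simp add: linear_combination_def Let_def)

lemma linear_combination_closed:
  "set xs \<subseteq> carrier R \<times> B \<Longrightarrow> linear_combination R xs \<in> carrier (free_module R B)"
proof (induct xs)
  case Nil
  show ?case unfolding linear_combination_Nil by (rule free_moduleI[where T = "{}"]) auto
next
  case (Cons p xs)
  obtain c x where p: "p = (c, x)" by (cases p)
  show ?case
    using Cons unfolding p linear_combination_Cons
    by (intro free_module_add_closed free_module_smult_closed free_basis_closed) auto
qed

lemma linear_combination_append:
  assumes "set xs \<subseteq> carrier R \<times> B" "set ys \<subseteq> carrier R \<times> B"
  shows "linear_combination R (xs @ ys) = (\<lambda>y. linear_combination R xs y \<oplus> linear_combination R ys y)"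
  using assms(1)
proof (induct xs)
  case Nil
  show ?case
    using free_moduleD(1)[OF linear_combination_closed[OF assms(2)]]
    by (simp add: linear_combination_Nil)
next
  case (Cons p xs)
  obtain c x where p: "p = (c, x)" by (cases p)
  have "free_basis R x y \<in> carrier R" for y by (simp add: free_basis_def)
  then show ?case
    using Cons free_moduleD(1)[OF linear_combination_closed[OF assms(2)]]
      free_moduleD(1)[OF linear_combination_closed[of xs B]]
    unfolding p by (auto simp: linear_combination_Cons fun_eq_iff a_assoc)
qed

lemma ex_linear_combination:
  assumes "f \<in> carrier (free_module R B)"
  shows "\<exists>xs. set xs \<subseteq> carrier R \<times> B \<and> linear_combination R xs = f"
  using assms
proof (induct rule: free_module_induct)
  case zero
  show ?case by (intro exI[of _ "[]"]) (simp add: linear_combination_Nil)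
next
  case (add f g)
  then obtain xs ys where "set xs \<subseteq> carrier R \<times> B" "linear_combination R xs = f"
    "set ys \<subseteq> carrier R \<times> B" "linear_combination R ys = g" by blast
  then show ?case by (intro exI[of _ "xs @ ys"]) (auto simp: linear_combination_append)
next
  case (basis r x)
  have "free_basis R x y \<in> carrier R" for y by (simp add: free_basis_def)
  with basis show ?case
    by (intro exI[of _ "[(r, x)]"]) (auto simp: linear_combination_Nil linear_combination_Cons)
qed

text \<open>
  The differentials of the resolution are defined by sums in the free module on the whole type; the sums
  can be formed in the free module on the relevant basis.
\<close>

lemma linear_extension_free_cong:
  assumes "f \<in> carrier (free_module R C)" and "\<And>x. x \<in> C \<Longrightarrow> w x \<in> carrier (free_module R B)"
    and "B \<subseteq> B'"
  shows "linear_extension R (free_module R B') w f = linear_extension R (free_module R B) w f"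
proof
  fix y
  note F = free_moduleD[OF assms(1)]
  have 1: "(\<lambda>q. f x \<otimes> w x q) \<in> carrier (free_module R B)" if "x \<in> support R f" for x
    using that assms(2) F by (intro free_module_smult_closed) auto
  then have 2: "(\<lambda>q. f x \<otimes> w x q) \<in> carrier (free_module R B')" if "x \<in> support R f" for x
    using that free_module_mono[OF assms(3)] by blast
  show "linear_extension R (free_module R B') w f y = linear_extension R (free_module R B) w f y"
    unfolding linear_extension_def free_module_sel
    by (simp only: finsum_free_module_apply[OF F(2) 1] finsum_free_module_apply[OF F(2) 2])
qed

end

locale module_resolution = Nm: module R N for R (structure) and N
begin

abbreviation "Bas \<equiv> res_basis R N"
abbreviation "F \<equiv> resolution R N"
abbreviation "D \<equiv> res_diff R"
abbreviation "aug \<equiv> res_augmentation R N"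

lemma module_F: "module R (F k)"
  unfolding resolution_def by (rule Nm.R.module_free_module)

lemma basis_in_F: "x \<in> Bas k \<Longrightarrow> free_basis R x \<in> carrier (F k)"
  unfolding resolution_def by (rule Nm.R.free_basis_closed)

lemma F_zero: "\<zero>\<^bsub>F k\<^esub> = (\<lambda>_. \<zero>)"
  by (simp add: resolution_def)

lemma res_diff_eq: "D k f = linear_extension R (free_module R UNIV) (gen_boundary R) f"
  by (simp add: res_diff_def linear_extension_def)

lemma gen_boundary_closed: "x \<in> Bas (Suc k) \<Longrightarrow> gen_boundary R x \<in> carrier (F k)"
proof -
  assume "x \<in> Bas (Suc k)"
  then obtain xs where "x = Syz xs" "set xs \<subseteq> carrier R \<times> Bas k" by auto
  then show ?thesis using Nm.R.linear_combination_closed[of xs "Bas k"] by (simp add: resolution_def)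
qed

lemma diff_hom: "D i \<in> module_hom R (F (Suc k)) (F k)"
proof -
  interpret F: module R "F k" by (rule module_F)
  have "linear_extension R (F k) (gen_boundary R) \<in> module_hom R (free_module R (Bas (Suc k))) (F k)"
    using gen_boundary_closed by (rule F.linear_extension_hom)
  moreover have "D i f = linear_extension R (F k) (gen_boundary R) f"
    if "f \<in> carrier (free_module R (Bas (Suc k)))" for f
    unfolding res_diff_eq resolution_def
    by (rule Nm.R.linear_extension_free_cong[OF that gen_boundary_closed[unfolded resolution_def] subset_UNIV])
  ultimately show ?thesis
    unfolding resolution_def by (rule module_hom_cong[OF Nm.R.module_free_module])
qed

lemma diff_basis:
  assumes "x \<in> Bas (Suc k)"
  shows "D i (free_basis R x) = gen_boundary R x"
proof -
  interpret F: module R "free_module R UNIV" by (rule Nm.R.module_free_module)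
  have "gen_boundary R x \<in> carrier (free_module R UNIV)"
    using gen_boundary_closed[OF assms] free_module_mono[of "Bas k" UNIV R] by (auto simp: resolution_def)
  then show ?thesis unfolding res_diff_eq by (rule F.linear_extension_basis)
qed

lemma diff_F0:
  assumes f: "f \<in> carrier (F 0)"
  shows "D i f = \<zero>\<^bsub>F k\<^esub>"
proof -
  interpret F: module R "free_module R UNIV" by (rule Nm.R.module_free_module)
  note f = free_moduleD[OF f[unfolded resolution_def]]
  have z: "f x \<odot>\<^bsub>free_module R UNIV\<^esub> gen_boundary R x = \<zero>\<^bsub>free_module R UNIV\<^esub>"
    if x: "x \<in> support R f" for x
  proof -
    obtain y where "x = Gen y" using f(3) x by auto
    then show ?thesis using f(1) by simp
  qed
  have "D i f = (\<Oplus>\<^bsub>free_module R UNIV\<^esub>x\<in>support R f. \<zero>\<^bsub>free_module R UNIV\<^esub>)"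
    unfolding res_diff_eq linear_extension_def
    by (rule F.M.finsum_cong'[OF refl _ z]) (auto simp del: free_module_sel)
  then show ?thesis unfolding F.M.finsum_zero by (simp add: F_zero)
qed

lemma diff_hom': "D i \<in> module_hom R (F i) (F (i - 1))"
proof (cases i)
  case 0
  interpret F: module R "F 0" by (rule module_F)
  have "D 0 \<in> module_hom R (F 0) (F 0)"
    by (rule module_homI) (simp_all add: diff_F0[of _ 0 0])
  then show ?thesis using 0 by simp
qed (simp add: diff_hom)

lemma aug_eq:
  assumes f: "f \<in> carrier (F 0)"
  shows "aug f = linear_extension R N (\<lambda>g. case g of Gen x \<Rightarrow> x | Syz _ \<Rightarrow> undefined) f"
proof -
  let ?w = "\<lambda>g. case g of Gen x \<Rightarrow> x | Syz _ \<Rightarrow> undefined"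
  note f = free_moduleD[OF f[unfolded resolution_def]]
  let ?S = "{x \<in> carrier N. Gen x \<in> support R f}"
  have S: "support R f = Gen ` ?S" using f(3) by auto
  have "linear_extension R N ?w f = (\<Oplus>\<^bsub>N\<^esub>g\<in>Gen ` ?S. f g \<odot>\<^bsub>N\<^esub> ?w g)"
    unfolding linear_extension_def S[symmetric] ..
  also have "\<dots> = (\<Oplus>\<^bsub>N\<^esub>x\<in>?S. f (Gen x) \<odot>\<^bsub>N\<^esub> ?w (Gen x))"
    using f(1) by (subst Nm.M.finsum_reindex[of "\<lambda>g. f g \<odot>\<^bsub>N\<^esub> ?w g" Gen ?S]) (auto simp: inj_on_def)
  finally show ?thesis by (simp add: res_augmentation_def)
qed

lemma aug_hom: "aug \<in> module_hom R (F 0) N"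
proof -
  have "linear_extension R N (\<lambda>g. case g of Gen x \<Rightarrow> x | Syz _ \<Rightarrow> undefined)
      \<in> module_hom R (free_module R (Bas 0)) N"
    by (rule Nm.linear_extension_hom) auto
  then show ?thesis
    unfolding resolution_def
    by (rule module_hom_cong[OF Nm.R.module_free_module]) (rule aug_eq, simp only: resolution_def)
qed

lemma aug_basis: "x \<in> carrier N \<Longrightarrow> aug (free_basis R (Gen x)) = x"
  by (simp add: aug_eq basis_in_F) (subst Nm.linear_extension_basis, auto)

lemma exact_F0:
  assumes "f \<in> carrier (F 0)" "aug f = \<zero>\<^bsub>N\<^esub>"
  shows "\<exists>g\<in>carrier (F 1). D 1 g = f"
proof -
  obtain xs where xs: "set xs \<subseteq> carrier R \<times> Bas 0" "linear_combination R xs = f"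
    using Nm.R.ex_linear_combination assms(1) unfolding resolution_def by blast
  then have "Syz xs \<in> Bas (Suc 0)" using assms(2) by auto
  then show ?thesis
    using xs diff_basis[of "Syz xs" 0 1] basis_in_F[of "Syz xs" "Suc 0"]
    by (intro bexI[of _ "free_basis R (Syz xs)"]) auto
qed

lemma exact_F:
  assumes "f \<in> carrier (F k)" "k > 0" "D k f = (\<lambda>_. \<zero>)"
  shows "\<exists>g\<in>carrier (F (Suc k)). D (Suc k) g = f"
proof -
  obtain xs where xs: "set xs \<subseteq> carrier R \<times> Bas k" "linear_combination R xs = f"
    using Nm.R.ex_linear_combination assms(1) unfolding resolution_def by blast
  then have "Syz xs \<in> Bas (Suc k)" using assms(2,3) by auto
  then show ?thesis
    using xs diff_basis[of "Syz xs" k "Suc k"] basis_in_F[of "Syz xs" "Suc k"]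
    by (intro bexI[of _ "free_basis R (Syz xs)"]) auto
qed

lemma diff_diff:
  assumes "f \<in> carrier (F (Suc k))"
  shows "D k (D (Suc k) f) = (\<lambda>_. \<zero>)"
proof (cases k)
  case 0
  then show ?thesis
    using module_homD(1)[OF diff_hom[of "Suc k" k] assms] diff_F0[of "D (Suc k) f" 0 0] by (simp add: F_zero)
next
  case (Suc l)
  interpret F: module R "F l" by (rule module_F)
  have a: "(\<lambda>f. D k (D (Suc k) f)) \<in> module_hom R (free_module R (Bas (Suc k))) (F l)"
    using module_hom_comp[OF diff_hom[of "Suc k" k] diff_hom[of k l, folded Suc]]
    by (simp add: resolution_def)
  have b: "(\<lambda>f. \<zero>\<^bsub>F l\<^esub>) \<in> module_hom R (free_module R (Bas (Suc k))) (F l)"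
    by (rule module_homI) auto
  have "D k (D (Suc k) f) = \<zero>\<^bsub>F l\<^esub>"
  proof (rule F.linear_on_free_eqI[OF _ a b])
    fix x assume x: "x \<in> Bas (Suc k)"
    then obtain xs where "x = Syz xs" "D k (linear_combination R xs) = (\<lambda>_. \<zero>)"
      using Suc by auto
    then show "D k (D (Suc k) (free_basis R x)) = \<zero>\<^bsub>F l\<^esub>"
      using diff_basis[OF x] by (simp add: F_zero)
  qed (use assms in \<open>simp add: resolution_def\<close>)
  then show ?thesis by (simp add: F_zero)
qed

lemma ex_hom_on_basis:
  assumes "\<And>g. g \<in> G \<Longrightarrow> \<exists>y\<in>carrier (F l). \<Phi> g y" and "G \<subseteq> Bas k"
  shows "\<exists>s\<in>module_hom R (F k) (F l). \<forall>g\<in>G. \<Phi> g (s (free_basis R g))"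
proof -
  interpret F: module R "F l" by (rule module_F)
  obtain w where w: "\<And>g. g \<in> G \<Longrightarrow> w g \<in> carrier (F l) \<and> \<Phi> g (w g)"
    using assms(1) by metis
  define w' where "w' g = (if g \<in> G then w g else \<zero>\<^bsub>F l\<^esub>)" for g
  have w': "w' g \<in> carrier (F l)" for g using w by (simp add: w'_def)
  have "linear_extension R (F l) w' \<in> module_hom R (F k) (F l)"
    using F.linear_extension_hom[of "Bas k" w'] w' by (simp add: resolution_def)
  moreover have "linear_extension R (F l) w' (free_basis R g) = w g" if "g \<in> G" for g
    using F.linear_extension_basis[of w' g, OF w'] that by (simp add: w'_def)
  ultimately show ?thesis using w by metis
qed

section \<open>Vanishing of Tor for torsion modules\<close>

text \<open>
  A power of \<open>t\<close> kills the finitely many elements of \<open>N\<close> that occur in degree \<open>0\<close>, which gives \<open>s\<close>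
  there.  In degree \<open>i + 1\<close>, let \<open>s\<close> be a homotopy that works for the basis elements occurring
  in the boundaries of \<open>G\<close>; then \<open>t\<^sup>n g - s(d g)\<close> is a cycle for \<open>g \<in> G\<close>, and the value of the next
  homotopy at \<open>g\<close> is chosen with this cycle as its boundary.  The exponent \<open>n\<close> is that of degree \<open>0\<close>.
\<close>

lemma torsion_homotopy:
  assumes t: "t \<in> carrier R"
    and tors: "\<And>x. x \<in> carrier N \<Longrightarrow> \<exists>n::nat. t [^] n \<odot>\<^bsub>N\<^esub> x = \<zero>\<^bsub>N\<^esub>"
    and G: "finite G" "G \<subseteq> Bas i"
  shows "\<exists>n::nat. \<exists>s\<in>module_hom R (F i) (F (Suc i)). \<exists>s'\<in>module_hom R (F (i - 1)) (F i).
    \<forall>g\<in>G. D (Suc i) (s (free_basis R g)) \<oplus>\<^bsub>F i\<^esub> s' (D i (free_basis R g)) = t [^] n \<odot>\<^bsub>F i\<^esub> free_basis R g"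
  using G
proof (induct i arbitrary: G)
  case 0
  interpret F: module R "F 0" by (rule module_F)
  have pow: "t [^] (n::nat) \<in> carrier R" for n using t by simp
  have "\<exists>n::nat. \<forall>g\<in>G. \<forall>x\<in>carrier N. g = Gen x \<longrightarrow> t [^] n \<odot>\<^bsub>N\<^esub> x = \<zero>\<^bsub>N\<^esub>"
    using 0
  proof (induct G)
    case (insert g G)
    then obtain n where n: "\<And>y. y \<in> carrier N \<Longrightarrow> Gen y \<in> G \<Longrightarrow> t [^] (n::nat) \<odot>\<^bsub>N\<^esub> y = \<zero>\<^bsub>N\<^esub>" by auto
    obtain x where x: "g = Gen x" "x \<in> carrier N" using insert by auto
    obtain m where m: "t [^] (m::nat) \<odot>\<^bsub>N\<^esub> x = \<zero>\<^bsub>N\<^esub>" using tors x by blast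
    have "t [^] (n + m) \<odot>\<^bsub>N\<^esub> y = \<zero>\<^bsub>N\<^esub>" if "y \<in> carrier N" "g = Gen y \<or> Gen y \<in> G" for y
    proof -
      have 1: "t [^] (n + m) \<odot>\<^bsub>N\<^esub> y = t [^] n \<odot>\<^bsub>N\<^esub> (t [^] m \<odot>\<^bsub>N\<^esub> y)"
        using t that pow by (simp add: Nm.R.nat_pow_mult[symmetric] Nm.smult_assoc1)
      have 2: "t [^] (n + m) \<odot>\<^bsub>N\<^esub> y = t [^] m \<odot>\<^bsub>N\<^esub> (t [^] n \<odot>\<^bsub>N\<^esub> y)"
        using t that pow by (simp add: Nm.R.nat_pow_mult[symmetric] Nm.smult_assoc1[symmetric] Nm.R.m_comm)
      show ?thesis using that(2)
      proof
        assume "g = Gen y"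
        then show ?thesis unfolding 1 using m x pow by simp
      next
        assume "Gen y \<in> G"
        then show ?thesis unfolding 2 using n that(1) pow by simp
      qed
    qed
    then show ?case by blast
  qed simp
  then obtain n where n: "\<And>x. x \<in> carrier N \<Longrightarrow> Gen x \<in> G \<Longrightarrow> t [^] (n::nat) \<odot>\<^bsub>N\<^esub> x = \<zero>\<^bsub>N\<^esub>" by blast
  have "\<exists>y\<in>carrier (F 1). D 1 y = t [^] n \<odot>\<^bsub>F 0\<^esub> free_basis R g" if g: "g \<in> G" for g
  proof (rule exact_F0)
    obtain x where x: "g = Gen x" "x \<in> carrier N" using g 0 by auto
    have b: "free_basis R g \<in> carrier (F 0)" using g 0 by (intro basis_in_F) auto
    then show "t [^] n \<odot>\<^bsub>F 0\<^esub> free_basis R g \<in> carrier (F 0)" using pow by simp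
    show "aug (t [^] n \<odot>\<^bsub>F 0\<^esub> free_basis R g) = \<zero>\<^bsub>N\<^esub>"
      using module_homD(3)[OF aug_hom pow b, of n] x n[of x] g by (simp add: aug_basis)
  qed
  from ex_hom_on_basis[where \<Phi> = "\<lambda>g y. D 1 y = t [^] n \<odot>\<^bsub>F 0\<^esub> free_basis R g", OF this 0(2)]
  obtain s where s: "s \<in> module_hom R (F 0) (F 1)"
    "\<And>g. g \<in> G \<Longrightarrow> D 1 (s (free_basis R g)) = t [^] n \<odot>\<^bsub>F 0\<^esub> free_basis R g" by blast
  have z: "(\<lambda>_. \<zero>\<^bsub>F 0\<^esub>) \<in> module_hom R (F (0 - 1)) (F 0)" by (rule module_homI) auto
  show ?case
  proof (intro exI[of _ n] bexI[OF _ z] bexI[of _ s] ballI)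
    fix g assume g: "g \<in> G"
    show "D (Suc 0) (s (free_basis R g)) \<oplus>\<^bsub>F 0\<^esub> \<zero>\<^bsub>F 0\<^esub> = t [^] n \<odot>\<^bsub>F 0\<^esub> free_basis R g"
      using s(2)[OF g] basis_in_F[OF subsetD[OF 0(2) g]] pow by simp
  qed (use s(1) in simp)
next
  case (Suc i)
  interpret F: module R "F i" by (rule module_F)
  interpret FS: module R "F (Suc i)" by (rule module_F)
  have pow: "t [^] (n::nat) \<in> carrier R" for n using t by simp
  note Dh = module_homD[OF diff_hom[of "Suc i" i]]
  have bas: "free_basis R g \<in> carrier (F (Suc i))" if "g \<in> G" for g
    by (rule basis_in_F[OF subsetD[OF Suc(3) that]])
  define G' where "G' = (\<Union>g\<in>G. support R (D (Suc i) (free_basis R g)))"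
  have G': "finite G'" "G' \<subseteq> Bas i"
    using Suc(2) free_moduleD(2,3)[OF Dh(1)[OF bas, unfolded resolution_def]] by (auto simp: G'_def)
  from Suc(1)[OF this] obtain n :: nat and s s' where s: "s \<in> module_hom R (F i) (F (Suc i))"
    and s': "s' \<in> module_hom R (F (i - 1)) (F i)"
    and htpy: "\<And>g. g \<in> G' \<Longrightarrow> D (Suc i) (s (free_basis R g)) \<oplus>\<^bsub>F i\<^esub> s' (D i (free_basis R g))
      = t [^] n \<odot>\<^bsub>F i\<^esub> free_basis R g" by blast
  note sh = module_homD[OF s] and sh' = module_homD[OF s'] and Dh' = module_homD[OF diff_hom'[of i]]
  have a: "(\<lambda>f. D (Suc i) (s f) \<oplus>\<^bsub>F i\<^esub> s' (D i f)) \<in> module_hom R (F i) (F i)"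
    by (rule module_homI)
      (simp_all add: sh sh' Dh Dh' F.smult_r_distr F.M.a_ac del: One_nat_def)
  have b: "(\<lambda>f. t [^] n \<odot>\<^bsub>F i\<^esub> f) \<in> module_hom R (F i) (F i)"
    by (rule module_homI)
      (simp_all add: pow F.smult_r_distr F.smult_assoc1[symmetric] Nm.R.m_comm)
  have hom': "D (Suc i) (s f) \<oplus>\<^bsub>F i\<^esub> s' (D i f) = t [^] n \<odot>\<^bsub>F i\<^esub> f"
    if "f \<in> carrier (free_module R G')" for f
    using F.linear_on_free_eqI[OF that module_hom_free_mono[OF G'(2)] module_hom_free_mono[OF G'(2)]]
      a b htpy unfolding resolution_def by blast
  have "\<exists>y\<in>carrier (F (Suc (Suc i))). D (Suc (Suc i)) y
      = t [^] n \<odot>\<^bsub>F (Suc i)\<^esub> free_basis R g \<ominus>\<^bsub>F (Suc i)\<^esub> s (D (Suc i) (free_basis R g))"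
    if g: "g \<in> G" for g
  proof (rule exact_F)
    let ?e = "free_basis R g"
    have De: "D (Suc i) ?e \<in> carrier (F i)" using Dh(1) bas g by simp
    show "t [^] n \<odot>\<^bsub>F (Suc i)\<^esub> ?e \<ominus>\<^bsub>F (Suc i)\<^esub> s (D (Suc i) ?e) \<in> carrier (F (Suc i))"
      using bas[OF g] sh(1)[OF De] pow by simp
    have sup: "support R (D (Suc i) ?e) \<subseteq> G'" using g by (auto simp: G'_def)
    have "D (Suc i) ?e \<in> carrier (free_module R G')"
      using De sup by (auto simp: resolution_def free_module_carrier_iff)
    from hom'[OF this] have "D (Suc i) (s (D (Suc i) ?e)) \<oplus>\<^bsub>F i\<^esub> s' (D i (D (Suc i) ?e))
      = t [^] n \<odot>\<^bsub>F i\<^esub> D (Suc i) ?e" .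
    moreover have "s' (D i (D (Suc i) ?e)) = \<zero>\<^bsub>F i\<^esub>"
      using diff_diff[OF bas[OF g]] module_hom_zero[OF module_F module_F s'] by (simp add: F_zero)
    ultimately have "D (Suc i) (s (D (Suc i) ?e)) = t [^] n \<odot>\<^bsub>F i\<^esub> D (Suc i) ?e"
      using Dh(1)[OF sh(1)[OF De]] by simp
    then have "D (Suc i) (t [^] n \<odot>\<^bsub>F (Suc i)\<^esub> ?e \<ominus>\<^bsub>F (Suc i)\<^esub> s (D (Suc i) ?e)) = \<zero>\<^bsub>F i\<^esub>"
      using bas[OF g] sh(1)[OF De] pow De
      by (simp add: module_hom_minus[OF module_F module_F diff_hom] Dh(3) a_minus_def[of "F i"] F.M.r_neg)
    then show "D (Suc i) (t [^] n \<odot>\<^bsub>F (Suc i)\<^esub> ?e \<ominus>\<^bsub>F (Suc i)\<^esub> s (D (Suc i) ?e)) = (\<lambda>_. \<zero>)"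
      by (simp add: F_zero)
  qed simp
  from ex_hom_on_basis[where \<Phi> = "\<lambda>g y. D (Suc (Suc i)) y
      = t [^] n \<odot>\<^bsub>F (Suc i)\<^esub> free_basis R g \<ominus>\<^bsub>F (Suc i)\<^esub> s (D (Suc i) (free_basis R g))", OF this Suc(3)]
  obtain r where r: "r \<in> module_hom R (F (Suc i)) (F (Suc (Suc i)))"
    "\<And>g. g \<in> G \<Longrightarrow> D (Suc (Suc i)) (r (free_basis R g))
      = t [^] n \<odot>\<^bsub>F (Suc i)\<^esub> free_basis R g \<ominus>\<^bsub>F (Suc i)\<^esub> s (D (Suc i) (free_basis R g))" by blast
  have "D (Suc (Suc i)) (r (free_basis R g)) \<oplus>\<^bsub>F (Suc i)\<^esub> s (D (Suc i) (free_basis R g))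
      = t [^] n \<odot>\<^bsub>F (Suc i)\<^esub> free_basis R g" if g: "g \<in> G" for g
    using r(2)[OF g] bas[OF g] sh(1)[OF Dh(1)[OF bas[OF g]]] pow
    by (simp add: a_minus_def FS.M.a_assoc FS.M.l_neg)
  then show ?case
    by (intro exI[of _ n] bexI[OF _ r(1)] bexI[of _ s] ballI) (simp_all add: s)
qed

end

text \<open>
  Let \<open>z\<close> be a cycle in \<open>F\<^sub>i \<otimes> M\<close>.  The homotopy gives \<open>t\<^sup>n z = d(s z)\<close>.  By density \<open>s z = f u + t\<^sup>n w\<close>
  with \<open>f \<in> F\<^sub>i\<^sub>+\<^sub>1\<close>, so \<open>t\<^sup>n (z - d w) = (d f) u\<close>, and by saturation \<open>z - d w = g u\<close> for some
  \<open>g \<in> F\<^sub>i\<close>.  Now \<open>g\<close> is a cycle of the resolution itself, hence a boundary.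
\<close>

lemma Tor_torsion_eq_zero:
  assumes M: "dense_extension R M t u" and N: "module R N"
    and tors: "\<And>x. x \<in> carrier N \<Longrightarrow> \<exists>n::nat. t [^]\<^bsub>R\<^esub> n \<odot>\<^bsub>N\<^esub> x = \<zero>\<^bsub>N\<^esub>"
    and i: "i > 0"
  shows "carrier (Tor R i N M) = {\<zero>\<^bsub>Tor R i N M\<^esub>}"
proof -
  \<comment> \<open>Keeps the indices \<open>i - 1\<close> in the form in which they occur in the definitions.\<close>
  note One_nat_def [simp del]
  interpret M: dense_extension R M t u by fact
  interpret res: module_resolution R N using N by (rule module_resolution.intro)
  interpret C: dense_free_tensor R M "res_basis R N k" t u for k
    by (intro dense_free_tensor.intro free_tensor.intro M.Mod.R.is_cring M.Mod.module_axioms M)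
  define Cx where "Cx k = tensor_product R (resolution R N k) M" for k
  define d where "d k = tensor_map R (resolution R N (k - 1)) M (res_diff R k) (\<lambda>x. x)" for k
  have CT: "Cx k = C.T k" for k by (simp add: Cx_def resolution_def)
  have fnct: "tensor_functor R (resolution R N k) M (resolution R N l) M f (\<lambda>x. x)"
    if "f \<in> module_hom R (resolution R N k) (resolution R N l)" for k l f
    using that
    by (intro tensor_functor.intro tensor_modules.intro tensor_functor_axioms.intro res.module_F M.Mod.module_axioms)
      (auto simp: module_hom_def)
  let ?\<tau> = "\<lambda>k. pure_tensor R (resolution R N k) M"
  have mapf: "tensor_map R (resolution R N l) M f (\<lambda>x. x) \<in> module_hom R (Cx k) (Cx l)"
    "a \<in> carrier (resolution R N k) \<Longrightarrow> m \<in> carrier M \<Longrightarrow>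
      tensor_map R (resolution R N l) M f (\<lambda>x. x) (?\<tau> k a m) = ?\<tau> l (f a) m"
    if "f \<in> module_hom R (resolution R N k) (resolution R N l)" for k l f a m
    using tensor_functor.tensor_map_hom[OF fnct[OF that]] tensor_functor.tensor_map_pure[OF fnct[OF that]]
    by (auto simp: Cx_def)
  have dhom: "d k \<in> module_hom R (Cx k) (Cx (k - 1))" for k
    unfolding d_def by (rule mapf(1)[OF res.diff_hom'])
  have dpure: "a \<in> carrier (resolution R N k) \<Longrightarrow> m \<in> carrier M \<Longrightarrow>
      d k (?\<tau> k a m) = ?\<tau> (k - 1) (res_diff R k a) m" for k a m
    unfolding d_def by (rule mapf(2)[OF res.diff_hom'])
  have Cmod: "module R (Cx k)" for k unfolding CT by (rule C.module_tensor_product)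
  interpret Ci: module R "Cx i" by (rule Cmod)
  interpret Cj: module R "Cx (i - 1)" by (rule Cmod)
  have main: "z \<in> d (Suc i) ` carrier (Cx (Suc i))"
    if z: "z \<in> carrier (Cx i)" and dz: "d i z = \<zero>\<^bsub>Cx (i - 1)\<^esub>" for z
  proof -
    from C.hom_finitely_determined[OF C.module_tensor_product[of i], of z i] z
    obtain G where G: "finite G" "G \<subseteq> res_basis R N i"
      and det: "\<And>\<phi> \<psi>. \<phi> \<in> module_hom R (Cx i) (Cx i) \<Longrightarrow> \<psi> \<in> module_hom R (Cx i) (Cx i) \<Longrightarrow>
        (\<forall>x\<in>G. \<forall>m\<in>carrier M. \<phi> (?\<tau> i (free_basis R x) m) = \<psi> (?\<tau> i (free_basis R x) m)) \<Longrightarrow> \<phi> z = \<psi> z"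
      unfolding CT resolution_def by blast
    obtain n :: nat and s s' where s: "s \<in> module_hom R (resolution R N i) (resolution R N (Suc i))"
      and s': "s' \<in> module_hom R (resolution R N (i - 1)) (resolution R N i)"
      and htpy: "\<And>g. g \<in> G \<Longrightarrow> res_diff R (Suc i) (s (free_basis R g)) \<oplus>\<^bsub>resolution R N i\<^esub> s' (res_diff R i (free_basis R g))
        = t [^]\<^bsub>R\<^esub> n \<odot>\<^bsub>resolution R N i\<^esub> free_basis R g"
      using res.torsion_homotopy[OF M.t tors G] by blast
    define S where "S = tensor_map R (resolution R N (Suc i)) M s (\<lambda>x. x)"
    define S' where "S' = tensor_map R (resolution R N i) M s' (\<lambda>x. x)"
    note Sh = mapf[OF s, folded S_def] and Sh' = mapf[OF s', folded S'_def]
    note S1 = module_homD[OF Sh(1)] and S1' = module_homD[OF Sh'(1)] and di = module_homD[OF dhom[of i]]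
      and dS = module_homD[OF dhom[of "Suc i", unfolded diff_Suc_1]]
    have a: "(\<lambda>z. d (Suc i) (S z) \<oplus>\<^bsub>Cx i\<^esub> S' (d i z)) \<in> module_hom R (Cx i) (Cx i)"
      by (rule module_homI) (simp_all add: S1 S1' di dS Ci.smult_r_distr Ci.M.a_ac)
    have b: "(\<lambda>z. t [^]\<^bsub>R\<^esub> n \<odot>\<^bsub>Cx i\<^esub> z) \<in> module_hom R (Cx i) (Cx i)"
      by (rule module_homI) (simp_all add: Ci.smult_r_distr Ci.smult_assoc1[symmetric] M.Mod.R.m_comm)
    have "d (Suc i) (S z) \<oplus>\<^bsub>Cx i\<^esub> S' (d i z) = t [^]\<^bsub>R\<^esub> n \<odot>\<^bsub>Cx i\<^esub> z"
    proof (rule det[OF a b], intro ballI)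
      fix x m assume x: "x \<in> G" and m: "m \<in> carrier M"
      let ?e = "free_basis R x"
      have e: "?e \<in> carrier (resolution R N i)" using x G res.basis_in_F by auto
      have cl: "s ?e \<in> carrier (resolution R N (Suc i))" "res_diff R i ?e \<in> carrier (resolution R N (i - 1))"
        using module_homD(1)[OF s e] module_homD(1)[OF res.diff_hom' e] by auto
      have cl2: "res_diff R (Suc i) (s ?e) \<in> carrier (resolution R N i)"
        "s' (res_diff R i ?e) \<in> carrier (resolution R N i)"
        using module_homD(1)[OF s' cl(2)] module_homD(1)[OF res.diff_hom cl(1)] by auto
      have "d (Suc i) (S (?\<tau> i ?e m)) \<oplus>\<^bsub>Cx i\<^esub> S' (d i (?\<tau> i ?e m))
          = ?\<tau> i (res_diff R (Suc i) (s ?e)) m \<oplus>\<^bsub>Cx i\<^esub> ?\<tau> i (s' (res_diff R i ?e)) m"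
        using e m cl by (simp add: Sh(2) Sh'(2) dpure)
      also have "\<dots> = ?\<tau> i (res_diff R (Suc i) (s ?e) \<oplus>\<^bsub>resolution R N i\<^esub> s' (res_diff R i ?e)) m"
        unfolding CT using C.pure_tensor_simps(1)[where k = i] cl2 m unfolding resolution_def by metis
      also have "\<dots> = t [^]\<^bsub>R\<^esub> n \<odot>\<^bsub>Cx i\<^esub> ?\<tau> i ?e m"
        unfolding htpy[OF x] CT using C.pure_tensor_simps(3)[where k = i, OF M.pow_closed] e m
        unfolding resolution_def by metis
      finally show "d (Suc i) (S (?\<tau> i ?e m)) \<oplus>\<^bsub>Cx i\<^esub> S' (d i (?\<tau> i ?e m)) = t [^]\<^bsub>R\<^esub> n \<odot>\<^bsub>Cx i\<^esub> ?\<tau> i ?e m" .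
    qed
    moreover have "S' (d i z) = \<zero>\<^bsub>Cx i\<^esub>"
      unfolding dz by (rule module_hom_zero[OF Cmod Cmod Sh'(1)])
    moreover have Sz: "S z \<in> carrier (Cx (Suc i))" by (rule S1(1)[OF z])
    ultimately have tz: "d (Suc i) (S z) = t [^]\<^bsub>R\<^esub> n \<odot>\<^bsub>Cx i\<^esub> z"
      using dS(1) by simp
    interpret CS: module R "Cx (Suc i)" by (rule Cmod)
    obtain f w where f: "f \<in> carrier (resolution R N (Suc i))" and w: "w \<in> carrier (Cx (Suc i))"
      and Sz_eq: "S z = ?\<tau> (Suc i) f u \<oplus>\<^bsub>Cx (Suc i)\<^esub> t [^]\<^bsub>R\<^esub> n \<odot>\<^bsub>Cx (Suc i)\<^esub> w"
      using C.tensor_divide[of "S z" "Suc i" n] Sz unfolding CT resolution_def by blast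
    have \<tau>cl: "a \<in> carrier (resolution R N k) \<Longrightarrow> ?\<tau> k a u \<in> carrier (Cx k)" for a k
      using C.pure_tensor_closed[of a k u] M.u unfolding CT resolution_def by blast
    define f' where "f' = res_diff R (Suc i) f"
    have f': "f' \<in> carrier (resolution R N i)"
      unfolding f'_def by (rule module_homD(1)[OF res.diff_hom f])
    have "d (Suc i) (S z) = ?\<tau> i f' u \<oplus>\<^bsub>Cx i\<^esub> t [^]\<^bsub>R\<^esub> n \<odot>\<^bsub>Cx i\<^esub> d (Suc i) w"
      unfolding Sz_eq using \<tau>cl[OF f] w f M.u by (simp add: dS dpure f'_def)
    then have eq: "t [^]\<^bsub>R\<^esub> n \<odot>\<^bsub>Cx i\<^esub> z = ?\<tau> i f' u \<oplus>\<^bsub>Cx i\<^esub> t [^]\<^bsub>R\<^esub> n \<odot>\<^bsub>Cx i\<^esub> d (Suc i) w"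
      using tz by simp
    let ?y = "z \<ominus>\<^bsub>Cx i\<^esub> d (Suc i) w"
    have y: "?y \<in> carrier (Cx i)" using z dS(1)[OF w] by simp
    have "t [^]\<^bsub>R\<^esub> n \<odot>\<^bsub>Cx i\<^esub> ?y = ?\<tau> i f' u"
      using z dS(1)[OF w] \<tau>cl[OF f']
      by (simp add: a_minus_def Ci.smult_r_distr Ci.smult_r_minus eq Ci.M.a_assoc Ci.M.r_neg)
    then obtain g where g: "g \<in> carrier (resolution R N i)" and yg: "?y = ?\<tau> i g u"
      using C.tensor_saturated[of ?y i f' n] y f' unfolding CT resolution_def by blast
    have "d i (d (Suc i) w) = \<zero>\<^bsub>Cx (i - 1)\<^esub>"
    proof -
      have a: "(\<lambda>w. d i (d (Suc i) w)) \<in> module_hom R (Cx (Suc i)) (Cx (i - 1))"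
        by (rule module_hom_comp[OF dhom[of "Suc i", unfolded diff_Suc_1] dhom[of i]])
      from w show ?thesis unfolding CT
      proof (induct rule: C.tensor_induct)
        case (pure a m)
        then have a: "a \<in> carrier (resolution R N (Suc i))" by (simp add: resolution_def)
        have "d i (d (Suc i) (?\<tau> (Suc i) a m)) = ?\<tau> (i - 1) (res_diff R i (res_diff R (Suc i) a)) m"
          using a pure(2) module_homD(1)[OF res.diff_hom a, of "Suc i"] by (simp add: dpure)
        also have "\<dots> = ?\<tau> (i - 1) \<zero>\<^bsub>resolution R N (i - 1)\<^esub> m"
          using res.diff_diff[OF a] by (simp add: res.F_zero)
        also have "\<dots> = \<zero>\<^bsub>Cx (i - 1)\<^esub>"
          unfolding CT resolution_def using pure(2) by (rule C.pure_tensor_zero(1))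
        finally show ?case unfolding resolution_def CT .
      next
        case (add w w')
        then show ?case using module_homD(2)[OF a, unfolded CT] by (simp add: C.module_tensor_product[THEN module.axioms(2)])
      qed
    qed
    then have "d i ?y = \<zero>\<^bsub>Cx (i - 1)\<^esub>"
      using z dS(1)[OF w] dz by (simp add: module_hom_minus[OF Cmod Cmod dhom] a_minus_def[of "Cx (i - 1)"] Cj.M.r_neg)
    then have "?\<tau> (i - 1) (res_diff R i g) u = \<zero>\<^bsub>Cx (i - 1)\<^esub>"
      using yg g M.u by (simp add: dpure)
    then have "res_diff R i g = (\<lambda>_. \<zero>\<^bsub>R\<^esub>)"
      using C.tensor_faithful[of "res_diff R i g" "i - 1"] module_homD(1)[OF res.diff_hom' g]
      unfolding CT resolution_def by simp
    from res.exact_F[OF g i this] obtain g' where g': "g' \<in> carrier (resolution R N (Suc i))" "res_diff R (Suc i) g' = g"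
      by blast
    have "z = d (Suc i) (?\<tau> (Suc i) g' u \<oplus>\<^bsub>Cx (Suc i)\<^esub> w)"
    proof -
      have "d (Suc i) (?\<tau> (Suc i) g' u \<oplus>\<^bsub>Cx (Suc i)\<^esub> w) = ?\<tau> i g u \<oplus>\<^bsub>Cx i\<^esub> d (Suc i) w"
        using \<tau>cl[OF g'(1)] w g' M.u by (simp add: dS dpure)
      also have "\<dots> = z" using z dS(1)[OF w] by (simp add: yg[symmetric] a_minus_def Ci.M.a_assoc Ci.M.l_neg)
      finally show ?thesis by simp
    qed
    then show ?thesis using \<tau>cl[OF g'(1)] w by blast
  qed
  let ?S = "boundaries Cx d i"
  have S: "submodule ?S R (Cx i)"
    unfolding boundaries_def using submodule_image[OF Cmod Cmod dhom[of "Suc i"]] by simp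
  interpret q: quotient_of_module R "Cx i" ?S
    by (rule quotient_of_moduleI[OF Cmod S])
  have "?S +>\<^bsub>Cx i\<lparr>carrier := K\<rparr>\<^esub> z = ?S +>\<^bsub>Cx i\<^esub> z" for K z
    by (simp add: a_r_coset_def')
  moreover have "?S +>\<^bsub>Cx i\<^esub> z = ?S" if "z \<in> a_kernel (Cx i) (Cx (i - 1)) (d i)" for z
  proof -
    have z: "z \<in> carrier (Cx i)" "d i z = \<zero>\<^bsub>Cx (i - 1)\<^esub>" using that by (auto simp: a_kernel_def')
    then show ?thesis using main[OF z] q.coset_eq_S_iff[OF z(1)] unfolding boundaries_def by blast
  qed
  moreover have "\<zero>\<^bsub>Cx i\<^esub> \<in> a_kernel (Cx i) (Cx (i - 1)) (d i)"
    using module_hom_zero[OF Cmod Cmod dhom] by (simp add: a_kernel_def')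
  ultimately have "carrier (homology Cx d i) = {?S}"
    by (auto simp: homology_def quotient_module_sel A_RCOSETS_def')
  moreover have "Tor R i N M = homology Cx d i"
    by (simp add: Tor_def Cx_def[abs_def] d_def[abs_def])
  ultimately show ?thesis by (simp add: homology_def quotient_module_sel)
qed

section \<open>Koszul complexes of two elements\<close>

locale koszul_pair = cring R for R (structure) +
  fixes a b
  assumes a: "a \<in> carrier R" and b: "b \<in> carrier R"
begin

abbreviation "Kz \<equiv> koszul R [a, b]"
abbreviation "dz \<equiv> koszul_diff R [a, b]"

lemma pair_subset_iff: "T \<subseteq> {..<length [a, b]} \<longleftrightarrow> T = {} \<or> T = {0} \<or> T = {1} \<or> T = {0, 1}"
proof -
  have "{..<length [a, b]} = {0, 1 :: nat}" by auto
  then show ?thesis by (simp only: subset_insert_iff subset_empty) auto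
qed

lemma koszul_diff_pair:
  assumes f: "\<And>T. f T \<in> carrier R"
  shows "dz p f = (\<lambda>T. if T = {} then a \<otimes> f {0} \<oplus> b \<otimes> f {1}
    else if T = {0} then \<ominus> (b \<otimes> f {0, 1}) else if T = {1} then a \<otimes> f {0, 1} else \<zero>)"
proof
  fix T :: "nat set"
  have two: "{..<length [a, b]} = {0, 1 :: nat}" by auto
  have c0: "{l \<in> {0 :: nat}. l < 1} = {0}" and c1: "{l \<in> {1 :: nat}. l < 0} = {}" by auto
  have e: "{} \<subseteq> {..<length [a, b]}" by simp
  consider "T = {}" | "T = {0}" | "T = {1}" | "T = {0, 1}" | "\<not> T \<subseteq> {..<length [a, b]}"
    using pair_subset_iff by blast
  then show "dz p f T = (if T = {} then a \<otimes> f {0} \<oplus> b \<otimes> f {1}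
    else if T = {0} then \<ominus> (b \<otimes> f {0, 1}) else if T = {1} then a \<otimes> f {0, 1} else \<zero>)"
  proof cases
    case 1
    have "dz p f T = (\<Oplus>j\<in>{0, 1}. \<one> \<otimes> ([a, b] ! j \<otimes> f {j}))"
      using 1 f a b unfolding koszul_diff_def two by simp
    also have "\<dots> = a \<otimes> f {0} \<oplus> b \<otimes> f {1}"
      using f a b by simp
    finally show ?thesis using 1 by simp
  next
    case 2
    have s: "{0, 1 :: nat} - {0} = {1}" by auto
    have "dz p f T = (\<Oplus>j\<in>{1}. ((\<ominus> \<one>) [^] card {l \<in> {0 :: nat}. l < j}) \<otimes> ([a, b] ! j \<otimes> f (insert j {0})))"
      using 2 unfolding koszul_diff_def two s by simp
    also have "\<dots> = \<ominus> (b \<otimes> f {0, 1})"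
      using f a b c0 by (simp add: l_minus insert_commute)
    finally show ?thesis using 2 by simp
  next
    case 3
    have s: "{0, 1 :: nat} - {1} = {0}" by auto
    have "dz p f T = (\<Oplus>j\<in>{0}. ((\<ominus> \<one>) [^] card {l \<in> {1 :: nat}. l < j}) \<otimes> ([a, b] ! j \<otimes> f (insert j {1})))"
      using 3 s unfolding koszul_diff_def two by (simp del: One_nat_def)
    also have "\<dots> = a \<otimes> f {0, 1}"
      using f a b c1 by simp
    finally show ?thesis using 3 by simp
  next
    case 4
    then have "dz p f T = \<zero>" unfolding koszul_diff_def two by simp
    moreover have "T \<noteq> {}" "T \<noteq> {0}" "T \<noteq> {1}" unfolding 4 by auto
    ultimately show ?thesis by (simp only: if_False)
  next
    case 5
    have "T \<noteq> {}" "T \<noteq> {0}" "T \<noteq> {1}" using 5 unfolding pair_subset_iff by simp_all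
    then show ?thesis using 5 unfolding koszul_diff_def by (simp only: if_False)
  qed
qed

lemma module_koszul: "module R (Kz p)"
  unfolding koszul_def by (rule module_free_module)

lemma koszulD: "f \<in> carrier (Kz p) \<Longrightarrow> f T \<in> carrier R"
  "f \<in> carrier (Kz p) \<Longrightarrow> card T \<noteq> p \<Longrightarrow> f T = \<zero>"
  "f \<in> carrier (Kz p) \<Longrightarrow> \<not> T \<subseteq> {..<length [a, b]} \<Longrightarrow> f T = \<zero>"
  unfolding koszul_def by (auto dest: free_moduleD(1,4))

lemma koszulI:
  assumes "\<And>T. f T \<in> carrier R" "\<And>T. T \<subseteq> {..<length [a, b]} \<Longrightarrow> card T \<noteq> p \<Longrightarrow> f T = \<zero>"
    "\<And>T. \<not> T \<subseteq> {..<length [a, b]} \<Longrightarrow> f T = \<zero>"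
  shows "f \<in> carrier (Kz p)"
  unfolding koszul_def
proof (rule free_moduleI)
  show "finite {S. S \<subseteq> {..<length [a, b]} \<and> card S = p}"
    by (rule finite_subset[of _ "Pow {..<length [a, b]}"]) auto
qed (use assms in auto)

lemma koszul_diff_hom: "dz (Suc p) \<in> module_hom R (Kz (Suc p)) (Kz p)"
proof (rule module_homI)
  fix f assume f: "f \<in> carrier (Kz (Suc p))"
  note F = koszulD[OF f]
  have *: "dz (Suc p) f = (\<lambda>T. if T = {} then a \<otimes> f {0} \<oplus> b \<otimes> f {1}
    else if T = {0} then \<ominus> (b \<otimes> f {0, 1}) else if T = {1} then a \<otimes> f {0, 1} else \<zero>)"
    by (rule koszul_diff_pair) (rule F)
  show "dz (Suc p) f \<in> carrier (Kz p)"
  proof (rule koszulI)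
    fix T :: "nat set"
    show "dz (Suc p) f T \<in> carrier R" unfolding * using F(1) a b by simp
    show "dz (Suc p) f T = \<zero>" if "card T \<noteq> p"
      unfolding * using that F(2)[of "{0}"] F(2)[of "{1}"] F(2)[of "{0, 1}"] a b by auto
    show "dz (Suc p) f T = \<zero>" if "\<not> T \<subseteq> {..<length [a, b]}"
      using that by (simp add: koszul_diff_def)
  qed
  {
    fix g assume g: "g \<in> carrier (Kz (Suc p))"
    note G = koszulD[OF g]
    have **: "dz (Suc p) g = (\<lambda>T. if T = {} then a \<otimes> g {0} \<oplus> b \<otimes> g {1}
      else if T = {0} then \<ominus> (b \<otimes> g {0, 1}) else if T = {1} then a \<otimes> g {0, 1} else \<zero>)"
      by (rule koszul_diff_pair) (rule G)
    have "dz (Suc p) (\<lambda>T. f T \<oplus> g T) = (\<lambda>T. if T = {} then a \<otimes> (f {0} \<oplus> g {0}) \<oplus> b \<otimes> (f {1} \<oplus> g {1})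
      else if T = {0} then \<ominus> (b \<otimes> (f {0, 1} \<oplus> g {0, 1})) else if T = {1} then a \<otimes> (f {0, 1} \<oplus> g {0, 1}) else \<zero>)"
      by (rule koszul_diff_pair) (simp add: F(1) G(1))
    then show "dz (Suc p) (f \<oplus>\<^bsub>Kz (Suc p)\<^esub> g) = dz (Suc p) f \<oplus>\<^bsub>Kz p\<^esub> dz (Suc p) g"
      unfolding koszul_def free_module_sel * **
      using F(1) G(1) a b by (auto simp: fun_eq_iff r_distr minus_add a_ac)
  }
  fix r assume r: "r \<in> carrier R"
  have "dz (Suc p) (\<lambda>T. r \<otimes> f T) = (\<lambda>T. if T = {} then a \<otimes> (r \<otimes> f {0}) \<oplus> b \<otimes> (r \<otimes> f {1})
    else if T = {0} then \<ominus> (b \<otimes> (r \<otimes> f {0, 1})) else if T = {1} then a \<otimes> (r \<otimes> f {0, 1}) else \<zero>)"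
    by (rule koszul_diff_pair) (simp add: F(1) r)
  then show "dz (Suc p) (r \<odot>\<^bsub>Kz (Suc p)\<^esub> f) = r \<odot>\<^bsub>Kz p\<^esub> dz (Suc p) f"
    unfolding koszul_def free_module_sel *
    using F(1) r a b by (auto simp: fun_eq_iff r_distr m_lcomm r_minus)
qed

text \<open>
  In degree \<open>1\<close> a cycle is a relation between \<open>a\<close> and \<open>b\<close>, and \<open>regular\<close> says that it is a multiple of the
  trivial one; in degree \<open>2\<close> a cycle is an element killed by \<open>a\<close>; above there is nothing.  The
  element \<open>z'\<close> is \<open>z\<close> in degree \<open>1\<close> and zero otherwise, which treats all degrees at once.
\<close>

lemma koszul_exact:
  assumes regular: "\<And>p q. p \<in> carrier R \<Longrightarrow> q \<in> carrier R \<Longrightarrow> a \<otimes> p \<oplus> b \<otimes> q = \<zero> \<Longrightarrow>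
      \<exists>z\<in>carrier R. p = \<ominus> (b \<otimes> z) \<and> q = a \<otimes> z"
    and nonzerodivisor: "\<And>z. z \<in> carrier R \<Longrightarrow> a \<otimes> z = \<zero> \<Longrightarrow> z = \<zero>"
    and i: "i > 0" and f: "f \<in> carrier (Kz i)" and df: "dz i f = (\<lambda>_. \<zero>)"
  shows "f \<in> boundaries Kz dz i"
proof -
  note F = koszulD[OF f]
  have *: "dz i f = (\<lambda>T. if T = {} then a \<otimes> f {0} \<oplus> b \<otimes> f {1}
    else if T = {0} then \<ominus> (b \<otimes> f {0, 1}) else if T = {1} then a \<otimes> f {0, 1} else \<zero>)"
    by (rule koszul_diff_pair) (rule F)
  have "dz i f {} = \<zero>" "dz i f {1} = \<zero>" using df by simp_all
  then have eqs: "a \<otimes> f {0} \<oplus> b \<otimes> f {1} = \<zero>" "a \<otimes> f {0, 1} = \<zero>"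
    unfolding * by simp_all
  have f01: "f {0, 1} = \<zero>" using nonzerodivisor[OF F(1) eqs(2)] .
  obtain z where z: "z \<in> carrier R" "f {0} = \<ominus> (b \<otimes> z)" "f {1} = a \<otimes> z"
    using regular[OF F(1) F(1) eqs(1)] by blast
  define z' where "z' = (if i = 1 then z else \<zero>)"
  have z': "z' \<in> carrier R" "f {0} = \<ominus> (b \<otimes> z')" "f {1} = a \<otimes> z'"
    using z F(2)[of "{0}"] F(2)[of "{1}"] a b by (auto simp: z'_def)
  define g where "g T = (if T = {0, 1 :: nat} then z' else \<zero>)" for T
  have gc: "g T \<in> carrier R" for T using z' by (simp add: g_def)
  have g0: "g {0} = \<zero>" "g {1} = \<zero>" "g {0, 1} = z'" by (auto simp: g_def doubleton_eq_iff)
  have "g \<in> carrier (Kz (Suc i))"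
  proof (rule koszulI)
    fix T :: "nat set"
    assume "\<not> T \<subseteq> {..<length [a, b]}"
    then have "T \<noteq> {0, 1}" unfolding pair_subset_iff by simp
    then show "g T = \<zero>" by (simp add: g_def)
  next
    fix T :: "nat set"
    assume "card T \<noteq> Suc i"
    then show "g T = \<zero>" by (auto simp: g_def z'_def)
  qed (rule gc)
  moreover have "dz (Suc i) g = f"
  proof
    fix T
    have "dz (Suc i) g T = (if T = {} then a \<otimes> \<zero> \<oplus> b \<otimes> \<zero>
      else if T = {0} then f {0} else if T = {1} then f {1} else \<zero>)"
      unfolding koszul_diff_pair[of g, OF gc] g0 z'(2,3) ..
    moreover have "f {} = \<zero>" using F(2)[of "{}"] i by simp
    moreover have "f T = \<zero>" if "T \<noteq> {}" "T \<noteq> {0}" "T \<noteq> {1}"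
      using F(3)[of T] f01 pair_subset_iff[of T] that by blast
    ultimately show "dz (Suc i) g T = f T" using a b by auto
  qed
  ultimately show ?thesis by (auto simp: boundaries_def)
qed

end

text \<open>
  The homology in positive homological degrees is zero, so \<open>k' = k\<close> can be taken; the transition is then the
  identity.
\<close>

lemma weakly_proregular_pair:
  assumes R: "cring R" and a: "a \<in> carrier R" and b: "b \<in> carrier R"
    and regular: "\<And>k p q. (k :: nat) > 0 \<Longrightarrow> p \<in> carrier R \<Longrightarrow> q \<in> carrier R \<Longrightarrow>
      a [^]\<^bsub>R\<^esub> k \<otimes>\<^bsub>R\<^esub> p \<oplus>\<^bsub>R\<^esub> b [^]\<^bsub>R\<^esub> k \<otimes>\<^bsub>R\<^esub> q = \<zero>\<^bsub>R\<^esub> \<Longrightarrow>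
      \<exists>z\<in>carrier R. p = \<ominus>\<^bsub>R\<^esub> (b [^]\<^bsub>R\<^esub> k \<otimes>\<^bsub>R\<^esub> z) \<and> q = a [^]\<^bsub>R\<^esub> k \<otimes>\<^bsub>R\<^esub> z"
    and nonzerodivisor: "\<And>k z. (k :: nat) > 0 \<Longrightarrow> z \<in> carrier R \<Longrightarrow> a [^]\<^bsub>R\<^esub> k \<otimes>\<^bsub>R\<^esub> z = \<zero>\<^bsub>R\<^esub> \<Longrightarrow> z = \<zero>\<^bsub>R\<^esub>"
  shows "weakly_proregular_seq R [a, b]"
  unfolding weakly_proregular_seq_def
proof (intro allI impI)
  fix i k :: nat assume i: "i > 0" and k: "k > 0"
  interpret cring R by fact
  interpret K: koszul_pair R "a [^]\<^bsub>R\<^esub> k" "b [^]\<^bsub>R\<^esub> k"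
    by (intro koszul_pair.intro koszul_pair_axioms.intro R) (use a b in auto)
  let ?S = "boundaries K.Kz K.dz i"
  have sp: "seq_power R [a, b] k = [a [^]\<^bsub>R\<^esub> k, b [^]\<^bsub>R\<^esub> k]" by (simp add: seq_power_def)
  have S: "submodule ?S R (K.Kz i)"
    unfolding boundaries_def by (rule submodule_image[OF K.module_koszul K.module_koszul K.koszul_diff_hom])
  interpret q: quotient_of_module R "K.Kz i" ?S
    by (rule quotient_of_moduleI[OF K.module_koszul S])
  have SK: "?S \<subseteq> carrier (K.Kz i)" by (rule q.sub.a_subset)
  have coset: "?S +>\<^bsub>K.Kz i\<^esub> z = ?S" if "z \<in> ?S" for z
    using that SK q.coset_eq_S_iff by blast
  show "\<exists>k'\<ge>k. \<forall>c\<in>carrier (koszul_homology R (seq_power R [a, b] k') i).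
       homology_map (koszul R (seq_power R [a, b] k)) (koszul_diff R (seq_power R [a, b] k)) i
         (koszul_transition R [a, b] (k' - k)) c
       = \<zero>\<^bsub>koszul_homology R (seq_power R [a, b] k) i\<^esub>"
  proof (intro exI[of _ k] conjI ballI order_refl)
    fix c assume "c \<in> carrier (koszul_homology R (seq_power R [a, b] k) i)"
    then obtain z where z: "z \<in> a_kernel (K.Kz i) (K.Kz (i - 1)) (K.dz i)"
      and c: "c = ?S +>\<^bsub>K.Kz i\<^esub> z"
      by (auto simp: koszul_homology_def homology_def sp quotient_module_sel A_RCOSETS_def' a_r_coset_def')
    have "z \<in> ?S"
    proof (rule K.koszul_exact)
      show "z \<in> carrier (K.Kz i)" "K.dz i z = (\<lambda>_. \<zero>\<^bsub>R\<^esub>)"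
        using z by (auto simp: a_kernel_def' koszul_def)
    qed (use regular[OF k] nonzerodivisor[OF k] i in auto)
    then have c: "c = ?S" using c coset by simp
    have tr: "koszul_transition R [a, b] (k - k) w = w" if "w \<in> ?S" for w
    proof
      fix T
      have w: "w \<in> carrier (K.Kz i)" using that SK by auto
      have "(\<Otimes>\<^bsub>R\<^esub>j\<in>T. [a, b] ! j [^]\<^bsub>R\<^esub> (0 :: nat)) = \<one>\<^bsub>R\<^esub>" by simp
      then show "koszul_transition R [a, b] (k - k) w T = w T"
        using K.koszulD(1,3)[OF w, of T] by (simp add: koszul_transition_def)
    qed
    have "homology_map K.Kz K.dz i (koszul_transition R [a, b] (k - k)) c = (\<Union>w\<in>?S. ?S)"
      unfolding homology_map_def c by (rule SUP_cong) (simp_all only: tr coset)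
    also have "\<dots> = ?S" using \<open>z \<in> ?S\<close> by auto
    finally show "homology_map (koszul R (seq_power R [a, b] k)) (koszul_diff R (seq_power R [a, b] k)) i
         (koszul_transition R [a, b] (k - k)) c
       = \<zero>\<^bsub>koszul_homology R (seq_power R [a, b] k) i\<^esub>"
      by (simp add: sp koszul_homology_def homology_def quotient_module_sel)
  qed
qed

section \<open>The tensor product of two power series rings\<close>

abbreviation base_ring :: "'k::field ring"
  where "base_ring \<equiv> ring_of_type_algebra"

text \<open>
  \<open>K[[x, y]]\<close> as a \<open>K\<close>-algebra, the target of the comparison map.
\<close>

definition series_module :: "('k::field, 'k fps fps) module"
  where "series_module =
    \<lparr>carrier = UNIV, monoid.mult = (*), monoid.one = 1, ring.zero = 0, ring.add = (+),
     module.smult = (\<lambda>c F. fps_const (fps_const c) * F)\<rparr>"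

abbreviation series_tensor :: "('k::field, ('k fps \<times> 'k fps \<Rightarrow> 'k) set) module"
  where "series_tensor \<equiv> tensor_product base_ring fps_algebra fps_algebra"

lemma base_ring_sel [simp]:
  "carrier base_ring = UNIV" "\<zero>\<^bsub>base_ring\<^esub> = 0" "\<one>\<^bsub>base_ring\<^esub> = 1"
  "x \<oplus>\<^bsub>base_ring\<^esub> y = x + y" "x \<otimes>\<^bsub>base_ring\<^esub> y = x * y"
  by (simp_all add: ring_of_type_algebra_def)

lemma fps_algebra_sel [simp]:
  "carrier fps_algebra = UNIV" "\<zero>\<^bsub>fps_algebra\<^esub> = 0" "\<one>\<^bsub>fps_algebra\<^esub> = 1"
  "x \<oplus>\<^bsub>fps_algebra\<^esub> y = x + y" "x \<otimes>\<^bsub>fps_algebra\<^esub> y = x * y"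
  "c \<odot>\<^bsub>fps_algebra\<^esub> x = fps_const c * x"
  by (simp_all add: fps_algebra_def)

lemma series_module_sel [simp]:
  "carrier series_module = UNIV" "\<zero>\<^bsub>series_module\<^esub> = 0" "\<one>\<^bsub>series_module\<^esub> = 1"
  "x \<oplus>\<^bsub>series_module\<^esub> y = x + y" "x \<otimes>\<^bsub>series_module\<^esub> y = x * y"
  "c \<odot>\<^bsub>series_module\<^esub> x = fps_const (fps_const c) * x"
  by (simp_all add: series_module_def)

lemma cring_base_ring: "cring base_ring"
  by (rule cring_from_type_algebra)

lemma module_fps_algebra: "module base_ring fps_algebra"
  by (rule moduleI[OF cring_base_ring abelian_groupI])
    (auto simp: algebra_simps fps_const_add[symmetric] simp del: fps_const_add intro: exI[of _ "- _"])

lemma module_series_module: "module base_ring series_module"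
  by (rule moduleI[OF cring_base_ring abelian_groupI])
    (auto simp: algebra_simps fps_const_add[symmetric] simp del: fps_const_add intro: exI[of _ "- _"])

interpretation S: tensor_modules base_ring fps_algebra fps_algebra
  by (intro tensor_modules.intro module_fps_algebra)

interpretation L: module base_ring series_module
  by (rule module_series_module)

lemma finsum_series_module: "finite A \<Longrightarrow> finsum series_module f A = sum f A"
  by (induct A rule: finite_induct) (auto simp: L.M.finsum_insert)

lemma finsum_base_ring: "finite A \<Longrightarrow> finsum base_ring f A = sum f A"
  by (induct A rule: finite_induct) (auto simp: S.M.R.finsum_insert)

lemma bilinear_split_product:
  "bilinear base_ring fps_algebra fps_algebra series_module (\<lambda>u v. left_series u * right_series v)"
proof (rule bilinearI, goal_cases)
  case (3 x y y')
  show ?case by (simp only: fps_algebra_sel series_module_sel fps_const_add[symmetric] distrib_left)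
next
  case (5 r x y)
  have "right_series (fps_const r * y) = right_series (fps_const r) * right_series y" by simp
  then show ?case by (simp add: mult_ac del: fps_const_mult)
qed (auto simp: left_series_add left_series_mult distrib_right)

text \<open>
  The comparison map \<open>u \<otimes> v \<mapsto> u(x) v(y)\<close>, and its composite with the projection from formal
  combinations of pairs.
\<close>

definition to_series :: "('k::field fps \<times> 'k fps \<Rightarrow> 'k) set \<Rightarrow> 'k fps fps"
  where "to_series = tensor_lift base_ring series_module (\<lambda>u v. left_series u * right_series v)"

definition pre_series :: "('k::field fps \<times> 'k fps \<Rightarrow> 'k) \<Rightarrow> 'k fps fps"
  where "pre_series h = (\<Sum>p\<in>support base_ring h. fps_const (fps_const (h p)) * (left_series (fst p) * right_series (snd p)))"

lemma to_series_hom: "to_series \<in> module_hom base_ring series_tensor series_module"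
  unfolding to_series_def by (rule S.tensor_lift_hom[OF module_series_module bilinear_split_product])

lemma to_series_pure [simp]: "to_series (S.\<tau> u v) = left_series u * right_series v"
  unfolding to_series_def
  by (rule S.tensor_lift_pure[OF module_series_module bilinear_split_product]) auto

lemma to_series_add: "z \<in> carrier series_tensor \<Longrightarrow> w \<in> carrier series_tensor \<Longrightarrow>
    to_series (z \<oplus>\<^bsub>series_tensor\<^esub> w) = to_series z + to_series w"
  using module_homD(2)[OF to_series_hom] by simp

lemma to_series_zero: "to_series \<zero>\<^bsub>series_tensor\<^esub> = 0"
  using module_hom_zero[OF S.module_tensor_product module_series_module to_series_hom] by simp

lemma to_series_coset:
  assumes "h \<in> carrier (pre_tensor base_ring fps_algebra fps_algebra)"
  shows "to_series (tensor_relations base_ring fps_algebra fps_algebra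
      +>\<^bsub>pre_tensor base_ring fps_algebra fps_algebra\<^esub> h) = pre_series h"
proof -
  have "finite (support base_ring h)"
    using assms unfolding pre_tensor_sel by (rule free_moduleD(2))
  then show ?thesis
    using S.tensor_lift_coset[OF module_series_module bilinear_split_product assms]
    by (simp add: to_series_def pre_series_def linear_extension_def finsum_series_module)
qed

primrec tensor_sum :: "('k::field fps \<times> 'k fps) list \<Rightarrow> ('k fps \<times> 'k fps \<Rightarrow> 'k) set"
  where "tensor_sum [] = \<zero>\<^bsub>series_tensor\<^esub>"
  | "tensor_sum (p # xs) = S.\<tau> (fst p) (snd p) \<oplus>\<^bsub>series_tensor\<^esub> tensor_sum xs"

lemma pure_in [simp]: "S.\<tau> u v \<in> carrier series_tensor"
  by (rule S.pure_tensor_closed) auto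

lemma tensor_sum_in [simp]: "tensor_sum xs \<in> carrier series_tensor"
  by (induct xs) auto

lemma tensor_sum_append: "tensor_sum (xs @ ys) = tensor_sum xs \<oplus>\<^bsub>series_tensor\<^esub> tensor_sum ys"
  by (induct xs) (auto simp: S.T.M.a_assoc)

lemma to_series_tensor_sum: "to_series (tensor_sum xs) = split_sum xs"
  by (induct xs) (auto simp: to_series_zero to_series_add)

lemma ex_tensor_sum:
  assumes "z \<in> carrier series_tensor"
  shows "\<exists>xs. z = tensor_sum xs"
  using assms
proof (induct rule: S.tensor_induct)
  case (pure u v)
  show ?case by (intro exI[of _ "[(u, v)]"]) simp
next
  case (add z z')
  then show ?case by (metis tensor_sum_append)
qed

lemma (in abelian_monoid) finsum_swap:
  assumes "finite I" "finite J" "\<And>i j. i \<in> I \<Longrightarrow> j \<in> J \<Longrightarrow> f i j \<in> carrier G"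
  shows "(\<Oplus>i\<in>I. \<Oplus>j\<in>J. f i j) = (\<Oplus>j\<in>J. \<Oplus>i\<in>I. f i j)"
  using assms(1,3)
proof (induct I)
  case (insert k I)
  have "(\<Oplus>i\<in>insert k I. \<Oplus>j\<in>J. f i j) = (\<Oplus>j\<in>J. f k j) \<oplus> (\<Oplus>i\<in>I. \<Oplus>j\<in>J. f i j)"
    by (rule finsum_insert[OF insert(1,2)]) (auto intro!: finsum_closed insert(4))
  also have "\<dots> = (\<Oplus>j\<in>J. f k j) \<oplus> (\<Oplus>j\<in>J. \<Oplus>i\<in>I. f i j)"
    using insert by simp
  also have "\<dots> = (\<Oplus>j\<in>J. f k j \<oplus> (\<Oplus>i\<in>I. f i j))"
    by (rule finsum_addf[symmetric]) (auto intro!: finsum_closed insert(4))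
  also have "\<dots> = (\<Oplus>j\<in>J. \<Oplus>i\<in>insert k I. f i j)"
    using insert by (intro finsum_cong') (auto intro!: finsum_closed finsum_insert[symmetric])
  finally show ?case .
qed simp

lemma pure_sum_left: "finite A \<Longrightarrow> S.\<tau> (sum f A) v = (\<Oplus>\<^bsub>series_tensor\<^esub>a\<in>A. S.\<tau> (f a) v)"
proof (induct A rule: finite_induct)
  case empty
  show ?case using S.pure_tensor_zero(1)[of v] by simp
next
  case (insert a A)
  then show ?case using S.pure_tensor_simps(1)[of "f a" "sum f A" v] by (simp add: S.T.M.finsum_insert)
qed

lemma pure_sum_right: "finite A \<Longrightarrow> S.\<tau> u (sum f A) = (\<Oplus>\<^bsub>series_tensor\<^esub>a\<in>A. S.\<tau> u (f a))"
proof (induct A rule: finite_induct)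
  case empty
  show ?case using S.pure_tensor_zero(2)[of u] by simp
next
  case (insert a A)
  then show ?case using S.pure_tensor_simps(2)[of u "f a" "sum f A"] by (simp add: S.T.M.finsum_insert)
qed

lemma tensor_sum_nth:
  "tensor_sum xs = (\<Oplus>\<^bsub>series_tensor\<^esub>i\<in>{..<length xs}. S.\<tau> (fst (xs ! i)) (snd (xs ! i)))"
proof (induct xs rule: rev_induct)
  case (snoc p xs)
  have "(\<Oplus>\<^bsub>series_tensor\<^esub>i\<in>insert (length xs) {..<length xs}. S.\<tau> (fst ((xs @ [p]) ! i)) (snd ((xs @ [p]) ! i)))
     = S.\<tau> (fst p) (snd p) \<oplus>\<^bsub>series_tensor\<^esub> (\<Oplus>\<^bsub>series_tensor\<^esub>i\<in>{..<length xs}. S.\<tau> (fst ((xs @ [p]) ! i)) (snd ((xs @ [p]) ! i)))"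
    by (subst S.T.M.finsum_insert) auto
  also have "(\<Oplus>\<^bsub>series_tensor\<^esub>i\<in>{..<length xs}. S.\<tau> (fst ((xs @ [p]) ! i)) (snd ((xs @ [p]) ! i))) = tensor_sum xs"
    unfolding snoc by (rule S.T.M.finsum_cong') (auto simp: nth_append)
  finally show ?case by (simp add: tensor_sum_append lessThan_Suc S.T.M.a_comm)
qed simp

text \<open>
  This is \<open>fps_tensor_relation\<close>, read in the tensor product.
\<close>

lemma tensor_sum_eq_zero:
  assumes "split_sum xs = 0"
  shows "tensor_sum xs = \<zero>\<^bsub>series_tensor\<^esub>"
proof -
  let ?u = "\<lambda>i. fst (xs ! i)" and ?v = "\<lambda>i. snd (xs ! i)" and ?I = "{..<length xs}"
  have "(\<Sum>i\<in>?I. fps_const (?u i $ m) * ?v i) = 0" for m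
    using arg_cong[OF assms, of "\<lambda>F. F $ m"]
    by (simp add: split_sum_nth sum_list_sum_nth atLeast0LessThan case_prod_beta)
  from fps_tensor_relation[OF finite_lessThan this] obtain J c w where J: "J \<subseteq> ?I"
    and u: "\<And>i. i \<in> ?I \<Longrightarrow> ?u i = (\<Sum>j\<in>J. fps_const (c i j) * w j)"
    and c: "\<And>j. j \<in> J \<Longrightarrow> (\<Sum>i\<in>?I. fps_const (c i j) * ?v i) = 0"
    by (elim exE conjE) (rule that, auto)
  have fJ: "finite J" using J finite_subset by blast
  have bal: "S.\<tau> (fps_const r * x) y = S.\<tau> x (fps_const r * y)" for r x y
    using S.pure_tensor_simps(3,4)[of r x y] by simp
  have "tensor_sum xs = (\<Oplus>\<^bsub>series_tensor\<^esub>i\<in>?I. \<Oplus>\<^bsub>series_tensor\<^esub>j\<in>J. S.\<tau> (w j) (fps_const (c i j) * ?v i))"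
    unfolding tensor_sum_nth
    by (rule S.T.M.finsum_cong') (auto simp: u pure_sum_left[OF fJ] bal)
  also have "\<dots> = (\<Oplus>\<^bsub>series_tensor\<^esub>j\<in>J. \<Oplus>\<^bsub>series_tensor\<^esub>i\<in>?I. S.\<tau> (w j) (fps_const (c i j) * ?v i))"
    by (rule S.T.M.finsum_swap) (auto simp: fJ)
  also have "\<dots> = (\<Oplus>\<^bsub>series_tensor\<^esub>j\<in>J. \<zero>\<^bsub>series_tensor\<^esub>)"
  proof (rule S.T.M.finsum_cong')
    fix j assume "j \<in> J"
    then show "(\<Oplus>\<^bsub>series_tensor\<^esub>i\<in>?I. S.\<tau> (w j) (fps_const (c i j) * ?v i)) = \<zero>\<^bsub>series_tensor\<^esub>"
      using c[of j] S.pure_tensor_zero(2)[of "w j"] by (simp add: pure_sum_right[symmetric])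
  qed auto
  finally show ?thesis by simp
qed

lemma to_series_inj:
  assumes "z \<in> carrier series_tensor" "w \<in> carrier series_tensor" "to_series z = to_series w"
  shows "z = w"
proof -
  have "to_series (z \<ominus>\<^bsub>series_tensor\<^esub> w) = 0"
    using module_hom_minus[OF S.module_tensor_product module_series_module to_series_hom assms(1,2)] assms(3)
      L.M.r_neg[of "to_series w"] by (simp add: a_minus_def)
  moreover obtain xs where "z \<ominus>\<^bsub>series_tensor\<^esub> w = tensor_sum xs"
    using ex_tensor_sum assms by (metis S.T.M.minus_closed)
  ultimately have "z \<ominus>\<^bsub>series_tensor\<^esub> w = \<zero>\<^bsub>series_tensor\<^esub>"
    using tensor_sum_eq_zero[of xs] to_series_tensor_sum[of xs] by simp
  then show ?thesis using S.T.minus_eq_zeroD assms(1,2) by blast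
qed

lemma to_series_image: "to_series ` carrier series_tensor = split_series"
proof
  show "to_series ` carrier series_tensor \<subseteq> split_series"
    using ex_tensor_sum to_series_tensor_sum by (fastforce simp: split_series_def)
  show "split_series \<subseteq> to_series ` carrier series_tensor"
    by (auto simp: split_series_def to_series_tensor_sum[symmetric])
qed

text \<open>
  The product on formal combinations is that of the monoid algebra of pairs, on which evaluation is
  multiplicative.
\<close>

lemma pre_mult_closed:
  assumes h: "h \<in> carrier (pre_tensor base_ring fps_algebra fps_algebra)"
    and g: "g \<in> carrier (pre_tensor base_ring fps_algebra fps_algebra)"
  shows "h \<otimes>\<^bsub>pre_tensor base_ring fps_algebra fps_algebra\<^esub> g
      \<in> carrier (pre_tensor base_ring fps_algebra fps_algebra)" (is ?closed)
    and "pre_series (h \<otimes>\<^bsub>pre_tensor base_ring fps_algebra fps_algebra\<^esub> g) = pre_series h * pre_series g" (is ?mult)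
proof -
  let ?H = "support base_ring h" and ?G = "support base_ring g"
  define m where "m z = (fst (fst z) * fst (snd z), snd (fst z) * snd (snd z))"
    for z :: "('a fps \<times> 'a fps) \<times> ('a fps \<times> 'a fps)"
  let ?P = "\<lambda>q. {z \<in> ?H \<times> ?G. m z = q}"
  have fin: "finite ?H" "finite ?G"
    using free_moduleD(2) h g unfolding pre_tensor_sel by blast+
  have eq: "(h \<otimes>\<^bsub>pre_tensor base_ring fps_algebra fps_algebra\<^esub> g) q = (\<Sum>z\<in>?P q. h (fst z) * g (snd z))" for q
  proof -
    have "{(x, y). x \<in> ?H \<and> y \<in> ?G \<and> (fst x \<otimes>\<^bsub>fps_algebra\<^esub> fst y, snd x \<otimes>\<^bsub>fps_algebra\<^esub> snd y) = q} = ?P q"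
      by (auto simp: m_def)
    moreover have "finite (?P q)" using fin by (auto intro: finite_subset[of _ "?H \<times> ?G"])
    ultimately show ?thesis by (simp add: pre_tensor_def finsum_base_ring)
  qed
  let ?Q = "m ` (?H \<times> ?G)"
  let ?hg = "h \<otimes>\<^bsub>pre_tensor base_ring fps_algebra fps_algebra\<^esub> g"
  have zero: "?hg q = 0" if "q \<notin> ?Q" for q
    unfolding eq using that by (intro sum.neutral) auto
  show ?closed
    unfolding pre_tensor_sel
    by (rule free_moduleI[where T = ?Q]) (use fin zero in auto)
  have sup: "support base_ring ?hg \<subseteq> ?Q" using zero by (auto simp: support_def)
  let ?w = "\<lambda>p :: 'a fps \<times> 'a fps. left_series (fst p) * right_series (snd p)"
  let ?c = "\<lambda>x :: 'a. fps_const (fps_const x)"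
  have w: "?w (m z) = ?w (fst z) * ?w (snd z)" for z
  proof -
    have "right_series (snd (fst z) * snd (snd z)) = right_series (snd (fst z)) * right_series (snd (snd z))"
      by simp
    then show ?thesis by (simp add: m_def left_series_mult mult_ac del: fps_const_mult)
  qed
  have "pre_series ?hg = (\<Sum>q\<in>?Q. ?c (?hg q) * ?w q)"
    unfolding pre_series_def using fin sup by (intro sum.mono_neutral_left) (auto simp: support_def)
  also have "\<dots> = (\<Sum>q\<in>?Q. \<Sum>z\<in>?P q. ?c (h (fst z) * g (snd z)) * ?w (m z))"
    unfolding eq by (rule sum.cong) (auto simp: fps_const_sum sum_distrib_right)
  also have "\<dots> = (\<Sum>z\<in>?H \<times> ?G. ?c (h (fst z) * g (snd z)) * ?w (m z))"
    using fin by (intro sum.image_gen[symmetric]) auto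
  also have "\<dots> = (\<Sum>z\<in>?H \<times> ?G. (?c (h (fst z)) * ?w (fst z)) * (?c (g (snd z)) * ?w (snd z)))"
    unfolding w by (rule sum.cong) (auto simp: mult_ac fps_const_mult[symmetric] simp del: fps_const_mult)
  also have "\<dots> = pre_series h * pre_series g"
    unfolding pre_series_def sum_product by (simp add: sum.cartesian_product case_prod_beta)
  finally show ?mult .
qed

text \<open>
  The product of two classes is defined as the union of the classes of all products of representatives.
  These classes all have the same series, so by injectivity of \<open>to_series\<close> they coincide.
\<close>

lemma
  assumes z: "z \<in> carrier series_tensor" and w: "w \<in> carrier series_tensor"
  shows series_tensor_mult_closed: "z \<otimes>\<^bsub>series_tensor\<^esub> w \<in> carrier series_tensor"
    and to_series_mult: "to_series (z \<otimes>\<^bsub>series_tensor\<^esub> w) = to_series z * to_series w"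
proof -
  let ?P = "pre_tensor base_ring fps_algebra fps_algebra"
  let ?S = "tensor_relations base_ring fps_algebra fps_algebra"
  obtain h where h: "h \<in> carrier ?P" "z = ?S +>\<^bsub>?P\<^esub> h" using z by (auto simp: S.carrier_tensor)
  obtain g where g: "g \<in> carrier ?P" "w = ?S +>\<^bsub>?P\<^esub> g" using w by (auto simp: S.carrier_tensor)
  have mem: "h' \<in> carrier ?P \<and> pre_series h' = to_series v"
    if "v = ?S +>\<^bsub>?P\<^esub> h''" "h'' \<in> carrier ?P" "h' \<in> v" for v h' h''
  proof -
    have h': "h' \<in> carrier ?P"
      using that S.Q.sub.a_subset S.P.M.a_r_coset_subset_G by blast
    have "?S +>\<^bsub>?P\<^esub> h'' = ?S +>\<^bsub>?P\<^esub> h'"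
      using S.P.M.a_repr_independence[OF _ that(2) S.Q.sub.a_subgroup] that by blast
    then show ?thesis using h' that(1) by (simp add: to_series_coset[symmetric])
  qed
  have one: "?S +>\<^bsub>?P\<^esub> (h' \<otimes>\<^bsub>?P\<^esub> g') = ?S +>\<^bsub>?P\<^esub> (h \<otimes>\<^bsub>?P\<^esub> g)" if "h' \<in> z" "g' \<in> w" for h' g'
  proof (rule to_series_inj)
    note h' = mem[OF h(2,1) that(1)] and g' = mem[OF g(2,1) that(2)]
    show "?S +>\<^bsub>?P\<^esub> (h' \<otimes>\<^bsub>?P\<^esub> g') \<in> carrier series_tensor"
      "?S +>\<^bsub>?P\<^esub> (h \<otimes>\<^bsub>?P\<^esub> g) \<in> carrier series_tensor"
      unfolding S.carrier_tensor using h' g' h g by (auto intro!: imageI pre_mult_closed)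
    show "to_series (?S +>\<^bsub>?P\<^esub> (h' \<otimes>\<^bsub>?P\<^esub> g')) = to_series (?S +>\<^bsub>?P\<^esub> (h \<otimes>\<^bsub>?P\<^esub> g))"
      using h' g' h g by (simp add: to_series_coset pre_mult_closed)
  qed
  have "h \<in> z" "g \<in> w" unfolding h(2) g(2) using h(1) g(1) S.Q.sub.a_rcos_self by auto
  moreover have "z \<otimes>\<^bsub>series_tensor\<^esub> w = (\<Union>h'\<in>z. \<Union>g'\<in>w. ?S +>\<^bsub>?P\<^esub> (h' \<otimes>\<^bsub>?P\<^esub> g'))"
    unfolding tensor_product_def quotient_module_sel rcoset_mult_def ..
  ultimately have zw: "z \<otimes>\<^bsub>series_tensor\<^esub> w = ?S +>\<^bsub>?P\<^esub> (h \<otimes>\<^bsub>?P\<^esub> g)"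
    using one by blast
  show "z \<otimes>\<^bsub>series_tensor\<^esub> w \<in> carrier series_tensor"
    unfolding zw S.carrier_tensor using h g by (auto intro!: imageI pre_mult_closed)
  show "to_series (z \<otimes>\<^bsub>series_tensor\<^esub> w) = to_series z * to_series w"
    unfolding zw using h g by (simp add: to_series_coset pre_mult_closed)
qed

lemma series_tensor_one: "\<one>\<^bsub>series_tensor\<^esub> = S.\<tau> 1 1"
  by (simp add: tensor_product_def quotient_module_sel pure_tensor_def pre_tensor_def)

lemma to_series_one: "to_series \<one>\<^bsub>series_tensor\<^esub> = 1"
  by (simp add: series_tensor_one)

lemma cring_series_tensor: "cring (series_tensor :: ('k::field, _) module)"
proof (rule cringI)
  note closed = series_tensor_mult_closed S.T.M.a_closed
  note simps = to_series_mult to_series_add to_series_one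
  have one: "\<one>\<^bsub>series_tensor\<^esub> \<in> carrier (series_tensor :: ('k, _) module)" by (simp add: series_tensor_one)
  show "abelian_group (series_tensor :: ('k, _) module)" by (rule S.T.M.abelian_group_axioms)
  show "comm_monoid (series_tensor :: ('k, _) module)"
  proof (rule comm_monoidI)
    show "\<one>\<^bsub>series_tensor\<^esub> \<in> carrier (series_tensor :: ('k, _) module)" by (rule one)
    fix x y z :: "('k fps \<times> 'k fps \<Rightarrow> 'k) set" assume x: "x \<in> carrier series_tensor"
    then show "\<one>\<^bsub>series_tensor\<^esub> \<otimes>\<^bsub>series_tensor\<^esub> x = x"
      by (intro to_series_inj) (simp_all only: one closed simps mult_1_left)
    assume y: "y \<in> carrier series_tensor"
    show "x \<otimes>\<^bsub>series_tensor\<^esub> y \<in> carrier series_tensor" using x y by (rule closed)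
    show "x \<otimes>\<^bsub>series_tensor\<^esub> y = y \<otimes>\<^bsub>series_tensor\<^esub> x"
      using x y by (intro to_series_inj) (simp_all only: closed simps mult.commute)
    assume "z \<in> carrier series_tensor"
    then show "x \<otimes>\<^bsub>series_tensor\<^esub> y \<otimes>\<^bsub>series_tensor\<^esub> z = x \<otimes>\<^bsub>series_tensor\<^esub> (y \<otimes>\<^bsub>series_tensor\<^esub> z)"
      using x y by (intro to_series_inj) (simp_all only: closed simps mult.assoc)
  qed
  fix x y z :: "('k fps \<times> 'k fps \<Rightarrow> 'k) set" assume "x \<in> carrier series_tensor" "y \<in> carrier series_tensor" "z \<in> carrier series_tensor"
  then show "(x \<oplus>\<^bsub>series_tensor\<^esub> y) \<otimes>\<^bsub>series_tensor\<^esub> z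
      = x \<otimes>\<^bsub>series_tensor\<^esub> z \<oplus>\<^bsub>series_tensor\<^esub> y \<otimes>\<^bsub>series_tensor\<^esub> z"
    by (intro to_series_inj) (simp_all only: closed simps distrib_right)
qed

section \<open>Weak proregularity\<close>

interpretation A: cring "series_tensor :: ('k::field, _) module"
  by (rule cring_series_tensor)

type_synonym 'k tensor = "('k fps \<times> 'k fps \<Rightarrow> 'k) set"

definition of_series :: "'k::field fps fps \<Rightarrow> 'k tensor"
  where "of_series F = inv_into (carrier series_tensor) to_series F"

lemma of_series_closed [simp]: "F \<in> split_series \<Longrightarrow> of_series F \<in> carrier series_tensor"
  and to_of_series [simp]: "F \<in> split_series \<Longrightarrow> to_series (of_series F) = F"
  unfolding of_series_def by (auto simp: to_series_image[symmetric] inv_into_into f_inv_into_f)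

lemma to_series_split [simp]: "z \<in> carrier series_tensor \<Longrightarrow> to_series z \<in> split_series"
  using to_series_image by blast

lemma to_series_uminus: "z \<in> carrier series_tensor \<Longrightarrow> to_series (\<ominus>\<^bsub>series_tensor\<^esub> z) = - to_series z"
  using to_series_add[of z "\<ominus>\<^bsub>series_tensor\<^esub> z"]
  by (simp add: S.T.M.r_neg to_series_zero minus_unique)

lemma to_series_minus:
  "z \<in> carrier series_tensor \<Longrightarrow> w \<in> carrier series_tensor \<Longrightarrow>
    to_series (z \<ominus>\<^bsub>series_tensor\<^esub> w) = to_series z - to_series w"
  by (simp add: a_minus_def to_series_add to_series_uminus)

lemma to_series_pow:
  "z \<in> carrier series_tensor \<Longrightarrow> to_series (z [^]\<^bsub>series_tensor\<^esub> (n :: nat)) = to_series z ^ n"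
  by (induct n) (auto simp: to_series_one to_series_mult mult.commute)

lemmas to_series_simps = to_series_add to_series_mult to_series_uminus to_series_minus to_series_pow
  to_series_zero to_series_one

abbreviation left_var :: "'k::field tensor"
  where "left_var \<equiv> pure_tensor base_ring fps_algebra fps_algebra fps_X 1"

abbreviation right_var :: "'k::field tensor"
  where "right_var \<equiv> pure_tensor base_ring fps_algebra fps_algebra 1 fps_X"

abbreviation right_X :: "'k::field fps fps"
  where "right_X \<equiv> right_series fps_X"

abbreviation var_ideal :: "'k::field tensor set"
  where "var_ideal \<equiv> Idl\<^bsub>series_tensor\<^esub> {left_var, right_var}"

lemma weakly_proregular_var_ideal: "weakly_proregular series_tensor (var_ideal :: 'k::field tensor set)"
  unfolding weakly_proregular_def
proof (intro exI[of _ "[left_var, right_var]"] conjI)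
  show "weakly_proregular_seq series_tensor [left_var, right_var :: 'k tensor]"
  proof (rule weakly_proregular_pair[OF cring_series_tensor pure_in pure_in])
    fix k :: nat and p q :: "'k tensor"
    assume k: "k > 0" and p: "p \<in> carrier series_tensor" and q: "q \<in> carrier series_tensor"
      and eq: "left_var [^]\<^bsub>series_tensor\<^esub> k \<otimes>\<^bsub>series_tensor\<^esub> p \<oplus>\<^bsub>series_tensor\<^esub>
        right_var [^]\<^bsub>series_tensor\<^esub> k \<otimes>\<^bsub>series_tensor\<^esub> q = \<zero>\<^bsub>series_tensor\<^esub>"
    have "fps_X ^ k * to_series p + right_X ^ k * to_series q = 0"
      using arg_cong[OF eq, of to_series] p q by (simp add: to_series_simps)
    from split_series_regular[OF to_series_split[OF q] this]
    obtain Z where Z: "Z \<in> split_series" "to_series p = - (right_X ^ k * Z)" "to_series q = fps_X ^ k * Z"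
      by blast
    show "\<exists>z\<in>carrier series_tensor. p = \<ominus>\<^bsub>series_tensor\<^esub> (right_var [^]\<^bsub>series_tensor\<^esub> k \<otimes>\<^bsub>series_tensor\<^esub> z) \<and>
        q = left_var [^]\<^bsub>series_tensor\<^esub> k \<otimes>\<^bsub>series_tensor\<^esub> z"
    proof (intro bexI[of _ "of_series Z"] conjI)
      show "p = \<ominus>\<^bsub>series_tensor\<^esub> (right_var [^]\<^bsub>series_tensor\<^esub> k \<otimes>\<^bsub>series_tensor\<^esub> of_series Z)"
        by (rule to_series_inj) (use p Z in \<open>simp_all add: to_series_simps\<close>)
      show "q = left_var [^]\<^bsub>series_tensor\<^esub> k \<otimes>\<^bsub>series_tensor\<^esub> of_series Z"
        by (rule to_series_inj) (use q Z in \<open>simp_all add: to_series_simps\<close>)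
    qed (use Z in simp)
  next
    fix k :: nat and z :: "'k tensor"
    assume z: "z \<in> carrier series_tensor"
      and eq: "left_var [^]\<^bsub>series_tensor\<^esub> k \<otimes>\<^bsub>series_tensor\<^esub> z = \<zero>\<^bsub>series_tensor\<^esub>"
    have "to_series z = 0"
      using arg_cong[OF eq, of to_series] z by (simp add: to_series_simps)
    then show "z = \<zero>\<^bsub>series_tensor\<^esub>"
      by (intro to_series_inj) (use z in \<open>simp_all add: to_series_zero\<close>)
  qed
qed auto

lemma ideal_of_series_set:
  assumes zero: "0 \<in> I" and add: "\<And>F G. F \<in> I \<Longrightarrow> G \<in> I \<Longrightarrow> F + G \<in> I"
    and mult: "\<And>F G. F \<in> I \<Longrightarrow> G \<in> split_series \<Longrightarrow> G * F \<in> I"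
  shows "ideal {z \<in> carrier series_tensor. to_series z \<in> I} (series_tensor :: ('k::field, _) module)"
proof (rule idealI)
  show "ring (series_tensor :: ('k, _) module)" by (rule A.ring_axioms)
  have neg: "- F \<in> I" if "F \<in> I" for F
    using mult[OF that, of "-1"] split_series_uminus[OF split_series_1] by simp
  show "subgroup {z \<in> carrier series_tensor. to_series z \<in> I} (add_monoid (series_tensor :: ('k, _) module))"
    by (rule S.T.M.add.subgroupI) (auto simp: to_series_simps add neg zero intro: exI[of _ "\<zero>\<^bsub>series_tensor\<^esub>"])
  fix z w :: "'k tensor" assume z: "z \<in> {z \<in> carrier series_tensor. to_series z \<in> I}" and w: "w \<in> carrier series_tensor"
  show "w \<otimes>\<^bsub>series_tensor\<^esub> z \<in> {z \<in> carrier series_tensor. to_series z \<in> I}"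
    using z w mult by (simp add: to_series_simps)
  show "z \<otimes>\<^bsub>series_tensor\<^esub> w \<in> {z \<in> carrier series_tensor. to_series z \<in> I}"
    using z w mult[of "to_series z" "to_series w"] by (simp add: to_series_simps mult.commute)
qed

section \<open>The tensor product is not noetherian\<close>

definition lacunary_tail :: "nat \<Rightarrow> 'k::field fps fps"
  where "lacunary_tail n = left_series (fps_shift n lacunary) - right_series (fps_shift n lacunary)"

lemma lacunary_tail_split: "lacunary_tail n \<in> split_series"
  unfolding lacunary_tail_def by (intro split_series_diff left_series_split right_series_split)

lemma lacunary_tail_Suc:
  "lacunary_tail n = fps_X * lacunary_tail (Suc n) + (fps_X - right_X) * right_series (fps_shift (Suc n) lacunary)"
proof -
  let ?f = "fps_shift (Suc n) lacunary :: 'a fps" and ?c = "fps_const (fps_shift n lacunary $ 0) :: 'a fps"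
  have f: "fps_shift n lacunary = ?c + fps_X * ?f"
  proof -
    have "fps_shift 1 (fps_shift n lacunary :: 'a fps) = ?f" by (simp add: fps_eq_iff)
    then show ?thesis using fps_shift_split[of "fps_shift n lacunary :: 'a fps"] by (simp only:)
  qed
  have "left_series (fps_shift n lacunary) = right_series ?c + fps_X * left_series ?f"
    by (subst f) (simp only: left_series_add left_series_mult left_series_const left_series_X)
  moreover have "right_series (fps_shift n lacunary) = right_series ?c + right_X * right_series ?f"
    by (subst f) (simp only: fps_const_add[symmetric] fps_const_mult[symmetric])
  ultimately show ?thesis unfolding lacunary_tail_def by (simp only: algebra_simps)
qed

lemma lacunary_tail_0_expand:
  "\<exists>c\<in>split_series. (lacunary_tail 0 :: 'k::field fps fps) = fps_X ^ n * lacunary_tail n + (fps_X - right_X) * c"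
proof (induct n)
  case 0
  show ?case by (rule bexI[OF _ split_series_0]) simp
next
  case (Suc n)
  then obtain c :: "'k fps fps" where c: "c \<in> split_series"
    "lacunary_tail 0 = fps_X ^ n * lacunary_tail n + (fps_X - right_X) * c" by blast
  let ?r = "right_series (fps_shift (Suc n) lacunary) :: 'k fps fps"
  have "lacunary_tail 0 = fps_X ^ Suc n * lacunary_tail (Suc n) + (fps_X - right_X) * (fps_X ^ n * ?r + c)"
    unfolding c(2) lacunary_tail_Suc[of n] by (simp add: algebra_simps)
  moreover have "fps_X ^ n * ?r + c \<in> split_series"
    by (intro split_series_add split_series_mult split_series_power split_series_X right_series_split c)
  ultimately show ?case by blast
qed

text \<open>
  If the chain of the ideals \<open>(g\<^sub>n, x - y)\<close>, with \<open>g\<^sub>n\<close> the \<open>n\<close>-th \<open>lacunary_tail\<close>, stops at \<open>n\<close>, then modulo \<open>x - y\<close> one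
  gets \<open>g\<^sub>n\<^sub>+\<^sub>1 = r g\<^sub>n = r x g\<^sub>n\<^sub>+\<^sub>1\<close>.  So \<open>1 - r x\<close> annihilates \<open>g\<^sub>n\<^sub>+\<^sub>1\<close> and hence \<open>g\<^sub>0\<close>,
  against \<open>lacunary_diagonal\<close>.
\<close>

lemma not_noetherian_series_tensor: "\<not> noetherian_ring (series_tensor :: ('k::field, _) module)"
proof
  assume "noetherian_ring (series_tensor :: ('k, _) module)"
  then interpret N: noetherian_ring "series_tensor :: ('k, _) module" .
  define I :: "nat \<Rightarrow> 'k fps fps set"
    where "I n = {r * lacunary_tail n + (fps_X - right_X) * c | r c. r \<in> split_series \<and> c \<in> split_series}" for n
  define C where "C n = {z \<in> carrier series_tensor. to_series z \<in> I n}" for n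
  have IE: "\<exists>r\<in>split_series. \<exists>c\<in>split_series. F = r * lacunary_tail n + (fps_X - right_X) * c" if "F \<in> I n" for F n
    using that by (auto simp: I_def)
  have II: "r * lacunary_tail n + (fps_X - right_X) * c \<in> I n" if "r \<in> split_series" "c \<in> split_series" for r c n
    using that by (auto simp: I_def)
  have ideal: "ideal (C n) series_tensor" for n
    unfolding C_def
  proof (rule ideal_of_series_set)
    show "0 \<in> I n" using II[OF split_series_0 split_series_0, of n] by simp
    fix F G :: "'k fps fps" assume F: "F \<in> I n"
    obtain r c where rc: "r \<in> split_series" "c \<in> split_series" "F = r * lacunary_tail n + (fps_X - right_X) * c"
      using IE[OF F] by blast
    {
      assume "G \<in> I n"
      then obtain r' c' where rc': "r' \<in> split_series" "c' \<in> split_series" "G = r' * lacunary_tail n + (fps_X - right_X) * c'"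
        using IE by blast
      have "F + G = (r + r') * lacunary_tail n + (fps_X - right_X) * (c + c')"
        unfolding rc rc' by (simp add: algebra_simps)
      then show "F + G \<in> I n" using II rc rc' split_series_add by metis
    }
    assume G: "G \<in> split_series"
    have "G * F = (G * r) * lacunary_tail n + (fps_X - right_X) * (G * c)"
      unfolding rc by (simp add: algebra_simps)
    then show "G * F \<in> I n" using II rc G split_series_mult by metis
  qed
  have step: "I n \<subseteq> I (Suc n)" for n
  proof
    fix F assume "F \<in> I n"
    then obtain r c where rc: "r \<in> split_series" "c \<in> split_series" "F = r * lacunary_tail n + (fps_X - right_X) * c"
      using IE by blast
    let ?s = "right_series (fps_shift (Suc n) lacunary) :: 'k fps fps"
    have "F = (r * fps_X) * lacunary_tail (Suc n) + (fps_X - right_X) * (r * ?s + c)"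
      unfolding rc lacunary_tail_Suc[of n] by (simp add: algebra_simps)
    moreover have "r * fps_X \<in> split_series" "r * ?s + c \<in> split_series"
      by (intro split_series_add split_series_mult split_series_X right_series_split rc)+
    ultimately show "F \<in> I (Suc n)" using II by metis
  qed
  have mono: "C m \<subseteq> C n" if "m \<le> n" for m n
    using lift_Suc_mono_le[of I m n, OF step that] by (auto simp: C_def)
  have "subset.chain {I. ideal I series_tensor} (range C)"
  proof -
    have "C m \<subseteq> C n \<or> C n \<subseteq> C m" for m n
      by (cases m n rule: le_cases) (simp_all add: mono)
    then show ?thesis unfolding subset_chain_def using ideal by blast
  qed
  from N.ideal_chain_is_trivial[OF _ this] obtain n where "\<Union> (range C) = C n" by auto
  then have sub: "C (Suc n) \<subseteq> C n" by blast
  have tail: "(lacunary_tail (Suc n) :: 'k fps fps) \<in> split_series" by (rule lacunary_tail_split)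
  have "of_series (lacunary_tail (Suc n)) \<in> C (Suc n)"
    using II[OF split_series_1 split_series_0, of "Suc n"] tail by (simp add: C_def)
  from subsetD[OF sub this] have "lacunary_tail (Suc n) \<in> I n"
    using tail by (simp add: C_def)
  then obtain r c :: "'k fps fps" where rc: "r \<in> split_series" "c \<in> split_series"
    "lacunary_tail (Suc n) = r * lacunary_tail n + (fps_X - right_X) * c"
    using IE by blast
  let ?s = "right_series (fps_shift (Suc n) lacunary) :: 'k fps fps"
  \<comment> \<open>The constant coefficient of \<open>?b\<close> is \<open>1\<close>.\<close>
  let ?b = "1 - r * fps_X" and ?c = "r * ?s + c"
  have b: "?b * lacunary_tail (Suc n) = (fps_X - right_X) * ?c"
    using rc(3) unfolding lacunary_tail_Suc[of n] by (simp add: algebra_simps)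
  obtain e :: "'k fps fps" where e: "e \<in> split_series"
    "lacunary_tail 0 = fps_X ^ Suc n * lacunary_tail (Suc n) + (fps_X - right_X) * e"
    using lacunary_tail_0_expand by blast
  have "?b * (left_series lacunary - right_series lacunary) = ?b * lacunary_tail 0"
    by (simp add: lacunary_tail_def)
  also have "\<dots> = fps_X ^ Suc n * (?b * lacunary_tail (Suc n)) + (fps_X - right_X) * (?b * e)"
    unfolding e(2) by (simp add: algebra_simps)
  also have "\<dots> = (fps_X - right_X) * (fps_X ^ Suc n * ?c + ?b * e)"
    unfolding b by (simp add: algebra_simps)
  finally have eq: "?b * (left_series lacunary - right_series lacunary)
      = (fps_X - right_X) * (fps_X ^ Suc n * ?c + ?b * e)" .
  have bs: "?b \<in> split_series"
    by (intro split_series_diff split_series_1 split_series_mult rc split_series_X)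
  have "fps_X ^ Suc n * ?c + ?b * e \<in> split_series"
    by (intro split_series_add split_series_mult split_series_power bs e rc split_series_X right_series_split)
  from lacunary_diagonal[OF bs this eq] show False by simp
qed

section \<open>The adic completion\<close>

definition order_ideal :: "nat \<Rightarrow> 'k::field tensor set"
  where "order_ideal n = {z \<in> carrier series_tensor. to_series z \<in> order_ge n}"

lemma order_ideal_ideal: "ideal (order_ideal n) (series_tensor :: ('k::field, _) module)"
  unfolding order_ideal_def
  by (rule ideal_of_series_set) (auto intro: order_ge_0 order_ge_add order_ge_mult)

lemma order_ideal_Suc_decompose:
  assumes "z \<in> order_ideal (Suc n)"
  shows "\<exists>g\<in>order_ideal n. \<exists>h\<in>order_ideal n.
    z = g \<otimes>\<^bsub>series_tensor\<^esub> left_var \<oplus>\<^bsub>series_tensor\<^esub> h \<otimes>\<^bsub>series_tensor\<^esub> right_var"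
proof -
  have z: "z \<in> carrier series_tensor" "to_series z \<in> order_ge (Suc n)" using assms by (auto simp: order_ideal_def)
  from order_ge_Suc_decompose[OF z(2) to_series_split[OF z(1)]]
  obtain G H where GH: "G \<in> order_ge n" "G \<in> split_series" "H \<in> order_ge n" "H \<in> split_series"
    "to_series z = fps_X * G + right_X * H" by blast
  show ?thesis
  proof (intro bexI)
    show "z = of_series G \<otimes>\<^bsub>series_tensor\<^esub> left_var \<oplus>\<^bsub>series_tensor\<^esub> of_series H \<otimes>\<^bsub>series_tensor\<^esub> right_var"
      by (rule to_series_inj) (use z GH in \<open>simp_all add: to_series_simps mult.commute\<close>)
  qed (use GH in \<open>simp_all add: order_ideal_def\<close>)
qed

lemma var_ideal_eq: "var_ideal = (order_ideal 1 :: 'k::field tensor set)"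
proof
  have "left_var \<in> (order_ideal 1 :: 'k tensor set)" "right_var \<in> (order_ideal 1 :: 'k tensor set)"
    by (auto simp: order_ideal_def order_ge_def)
  then show "var_ideal \<subseteq> (order_ideal 1 :: 'k tensor set)"
    by (intro A.genideal_minimal[OF order_ideal_ideal]) simp
  have id: "ideal (var_ideal :: 'k tensor set) series_tensor" by (rule A.genideal_ideal) auto
  have gen: "left_var \<in> (var_ideal :: 'k tensor set)" "right_var \<in> (var_ideal :: 'k tensor set)"
    using A.genideal_self[of "{left_var, right_var}"] by auto
  show "order_ideal 1 \<subseteq> (var_ideal :: 'k tensor set)"
  proof
    fix z :: "'k tensor" assume "z \<in> order_ideal 1"
    then obtain g h where "g \<in> order_ideal 0" "h \<in> order_ideal 0"
      "z = g \<otimes>\<^bsub>series_tensor\<^esub> left_var \<oplus>\<^bsub>series_tensor\<^esub> h \<otimes>\<^bsub>series_tensor\<^esub> right_var"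
      using order_ideal_Suc_decompose[of z 0] by auto
    then show "z \<in> var_ideal"
      using ideal.I_l_closed[OF id gen(1)] ideal.I_l_closed[OF id gen(2)]
        additive_subgroup.a_closed[OF ideal.axioms(1)[OF id]]
      by (auto simp: order_ideal_def)
  qed
qed

lemma ideal_power_var_ideal: "ideal_power series_tensor (var_ideal :: 'k::field tensor set) n = order_ideal n"
proof (induct n)
  case 0
  show ?case by (auto simp: ideal_power_def ideals_set_def order_ideal_def order_ge_zero nat_pow_def)
next
  case (Suc n)
  have "ideal_power series_tensor (var_ideal :: 'k tensor set) (Suc n)
      = ideal_power series_tensor var_ideal n \<cdot>\<^bsub>series_tensor\<^esub> var_ideal"
    by (simp add: ideal_power_def ideals_set_def nat_pow_def)
  also have "\<dots> = order_ideal n \<cdot>\<^bsub>series_tensor\<^esub> order_ideal 1"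
    unfolding Suc unfolding var_ideal_eq ..
  also have "\<dots> = order_ideal (Suc n)"
  proof
    show "order_ideal n \<cdot>\<^bsub>series_tensor\<^esub> order_ideal 1 \<subseteq> (order_ideal (Suc n) :: 'k tensor set)"
    proof
      fix z :: "'k tensor" assume "z \<in> order_ideal n \<cdot>\<^bsub>series_tensor\<^esub> order_ideal 1"
      then show "z \<in> order_ideal (Suc n)"
      proof (induct rule: ideal_prod.induct)
        case (prod i j)
        then have i: "i \<in> carrier series_tensor" "to_series i \<in> order_ge n" by (auto simp: order_ideal_def)
        obtain g h where gh: "g \<in> carrier series_tensor" "h \<in> carrier series_tensor"
          "j = g \<otimes>\<^bsub>series_tensor\<^esub> left_var \<oplus>\<^bsub>series_tensor\<^esub> h \<otimes>\<^bsub>series_tensor\<^esub> right_var"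
          using order_ideal_Suc_decompose[of j 0] prod(2) by (auto simp: order_ideal_def)
        have "to_series (i \<otimes>\<^bsub>series_tensor\<^esub> j)
            = fps_X * (to_series g * to_series i) + right_X * (to_series h * to_series i)"
          using i gh by (simp add: to_series_simps algebra_simps)
        also have "\<dots> \<in> order_ge (Suc n)"
          by (intro order_ge_add order_ge_left_X order_ge_right_X order_ge_mult i)
        finally show ?case using i gh by (simp add: order_ideal_def)
      next
        case (sum z w)
        then show ?case by (auto simp: order_ideal_def to_series_simps order_ge_add)
      qed
    qed
    show "(order_ideal (Suc n) :: 'k tensor set) \<subseteq> order_ideal n \<cdot>\<^bsub>series_tensor\<^esub> order_ideal 1"
    proof
      fix z :: "'k tensor" assume "z \<in> order_ideal (Suc n)"
      then obtain g h where gh: "g \<in> order_ideal n" "h \<in> order_ideal n"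
        "z = g \<otimes>\<^bsub>series_tensor\<^esub> left_var \<oplus>\<^bsub>series_tensor\<^esub> h \<otimes>\<^bsub>series_tensor\<^esub> right_var"
        using order_ideal_Suc_decompose by blast
      have "left_var \<in> order_ideal 1" "right_var \<in> order_ideal 1"
        by (auto simp: order_ideal_def order_ge_def)
      then show "z \<in> order_ideal n \<cdot>\<^bsub>series_tensor\<^esub> order_ideal 1"
        unfolding gh(3) by (intro ideal_prod.intros gh)
    qed
  qed
  finally show ?case .
qed

text \<open>
  The coset of the \<open>n\<close>-th power of the ideal that approximates \<open>F\<close> to order \<open>n\<close>; here \<open>F\<close> is any series in
  two variables, not necessarily split.
\<close>

definition series_coset :: "nat \<Rightarrow> 'k::field fps fps \<Rightarrow> 'k tensor set"
  where "series_coset n F = {z \<in> carrier series_tensor. to_series z - F \<in> order_ge n}"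

definition complete_series :: "'k::field fps fps \<Rightarrow> nat \<Rightarrow> 'k tensor set"
  where "complete_series F k = series_coset (Suc k) F"

abbreviation completion :: "('k::field tensor, nat \<Rightarrow> 'k tensor set) module"
  where "completion \<equiv> adic_completion series_tensor var_ideal"

lemma series_coset_nonempty: "\<exists>z\<in>carrier series_tensor. z \<in> series_coset n F"
proof -
  obtain G where G: "G \<in> split_series" "F - G \<in> order_ge n" using split_series_dense by blast
  then have "of_series G \<in> series_coset n F"
    using order_ge_uminus[of "F - G" n] by (simp add: series_coset_def)
  then show ?thesis using G by (intro bexI[of _ "of_series G"]) auto
qed

lemma series_coset_eqI:
  assumes "F - G \<in> order_ge n"
  shows "series_coset n F = series_coset n G"
proof -
  have "F' - F \<in> order_ge n \<longleftrightarrow> F' - G \<in> order_ge n" for F'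
    using order_ge_add[OF _ assms, of "F' - F"] order_ge_diff[OF _ assms, of "F' - G"] by auto
  then show ?thesis by (auto simp: series_coset_def)
qed

lemma series_coset_eq_iff: "series_coset n F = series_coset n G \<longleftrightarrow> F - G \<in> order_ge n"
proof
  assume eq: "series_coset n F = series_coset n G"
  obtain z where z: "z \<in> series_coset n F" using series_coset_nonempty by blast
  then have "to_series z - G \<in> order_ge n" "to_series z - F \<in> order_ge n"
    using eq by (auto simp: series_coset_def)
  from order_ge_diff[OF this] show "F - G \<in> order_ge n" by simp
qed (rule series_coset_eqI)

lemma series_coset_eq_coset:
  assumes z: "z \<in> carrier series_tensor"
  shows "order_ideal n +>\<^bsub>series_tensor\<^esub> z = series_coset n (to_series z)"
proof
  show "order_ideal n +>\<^bsub>series_tensor\<^esub> z \<subseteq> series_coset n (to_series z)"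
    using z by (auto simp: a_r_coset_def' order_ideal_def series_coset_def to_series_simps)
  show "series_coset n (to_series z) \<subseteq> order_ideal n +>\<^bsub>series_tensor\<^esub> z"
  proof
    fix w assume w: "w \<in> series_coset n (to_series z)"
    then have "w \<ominus>\<^bsub>series_tensor\<^esub> z \<in> order_ideal n"
      using z by (simp add: series_coset_def order_ideal_def to_series_simps)
    moreover have "w = (w \<ominus>\<^bsub>series_tensor\<^esub> z) \<oplus>\<^bsub>series_tensor\<^esub> z"
      by (rule to_series_inj) (use w z in \<open>simp_all add: series_coset_def to_series_simps\<close>)
    ultimately show "w \<in> order_ideal n +>\<^bsub>series_tensor\<^esub> z" by (auto simp: a_r_coset_def')
  qed
qed

lemma ex_series_coset: "\<exists>z\<in>carrier series_tensor. series_coset n F = order_ideal n +>\<^bsub>series_tensor\<^esub> z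
    \<and> to_series z - F \<in> order_ge n"
proof -
  obtain z where z: "z \<in> carrier series_tensor" "z \<in> series_coset n F" using series_coset_nonempty by blast
  then have "to_series z - F \<in> order_ge n" by (simp add: series_coset_def)
  moreover have "series_coset n F = order_ideal n +>\<^bsub>series_tensor\<^esub> z"
    using series_coset_eqI[OF \<open>to_series z - F \<in> order_ge n\<close>] series_coset_eq_coset[OF z(1)] by simp
  ultimately show ?thesis using z(1) by blast
qed

lemma carrier_quotient_order_ideal: "carrier (series_tensor Quot order_ideal n) = range (series_coset n)"
proof
  show "carrier (series_tensor Quot order_ideal n) \<subseteq> range (series_coset n)"
    by (auto simp: FactRing_def A_RCOSETS_def' series_coset_eq_coset)
  show "range (series_coset n) \<subseteq> carrier (series_tensor Quot order_ideal n)"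
    using ex_series_coset by (fastforce simp: FactRing_def A_RCOSETS_def')
qed

lemma
  fixes F G :: "'k::field fps fps"
  shows series_coset_add: "series_coset n F <+>\<^bsub>series_tensor\<^esub> series_coset n G = series_coset n (F + G)"
    and series_coset_mult: "[mod order_ideal n:] series_coset n F \<Otimes>\<^bsub>series_tensor\<^esub> series_coset n G = series_coset n (F * G)"
proof -
  interpret I: ideal "order_ideal n" "series_tensor :: ('k, _) module" by (rule order_ideal_ideal)
  interpret I: abelian_subgroup "order_ideal n" "series_tensor :: ('k, _) module"
    by (rule abelian_subgroupI3[OF I.additive_subgroup_axioms S.T.M.abelian_group_axioms])
  obtain z where z: "z \<in> carrier series_tensor" "series_coset n F = order_ideal n +>\<^bsub>series_tensor\<^esub> z"
    "to_series z - F \<in> order_ge n" using ex_series_coset by blast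
  obtain w where w: "w \<in> carrier series_tensor" "series_coset n G = order_ideal n +>\<^bsub>series_tensor\<^esub> w"
    "to_series w - G \<in> order_ge n" using ex_series_coset by blast
  show "series_coset n F <+>\<^bsub>series_tensor\<^esub> series_coset n G = series_coset n (F + G)"
    unfolding z w I.a_rcos_sum[OF z(1) w(1)]
    using z w order_ge_add[OF z(3) w(3)]
    by (simp add: series_coset_eq_coset to_series_simps series_coset_eq_iff algebra_simps)
  have "to_series z * to_series w - F * G = to_series z * (to_series w - G) + G * (to_series z - F)"
    by (simp add: algebra_simps)
  also have "\<dots> \<in> order_ge n" by (intro order_ge_add order_ge_mult z w)
  finally show "[mod order_ideal n:] series_coset n F \<Otimes>\<^bsub>series_tensor\<^esub> series_coset n G = series_coset n (F * G)"
    unfolding z w I.rcoset_mult_add[OF z(1) w(1)]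
    using z w by (simp add: series_coset_eq_coset to_series_simps series_coset_eq_iff)
qed

lemma order_ideal_add_coset: "order_ideal n <+>\<^bsub>series_tensor\<^esub> series_coset (Suc n) F = series_coset n F"
proof
  have mono: "G \<in> order_ge (Suc n) \<Longrightarrow> G \<in> order_ge n" for G
    using order_ge_mono[of n "Suc n"] by auto
  show "order_ideal n <+>\<^bsub>series_tensor\<^esub> series_coset (Suc n) F \<subseteq> series_coset n F"
    using order_ge_add[OF _ mono] by (auto simp: set_add_def' order_ideal_def series_coset_def to_series_simps add_diff_eq[symmetric])
  show "series_coset n F \<subseteq> order_ideal n <+>\<^bsub>series_tensor\<^esub> series_coset (Suc n) F"
  proof
    fix w assume w: "w \<in> series_coset n F"
    obtain z where z: "z \<in> carrier series_tensor" "z \<in> series_coset (Suc n) F" using series_coset_nonempty by blast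
    have "to_series w - F \<in> order_ge n" "to_series z - F \<in> order_ge n"
      using w z mono by (auto simp: series_coset_def)
    from order_ge_diff[OF this] have "w \<ominus>\<^bsub>series_tensor\<^esub> z \<in> order_ideal n"
      using w z by (simp add: series_coset_def order_ideal_def to_series_simps)
    moreover have "w = (w \<ominus>\<^bsub>series_tensor\<^esub> z) \<oplus>\<^bsub>series_tensor\<^esub> z"
      by (rule to_series_inj) (use w z in \<open>simp_all add: series_coset_def to_series_simps\<close>)
    ultimately show "w \<in> order_ideal n <+>\<^bsub>series_tensor\<^esub> series_coset (Suc n) F"
      using z(2) by (auto simp: set_add_def')
  qed
qed

lemma completion_sel:
  fixes x y :: "nat \<Rightarrow> 'k::field tensor set" and r :: "'k tensor"
  shows "carrier (completion :: ('k tensor, _) module) = {x. \<forall>k. x k \<in> range (series_coset (Suc k)) \<and>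
      order_ideal (Suc k) <+>\<^bsub>series_tensor\<^esub> x (Suc k) = x k}"
  "x \<otimes>\<^bsub>completion\<^esub> y = (\<lambda>k. [mod order_ideal (Suc k):] x k \<Otimes>\<^bsub>series_tensor\<^esub> y k)"
  "\<one>\<^bsub>completion\<^esub> = (\<lambda>k. order_ideal (Suc k) +>\<^bsub>series_tensor\<^esub> \<one>\<^bsub>series_tensor :: ('k, _) module\<^esub>)"
  "\<zero>\<^bsub>completion\<^esub> = (\<lambda>k. order_ideal (Suc k) :: 'k tensor set)"
  "x \<oplus>\<^bsub>completion\<^esub> y = (\<lambda>k. x k <+>\<^bsub>series_tensor\<^esub> y k)"
  "r \<odot>\<^bsub>completion\<^esub> x = (\<lambda>k. [mod order_ideal (Suc k):] (order_ideal (Suc k) +>\<^bsub>series_tensor\<^esub> r) \<Otimes>\<^bsub>series_tensor\<^esub> x k)"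
  by (simp_all add: adic_completion_def Let_def ideal_power_var_ideal carrier_quotient_order_ideal)
    (simp_all add: FactRing_def)

lemma complete_series_closed [simp]: "complete_series F \<in> carrier completion"
  by (simp add: completion_sel complete_series_def order_ideal_add_coset)

lemma complete_series_simps:
  "complete_series F \<oplus>\<^bsub>completion\<^esub> complete_series G = complete_series (F + G)"
  "complete_series F \<otimes>\<^bsub>completion\<^esub> complete_series G = complete_series (F * G)"
  "z \<in> carrier series_tensor \<Longrightarrow> z \<odot>\<^bsub>completion\<^esub> complete_series F = complete_series (to_series z * F)"
  by (simp_all add: completion_sel complete_series_def fun_eq_iff series_coset_add series_coset_mult series_coset_eq_coset)

lemma complete_series_one: "\<one>\<^bsub>completion\<^esub> = complete_series 1"
proof -
  have "\<one>\<^bsub>series_tensor :: ('a, _) module\<^esub> \<in> carrier series_tensor" by (simp add: series_tensor_one)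
  then show ?thesis
    by (simp add: completion_sel complete_series_def fun_eq_iff series_coset_eq_coset to_series_one)
qed

lemma complete_series_zero: "\<zero>\<^bsub>completion\<^esub> = complete_series 0"
  by (simp add: completion_sel complete_series_def fun_eq_iff series_coset_def order_ideal_def)

lemma complete_series_eq_iff: "complete_series F = complete_series G \<longleftrightarrow> F = G"
proof
  assume "complete_series F = complete_series G"
  then have "F - G \<in> order_ge (Suc k)" for k
    by (simp add: complete_series_def fun_eq_iff series_coset_eq_iff)
  then have "F - G \<in> order_ge k" for k using order_ge_mono[of k "Suc k"] by auto
  then show "F = G" using order_ge_separated[of "F - G"] by simp
qed simp

text \<open>
  In a compatible family of approximations \<open>F k\<close> the coefficient of \<open>x\<^sup>i y\<^sup>j\<close> is constant from
  \<open>k = i + j\<close> on, and these coefficients make up the limit.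
\<close>

lemma carrier_completion:
  "carrier (completion :: ('k::field tensor, _) module) = range complete_series"
proof
  show "carrier (completion :: ('k tensor, _) module) \<subseteq> range complete_series"
  proof
    fix x assume x: "x \<in> carrier (completion :: ('k tensor, _) module)"
    have "\<exists>F. \<forall>k. x k = series_coset (Suc k) (F k)"
      using x unfolding completion_sel by (intro choice) blast
    then obtain F where F: "\<And>k. x k = series_coset (Suc k) (F k)" by blast
    have step: "F (Suc k) - F k \<in> order_ge (Suc k)" for k
      using x by (simp add: completion_sel F order_ideal_add_coset series_coset_eq_iff)
    have far: "F (k + m) - F k \<in> order_ge (Suc k)" for k m
    proof (induct m)
      case (Suc m)
      have "F (k + Suc m) - F (k + m) \<in> order_ge (Suc k)"
        using step[of "k + m"] order_ge_mono[of "Suc k" "Suc (k + m)"] by auto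
      from order_ge_add[OF this Suc] show ?case by simp
    qed (simp add: order_ge_0)
    define L where "L = Abs_fps (\<lambda>i. Abs_fps (\<lambda>j. F (i + j) $ i $ j))"
    have "F k - L \<in> order_ge (Suc k)" for k
    proof -
      have "(F k - L) $ i $ j = 0" if "i + j < Suc k" for i j
      proof -
        have "F (i + j + (k - (i + j))) - F (i + j) \<in> order_ge (Suc (i + j))" by (rule far)
        then have "(F k - F (i + j)) $ i $ j = 0" using that by (simp add: order_ge_def)
        then show ?thesis by (simp add: L_def)
      qed
      then show ?thesis by (simp add: order_ge_def)
    qed
    then have "x = complete_series L"
      by (simp add: fun_eq_iff F complete_series_def series_coset_eq_iff)
    then show "x \<in> range complete_series" by blast
  qed
qed auto

lemma completion_cases:
  assumes "x \<in> carrier completion"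
  obtains F where "x = complete_series F"
  using assms unfolding carrier_completion by blast

lemma abelian_group_completion: "abelian_group (completion :: ('k::field tensor, _) module)"
proof (rule abelian_groupI)
  fix x y z assume x: "x \<in> carrier (completion :: ('k tensor, _) module)"
  then obtain F where F: "x = complete_series F" by (rule completion_cases)
  show "\<zero>\<^bsub>completion\<^esub> \<oplus>\<^bsub>completion\<^esub> x = x"
    unfolding F complete_series_zero complete_series_simps by simp
  show "\<exists>y\<in>carrier completion. y \<oplus>\<^bsub>completion\<^esub> x = \<zero>\<^bsub>completion\<^esub>"
    unfolding F complete_series_zero
    by (rule bexI[of _ "complete_series (- F)"]) (simp_all add: complete_series_simps)
  assume y: "y \<in> carrier (completion :: ('k tensor, _) module)"
  then obtain G where G: "y = complete_series G" by (rule completion_cases)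
  show "x \<oplus>\<^bsub>completion\<^esub> y \<in> carrier completion"
    unfolding F G complete_series_simps by simp
  show "x \<oplus>\<^bsub>completion\<^esub> y = y \<oplus>\<^bsub>completion\<^esub> x"
    unfolding F G complete_series_simps by (simp add: add.commute)
  assume z: "z \<in> carrier (completion :: ('k tensor, _) module)"
  then obtain H where H: "z = complete_series H" by (rule completion_cases)
  show "x \<oplus>\<^bsub>completion\<^esub> y \<oplus>\<^bsub>completion\<^esub> z = x \<oplus>\<^bsub>completion\<^esub> (y \<oplus>\<^bsub>completion\<^esub> z)"
    unfolding F G H complete_series_simps by (simp add: add.assoc)
qed (simp add: complete_series_zero)

lemma ring_completion: "ring (completion :: ('k::field tensor, _) module)"
proof (rule ringI[OF abelian_group_completion])
  show "Group.monoid (completion :: ('k tensor, _) module)"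
    by (rule monoidI) (auto simp: complete_series_one complete_series_simps mult.assoc elim!: completion_cases)
qed (auto simp: complete_series_simps algebra_simps elim!: completion_cases)

lemma module_completion: "module series_tensor (completion :: ('k::field tensor, _) module)"
  by (rule moduleI[OF cring_series_tensor abelian_group_completion])
    (auto simp: complete_series_simps to_series_simps algebra_simps series_tensor_mult_closed elim!: completion_cases)

section \<open>The completion is noetherian and adically flat\<close>

lemma noetherian_completion: "noetherian_ring (completion :: ('k::field tensor, _) module)"
proof (rule ring.noetherian_ringI[OF ring_completion])
  interpret C: ring "completion :: ('k tensor, _) module" by (rule ring_completion)
  fix I assume I: "ideal I (completion :: ('k tensor, _) module)"
  interpret I: ideal I "completion :: ('k tensor, _) module" by (rule I)
  let ?J = "{F. complete_series F \<in> I}"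
  have "\<exists>S\<subseteq>?J. finite S \<and> (\<forall>J. 0 \<in> J \<longrightarrow> S \<subseteq> J \<longrightarrow> (\<forall>F\<in>J. \<forall>F'\<in>J. F + F' \<in> J) \<longrightarrow>
    (\<forall>c. \<forall>F\<in>J. c * F \<in> J) \<longrightarrow> ?J \<subseteq> J)"
    by (rule fps_fps_ideal_finitely_generated)
      (use I.zero_closed I.a_closed I.I_l_closed[OF _ complete_series_closed] in
        \<open>auto simp: complete_series_zero complete_series_simps[symmetric]\<close>)
  then obtain S where S: "S \<subseteq> ?J" "finite S" and gen: "\<And>J. 0 \<in> J \<Longrightarrow> S \<subseteq> J \<Longrightarrow>
    (\<forall>F\<in>J. \<forall>F'\<in>J. F + F' \<in> J) \<Longrightarrow> (\<forall>c. \<forall>F\<in>J. c * F \<in> J) \<Longrightarrow> ?J \<subseteq> J"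
    by blast
  let ?G = "complete_series ` S"
  have G: "?G \<subseteq> carrier completion" by auto
  interpret K: ideal "Idl\<^bsub>completion\<^esub> ?G" "completion :: ('k tensor, _) module" by (rule C.genideal_ideal[OF G])
  have "?J \<subseteq> {F. complete_series F \<in> Idl\<^bsub>completion\<^esub> ?G}"
  proof (rule gen)
    show "S \<subseteq> {F. complete_series F \<in> Idl\<^bsub>completion\<^esub> ?G}"
      using C.genideal_self[OF G] by auto
  qed (use K.zero_closed K.a_closed K.I_l_closed[OF _ complete_series_closed] in
      \<open>auto simp: complete_series_zero complete_series_simps[symmetric]\<close>)
  then have "I \<subseteq> Idl\<^bsub>completion\<^esub> ?G"
    using I.Icarr by (blast elim: completion_cases)
  moreover have "Idl\<^bsub>completion\<^esub> ?G \<subseteq> I" by (rule C.genideal_minimal[OF I]) (use S in auto)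
  ultimately show "\<exists>A\<subseteq>carrier completion. finite A \<and> I = Idl\<^bsub>completion\<^esub> A"
    using S G by (intro exI[of _ ?G]) auto
qed

text \<open>
  Removing the terms without \<open>x\<close>, which form a split series, leaves a multiple of \<open>x\<close>.
\<close>

lemma dense_extension_completion:
  "dense_extension series_tensor (completion :: ('k::field tensor, _) module) left_var (complete_series 1)"
proof (intro dense_extension.intro dense_extension_axioms.intro module_completion)
  fix m assume "m \<in> carrier (completion :: ('k tensor, _) module)"
  then obtain F where F: "m = complete_series F" by (rule completion_cases)
  have r: "right_series (F $ 0) \<in> split_series" by (rule right_series_split)
  have "m = of_series (right_series (F $ 0)) \<odot>\<^bsub>completion\<^esub> complete_series 1 \<oplus>\<^bsub>completion\<^esub>
      left_var \<odot>\<^bsub>completion\<^esub> complete_series (fps_shift 1 F)"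
    using fps_shift_split[of F] r by (simp add: F complete_series_simps complete_series_eq_iff)
  then show "\<exists>a\<in>carrier series_tensor. \<exists>m'\<in>carrier completion.
      m = a \<odot>\<^bsub>completion\<^esub> complete_series 1 \<oplus>\<^bsub>completion\<^esub> left_var \<odot>\<^bsub>completion\<^esub> m'"
    using of_series_closed[OF r] complete_series_closed by blast
  fix a :: "'k tensor" assume a: "a \<in> carrier series_tensor"
    and eq: "left_var \<odot>\<^bsub>completion\<^esub> m = a \<odot>\<^bsub>completion\<^esub> complete_series 1"
  have "fps_X * F = to_series a"
    using eq a by (simp add: F complete_series_simps complete_series_eq_iff)
  then have "F \<in> split_series"
    using split_series_X_power_cancel[of 1 F] to_series_split[OF a] by simp
  then show "\<exists>b\<in>carrier series_tensor. m = b \<odot>\<^bsub>completion\<^esub> complete_series 1"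
    by (intro bexI[of _ "of_series F"]) (simp_all add: F complete_series_simps)
next
  fix a :: "'k tensor" assume a: "a \<in> carrier series_tensor" and "a \<odot>\<^bsub>completion\<^esub> complete_series 1 = \<zero>\<^bsub>completion\<^esub>"
  then have "to_series a = 0" by (simp add: complete_series_simps complete_series_eq_iff complete_series_zero)
  then show "a = \<zero>\<^bsub>series_tensor\<^esub>"
    by (intro to_series_inj) (use a in \<open>simp_all add: to_series_zero\<close>)
qed simp_all

lemma left_var_pow_mem: "left_var [^]\<^bsub>series_tensor\<^esub> k \<in> ideal_power series_tensor (var_ideal :: 'k::field tensor set) k"
proof -
  have "fps_X ^ k \<in> order_ge k" by (auto simp: order_ge_def)
  then show ?thesis by (simp add: ideal_power_var_ideal order_ideal_def to_series_pow)
qed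

lemma adically_flat_completion:
  "adically_flat TYPE('n) series_tensor (var_ideal :: 'k::field tensor set) completion"
  unfolding adically_flat_def
proof (intro allI impI)
  fix N :: "('k tensor, 'n) module" and i :: nat
  assume N: "module series_tensor N \<and> adic_torsion series_tensor var_ideal N" and i: "i > 0"
  show "carrier (Tor series_tensor i N completion) = {\<zero>\<^bsub>Tor series_tensor i N completion\<^esub>}"
  proof (rule Tor_torsion_eq_zero[OF dense_extension_completion _ _ i])
    show "module series_tensor N" using N by blast
    show "\<exists>n::nat. left_var [^]\<^bsub>series_tensor\<^esub> n \<odot>\<^bsub>N\<^esub> x = \<zero>\<^bsub>N\<^esub>" if "x \<in> carrier N" for x
      using N that left_var_pow_mem unfolding adic_torsion_def by blast
  qed
qed

section \<open>The completion is not flat\<close>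

text \<open>
  \<open>(f(x) - f(y)) / (x - y)\<close>.
\<close>

definition divided_difference :: "'k::field fps \<Rightarrow> 'k fps fps"
  where "divided_difference f = Abs_fps (\<lambda>i. Abs_fps (\<lambda>j. f $ (i + j + 1)))"

lemma divided_difference:
  "left_series f - right_series f = (fps_X - right_X) * divided_difference f"
proof (rule fps_ext, rule fps_ext)
  fix i j
  show "(left_series f - right_series f) $ i $ j = ((fps_X - right_X) * divided_difference f) $ i $ j"
    by (cases i; cases j) (simp_all add: left_diff_distrib divided_difference_def)
qed

definition difference_ideal :: "'k::field tensor set"
  where "difference_ideal = {z \<in> carrier series_tensor. \<exists>r\<in>split_series. \<exists>s\<in>split_series.
    to_series z = r * (left_series lacunary - right_series lacunary) + s * (fps_X - right_X)}"

text \<open>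
  The value at the origin of the coefficient of \<open>f(x) - f(y)\<close> in an element of the ideal generated by
  \<open>f(x) - f(y)\<close> and \<open>x - y\<close>, with \<open>f\<close> the lacunary series.
\<close>

definition lacunary_coefficient :: "'k::field tensor \<Rightarrow> 'k"
  where "lacunary_coefficient z = (SOME c. \<exists>r\<in>split_series. \<exists>s\<in>split_series. c = r $ 0 $ 0 \<and>
    to_series z = r * (left_series lacunary - right_series lacunary) + s * (fps_X - right_X))"

text \<open>
  Two expressions of the same element differ by a relation \<open>b (f(x) - f(y)) = (x - y) c\<close>, and \<open>b\<close> vanishes
  at the origin by \<open>lacunary_diagonal\<close>.
\<close>

lemma lacunary_coefficient_eq:
  assumes r: "r \<in> split_series" and s: "s \<in> split_series"
    and z: "to_series z = r * (left_series lacunary - right_series lacunary) + s * (fps_X - right_X)"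
  shows "lacunary_coefficient z = r $ 0 $ 0"
  unfolding lacunary_coefficient_def
proof (rule some_equality)
  fix c assume "\<exists>r\<in>split_series. \<exists>s\<in>split_series. c = r $ 0 $ 0 \<and>
    to_series z = r * (left_series lacunary - right_series lacunary) + s * (fps_X - right_X)"
  then obtain r' s' where rs': "r' \<in> split_series" "s' \<in> split_series" "c = r' $ 0 $ 0"
    "to_series z = r' * (left_series lacunary - right_series lacunary) + s' * (fps_X - right_X)" by blast
  have "(r' - r) * (left_series lacunary - right_series lacunary) = (fps_X - right_X) * (s - s')"
    using z rs'(4) by (simp add: algebra_simps)
  from lacunary_diagonal[OF split_series_diff[OF rs'(1) r] split_series_diff[OF s rs'(2)] this]
  show "c = r $ 0 $ 0" by (simp add: rs'(3))
qed (use assms in blast)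

lemma difference_idealE:
  assumes "z \<in> difference_ideal"
  obtains r s where "z \<in> carrier series_tensor" "r \<in> split_series" "s \<in> split_series"
    "to_series z = r * (left_series lacunary - right_series lacunary) + s * (fps_X - right_X)"
    "lacunary_coefficient z = r $ 0 $ 0"
  using assms lacunary_coefficient_eq unfolding difference_ideal_def by blast

lemma lacunary_coefficient_add:
  assumes "z \<in> difference_ideal" "w \<in> difference_ideal"
  shows "z \<oplus>\<^bsub>series_tensor\<^esub> w \<in> difference_ideal"
    and "lacunary_coefficient (z \<oplus>\<^bsub>series_tensor\<^esub> w) = lacunary_coefficient z + lacunary_coefficient w"
proof -
  obtain r s where z: "z \<in> carrier series_tensor" "r \<in> split_series" "s \<in> split_series"
    "to_series z = r * (left_series lacunary - right_series lacunary) + s * (fps_X - right_X)"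
    "lacunary_coefficient z = r $ 0 $ 0" using assms(1) by (rule difference_idealE)
  obtain r' s' where w: "w \<in> carrier series_tensor" "r' \<in> split_series" "s' \<in> split_series"
    "to_series w = r' * (left_series lacunary - right_series lacunary) + s' * (fps_X - right_X)"
    "lacunary_coefficient w = r' $ 0 $ 0" using assms(2) by (rule difference_idealE)
  have rs: "r + r' \<in> split_series" "s + s' \<in> split_series" by (intro split_series_add z w)+
  have eq: "to_series (z \<oplus>\<^bsub>series_tensor\<^esub> w)
      = (r + r') * (left_series lacunary - right_series lacunary) + (s + s') * (fps_X - right_X)"
    unfolding to_series_add[OF z(1) w(1)] z(4) w(4) by (simp add: algebra_simps)
  show "z \<oplus>\<^bsub>series_tensor\<^esub> w \<in> difference_ideal"
    using eq rs z(1) w(1) unfolding difference_ideal_def by blast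
  show "lacunary_coefficient (z \<oplus>\<^bsub>series_tensor\<^esub> w) = lacunary_coefficient z + lacunary_coefficient w"
    using lacunary_coefficient_eq[OF rs eq] z(5) w(5) by simp
qed

lemma lacunary_coefficient_mult:
  assumes "a \<in> carrier series_tensor" "w \<in> difference_ideal"
  shows "a \<otimes>\<^bsub>series_tensor\<^esub> w \<in> difference_ideal"
    and "lacunary_coefficient (a \<otimes>\<^bsub>series_tensor\<^esub> w) = to_series a $ 0 $ 0 * lacunary_coefficient w"
proof -
  obtain r s where w: "w \<in> carrier series_tensor" "r \<in> split_series" "s \<in> split_series"
    "to_series w = r * (left_series lacunary - right_series lacunary) + s * (fps_X - right_X)"
    "lacunary_coefficient w = r $ 0 $ 0" using assms(2) by (rule difference_idealE)
  have rs: "to_series a * r \<in> split_series" "to_series a * s \<in> split_series"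
    using assms(1) by (intro split_series_mult to_series_split w; simp)+
  have eq: "to_series (a \<otimes>\<^bsub>series_tensor\<^esub> w)
      = (to_series a * r) * (left_series lacunary - right_series lacunary) + (to_series a * s) * (fps_X - right_X)"
    unfolding to_series_mult[OF assms(1) w(1)] w(4) by (simp add: algebra_simps)
  show "a \<otimes>\<^bsub>series_tensor\<^esub> w \<in> difference_ideal"
    using eq rs series_tensor_mult_closed[OF assms(1) w(1)] unfolding difference_ideal_def by blast
  show "lacunary_coefficient (a \<otimes>\<^bsub>series_tensor\<^esub> w) = to_series a $ 0 $ 0 * lacunary_coefficient w"
    using lacunary_coefficient_eq[OF rs eq] w(5) by simp
qed

text \<open>
  An ideal, or the ring itself, as a module.  The algebra of the tensor product carries only the
  scalar multiplication of the base field.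
\<close>

definition regular_module :: "('r, 'c) ring_scheme \<Rightarrow> 'r set \<Rightarrow> ('r, 'r) module"
  where "regular_module R I = \<lparr>carrier = I, monoid.mult = monoid.mult R, monoid.one = \<one>\<^bsub>R\<^esub>,
    ring.zero = \<zero>\<^bsub>R\<^esub>, ring.add = ring.add R, module.smult = monoid.mult R\<rparr>"

lemma regular_module_sel [simp]:
  "carrier (regular_module R I) = I" "\<zero>\<^bsub>regular_module R I\<^esub> = \<zero>\<^bsub>R\<^esub>"
  "x \<oplus>\<^bsub>regular_module R I\<^esub> y = x \<oplus>\<^bsub>R\<^esub> y" "r \<odot>\<^bsub>regular_module R I\<^esub> x = r \<otimes>\<^bsub>R\<^esub> x"
  by (simp_all add: regular_module_def)

lemma (in ideal) module_regular_module:
  assumes "cring R"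
  shows "module R (regular_module R I)"
proof -
  interpret cring R by fact
  show ?thesis
  proof (rule moduleI[OF assms])
    show "abelian_group (regular_module R I)"
    proof (rule abelian_groupI)
      fix x assume "x \<in> carrier (regular_module R I)"
      then show "\<exists>y\<in>carrier (regular_module R I). y \<oplus>\<^bsub>regular_module R I\<^esub> x = \<zero>\<^bsub>regular_module R I\<^esub>"
        by (intro bexI[of _ "\<ominus> x"]) (auto simp: l_neg)
    qed (auto simp: a_ac)
  qed (auto simp: I_l_closed l_distr r_distr m_assoc)
qed

text \<open>
  The residue field at the origin.
\<close>

definition residue_module :: "('k::field tensor, 'k) module"
  where "residue_module = \<lparr>carrier = UNIV, monoid.mult = (*), monoid.one = 1, ring.zero = 0,
    ring.add = (+), module.smult = (\<lambda>a c. to_series a $ 0 $ 0 * c)\<rparr>"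

lemma residue_module_sel [simp]:
  "carrier residue_module = UNIV" "\<zero>\<^bsub>residue_module\<^esub> = 0" "x \<oplus>\<^bsub>residue_module\<^esub> y = x + y"
  "a \<odot>\<^bsub>residue_module\<^esub> x = to_series a $ 0 $ 0 * x"
  by (simp_all add: residue_module_def)

lemma module_residue_module: "module series_tensor (residue_module :: ('k::field tensor, 'k) module)"
  by (rule moduleI[OF cring_series_tensor abelian_groupI])
    (auto simp: to_series_simps algebra_simps intro: exI[of _ "- _"])

definition completion_residue :: "(nat \<Rightarrow> 'k::field tensor set) \<Rightarrow> 'k"
  where "completion_residue m = inv_into UNIV complete_series m $ 0 $ 0"

lemma completion_residue: "completion_residue (complete_series F) = F $ 0 $ 0"
  by (simp add: completion_residue_def inv_into_f_f inj_on_def complete_series_eq_iff)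

lemma ideal_difference_ideal: "ideal difference_ideal (series_tensor :: ('k::field, _) module)"
proof -
  let ?g = "left_series lacunary - right_series lacunary :: 'k fps fps" and ?d = "fps_X - right_X :: 'k fps fps"
  let ?I = "{F. \<exists>r\<in>split_series. \<exists>s\<in>split_series. F = r * ?g + s * ?d}"
  have "ideal {z \<in> carrier series_tensor. to_series z \<in> ?I} series_tensor"
  proof (rule ideal_of_series_set)
    show "0 \<in> ?I" using split_series_0 by (intro CollectI bexI[of _ 0]) auto
    fix F G :: "'k fps fps" assume "F \<in> ?I"
    then obtain r s where rs: "r \<in> split_series" "s \<in> split_series" "F = r * ?g + s * ?d" by blast
    {
      assume "G \<in> ?I"
      then obtain r' s' where rs': "r' \<in> split_series" "s' \<in> split_series" "G = r' * ?g + s' * ?d" by blast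
      have "F + G = (r + r') * ?g + (s + s') * ?d" unfolding rs(3) rs'(3) by (simp only: algebra_simps)
      then show "F + G \<in> ?I" using split_series_add[OF rs(1) rs'(1)] split_series_add[OF rs(2) rs'(2)] by blast
    }
    assume G: "G \<in> split_series"
    have "G * F = (G * r) * ?g + (G * s) * ?d" unfolding rs(3) by (simp only: algebra_simps)
    then show "G * F \<in> ?I" using split_series_mult[OF G rs(1)] split_series_mult[OF G rs(2)] by blast
  qed
  then show ?thesis unfolding difference_ideal_def mem_Collect_eq .
qed

lemma bilinear_residue:
  "bilinear series_tensor (regular_module series_tensor difference_ideal) completion residue_module
    (\<lambda>z m. lacunary_coefficient z * completion_residue m)"
proof (rule bilinearI, goal_cases)
  case (2 z w m)
  then show ?case by (simp add: lacunary_coefficient_add distrib_right)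
next
  case (3 z m m')
  then show ?case
    by (auto elim!: completion_cases simp: complete_series_simps completion_residue distrib_left)
next
  case (4 r z m)
  then show ?case by (simp add: lacunary_coefficient_mult)
next
  case (5 r z m)
  then show ?case
    by (auto elim!: completion_cases simp: complete_series_simps completion_residue)
qed simp

text \<open>
  With \<open>g = f(x) - f(y)\<close>, \<open>d = x - y\<close> and \<open>g = d h\<close> in the completion, the tensors \<open>g \<otimes> 1\<close> and \<open>d \<otimes> h\<close> become
  equal over the whole ring, since both factors can be moved to the right.  Over the ideal \<open>(g, d)\<close> the
  bilinear map that multiplies the coefficient of \<open>g\<close> at the origin by the residue of the second
  factor takes the values \<open>1\<close> and \<open>0\<close> on them.
\<close>

lemma not_flat_completion:
  "\<not> flat TYPE('k tensor) series_tensor (completion :: ('k::field tensor, _) module)"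
proof
  assume flat: "flat TYPE('k tensor) series_tensor (completion :: ('k tensor, _) module)"
  let ?N' = "regular_module series_tensor difference_ideal :: ('k tensor, 'k tensor) module"
  let ?N = "regular_module series_tensor (carrier series_tensor) :: ('k tensor, 'k tensor) module"
  have sub: "difference_ideal \<subseteq> carrier (series_tensor :: ('k, _) module)"
    by (auto simp: difference_ideal_def)
  have N': "module series_tensor ?N'"
    by (rule ideal.module_regular_module[OF ideal_difference_ideal cring_series_tensor])
  have N: "module series_tensor ?N"
    by (rule ideal.module_regular_module[OF A.oneideal cring_series_tensor])
  have incl: "(\<lambda>z. z) \<in> module_hom series_tensor ?N' ?N"
    using sub by (auto simp: module_hom_def)
  interpret TF: tensor_functor series_tensor ?N' "completion :: ('k tensor, _) module" ?N completion
      "\<lambda>z. z" "\<lambda>m. m"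
    by (intro tensor_functor.intro tensor_modules.intro tensor_functor_axioms.intro N N' incl module_completion)
      (simp add: module_hom_def)
  \<comment> \<open>Flatness is applied to the inclusion of the ideal into the ring.\<close>
  have inj: "inj_on (tensor_map series_tensor ?N completion (\<lambda>z. z) (\<lambda>m. m)) (carrier TF.S.T)"
    using flat N N' incl unfolding flat_def by (auto simp: inj_on_def[of "\<lambda>z. z"])
  let ?G = "left_series lacunary - right_series lacunary :: 'k fps fps" and ?D = "fps_X - right_X :: 'k fps fps"
  let ?h = "divided_difference lacunary :: 'k fps fps"
  have split: "?G \<in> split_series" "?D \<in> split_series"
    using right_series_split left_series_split split_series_X split_series_diff by blast+
  define g where "g = of_series ?G"
  define d where "d = of_series ?D"
  have g: "g \<in> carrier series_tensor" "to_series g = 1 * ?G + 0 * ?D"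
    and d: "d \<in> carrier series_tensor" "to_series d = 0 * ?G + 1 * ?D"
    using split by (simp_all add: g_def d_def)
  have mem: "g \<in> difference_ideal" "d \<in> difference_ideal"
    using g d split_series_0 split_series_1 unfolding difference_ideal_def by blast+
  have pure: "TF.T.\<tau> z (complete_series F) = TF.T.\<tau> \<one>\<^bsub>series_tensor\<^esub> (complete_series (to_series z * F))"
    if z: "z \<in> carrier series_tensor" for z and F :: "'k fps fps"
  proof -
    have one: "\<one>\<^bsub>series_tensor\<^esub> \<in> carrier ?N" by (simp add: series_tensor_one)
    have "TF.T.\<tau> (z \<odot>\<^bsub>?N\<^esub> \<one>\<^bsub>series_tensor\<^esub>) (complete_series F)
        = TF.T.\<tau> \<one>\<^bsub>series_tensor\<^esub> (z \<odot>\<^bsub>completion\<^esub> complete_series F)"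
      using TF.T.pure_tensor_simps(3,4)[OF z one complete_series_closed] by simp
    then show ?thesis using z by (simp add: complete_series_simps A.r_one)
  qed
  have "TF.T.\<tau> g (complete_series 1) = TF.T.\<tau> d (complete_series ?h)"
    unfolding pure[OF g(1)] pure[OF d(1)] g(2) d(2) by (simp add: divided_difference)
  then have "tensor_map series_tensor ?N completion (\<lambda>z. z) (\<lambda>m. m) (TF.S.\<tau> g (complete_series 1))
      = tensor_map series_tensor ?N completion (\<lambda>z. z) (\<lambda>m. m) (TF.S.\<tau> d (complete_series ?h))"
    using mem by (simp add: TF.tensor_map_pure)
  then have eq: "TF.S.\<tau> g (complete_series 1) = TF.S.\<tau> d (complete_series ?h)"
    using inj mem by (auto simp: inj_on_def TF.S.pure_tensor_closed)
  have "lacunary_coefficient g * completion_residue (complete_series 1)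
      = lacunary_coefficient d * completion_residue (complete_series ?h)"
    using arg_cong[OF eq, of "tensor_lift series_tensor residue_module (\<lambda>z m. lacunary_coefficient z * completion_residue m)"]
      mem by (simp add: TF.S.tensor_lift_pure[OF module_residue_module bilinear_residue])
  then show False
    unfolding lacunary_coefficient_eq[OF split_series_1 split_series_0 g(2)]
      lacunary_coefficient_eq[OF split_series_0 split_series_1 d(2)]
    by (simp add: completion_residue)
qed

theorem theorem6p2:
  fixes K :: "'k::field_char_0 ring"
    and A :: "('k, ('k fps \<times> 'k fps \<Rightarrow> 'k) set) module"
    and t1 t2 :: "('k fps \<times> 'k fps \<Rightarrow> 'k) set"
    and \<aa> :: "('k fps \<times> 'k fps \<Rightarrow> 'k) set set"
    and Ahat :: "(('k fps \<times> 'k fps \<Rightarrow> 'k) set, nat \<Rightarrow> ('k fps \<times> 'k fps \<Rightarrow> 'k) set set) module"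
  assumes "K = ring_of_type_algebra"
    and "A = tensor_product K fps_algebra fps_algebra"
    and "t1 = pure_tensor K fps_algebra fps_algebra fps_X 1"
    and "t2 = pure_tensor K fps_algebra fps_algebra 1 fps_X"
    and "\<aa> = Idl\<^bsub>A\<^esub> {t1, t2}"
    and "Ahat = adic_completion A \<aa>"
  shows "weakly_proregular A \<aa> \<and>
    \<not> noetherian_ring A \<and>
    noetherian_ring Ahat \<and>
    adically_flat TYPE('n) A \<aa> Ahat \<and>
    \<not> flat TYPE(('k fps \<times> 'k fps \<Rightarrow> 'k) set) A Ahat"
  unfolding assms
  by (intro conjI weakly_proregular_var_ideal not_noetherian_series_tensor noetherian_completion
      adically_flat_completion not_flat_completion)

end
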